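(* Let $m\in\mathbb N$ be odd, let $\Psi_1,\ldots,\Psi_m$ be bounded sets of positive kernel operators on $L^2(X,\mu)$, and let $r\in\{\rho,\hat\rho\}$. Then $$\big\|\Psi_1^{(\frac1m)}\circ\cdots\circ\Psi_m^{(\frac1m)}\big\|$$ $$\le r\big((\Psi_1\Psi_2^* )^{(\frac1m)}\circ(\Psi_3\Psi_4^* )^{(\frac1m)}\circ\cdots\circ(\Psi_{m-2}\Psi_{m-1}^* )^{(\frac1m)}\circ(\Psi_m\Psi_1^* )^{(\frac1m)}\circ(\Psi_2\Psi_3^* )^{(\frac1m)}\circ\cdots\circ(\Psi_{m-1}\Psi_m^* )^{(\frac1m)}\big)^{\frac12}$$ $$\le r\big(\Omega_1^{(\frac1m)}\circ\cdots\circ\Omega_m^{(\frac1m)}\big)^{\frac1{2m}}\le r\big(\Psi_1\Psi_2^*\cdots\Psi_{m-2}\Psi_{m-1}^*\Psi_m\Psi_1^*\Psi_2\Psi_3^*\cdots\Psi_{m-2}^*\Psi_{m-1}\Psi_m^*\big)^{\frac1{2m}},$$ where $$\Omega_j=\Psi_{2j-1}\Psi_{2j}^*\cdots\Psi_{m-2}\Psi_{m-1}^*\Psi_m\Psi_1^*\Psi_2\Psi_3^*\cdots\Psi_{m-1}\Psi_m^*\Psi_1\Psi_2^*\cdots\Psi_{2j-3}\Psi_{2j-2}^*\quad\text{for }1\le j\le\tfrac{m-1}2,$$ $$\Omega_{\frac{m+1}2}=\Psi_m\Psi_1^*\Psi_2\Psi_3^*\cdots\Psi_{m-1}\Psi_m^*\Psi_1\Psi_2^*\Psi_3\Psi_4^*\cdots\Psi_{m-2}\Psi_{m-1}^*,$$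 $$\Omega_j=\Psi_{2j-m-1}\Psi_{2j-m}^*\cdots\Psi_{m-1}\Psi_m^*\Psi_1\Psi_2^*\Psi_3\Psi_4^*\cdots\Psi_m\Psi_1^*\cdots\Psi_{2j-m-3}\Psi_{2j-m-2}^*\quad\text{for }\tfrac{m+3}2\le j\le m.$$ (That is, with indices read modulo $m$ in $\{1,\ldots,m\}$, the Hadamard product in the second line has the $m$ factors $(\Psi_i\Psi_{i+1}^* )^{(1/m)}$, $i=1,\ldots,m$, and $\Omega_j$ is the product of the $2m$ factors $\Psi_{2j-1}\Psi_{2j}^*\Psi_{2j+1}\Psi_{2j+2}^*\cdots\Psi_{2j+2m-3}\Psi_{2j+2m-2}^*$; the last product in the chain is $\Omega_1$.)
   Context: $(X,\mathfrak M,\mu)$ is a nonempty set with a $\sigma$-finite positive measure and $L^2(X,\mu)$ is the complex Hilbert space. A linear operator $A$ on it is positive if it maps a.e. nonnegative functions to a.e. nonnegative functions (then it is bounded). It is a kernel operator if there is a $\mu\times\mu$-measurable $a$ on $X\times X$ such that for all $f\in L^2(X,\mu)$ and almost all $x$, $\int_X|a(x,y)f(y)|\,d\mu(y)<\infty$ and $(Af)(x)=\int_X a(x,y)f(y)\,d\mu(y)$. For positive kernel operators $A_1,\ldots,A_m$ with kernels $a_1,\ldots,a_m$ and positive $\alpha_j$ with $\sum_j\alpha_j=1$, $A_1^{(\alpha_1)}\circ\cdots\circ A_m^{(\alpha_m)}$ is the positive kernel operator with kernel $a_1(x,y)^{\alpha_1}\cdots a_m(x,y)^{\alpha_m}$.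 For bounded sets of operators: $\Psi_1\cdots\Psi_k=\{A_1\cdots A_k: A_i\in\Psi_i\}$, $\Sigma^k=\{A_1\cdots A_k:A_i\in\Sigma\}$, $\Psi^*=\{A^*:A\in\Psi\}$ ($A^*$ the Hilbert space adjoint), $\|\Psi\|=\sup_{A\in\Psi}\|A\|$, and $\Psi_1^{(\alpha_1)}\circ\cdots\circ\Psi_m^{(\alpha_m)}=\{A_1^{(\alpha_1)}\circ\cdots\circ A_m^{(\alpha_m)}:A_j\in\Psi_j\}$ (elements chosen independently from each factor). With $\rho(A)$ the spectral radius of an operator, for a bounded set $\Sigma$ of bounded operators: $\rho(\Sigma)=\limsup_{k\to\infty}[\sup_{A\in\Sigma^k}\rho(A)]^{1/k}$ and $\hat\rho(\Sigma)=\lim_{k\to\infty}[\sup_{A\in\Sigma^k}\|A\|]^{1/k}$. *)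

theory Defs
  imports "HOL-Analysis.Analysis"
begin

text \<open>
  \<open>L\<^sup>2(X, \<mu>)\<close> depends on the measure, hence is not a type. Its elements are represented by square
  integrable functions and its operators by maps on such functions that respect almost everywhere
  equality; nothing is required outside \<open>L2 M\<close>. All identities between elements of
  \<open>L\<^sup>2(X, \<mu>)\<close> are stated almost everywhere, and every set construction below is closed under, or
  insensitive to, the choice of representatives.
\<close>

type_synonym 'a op = "('a \<Rightarrow> complex) \<Rightarrow> 'a \<Rightarrow> complex"

definition L2 :: "'a measure \<Rightarrow> ('a \<Rightarrow> complex) set" where
  "L2 M = {f \<in> borel_measurable M. integrable M (\<lambda>x. (cmod (f x))\<^sup>2)}"

definition L2_norm :: "'a measure \<Rightarrow> ('a \<Rightarrow> complex) \<Rightarrow> real" where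
  "L2_norm M f = sqrt (LINT x|M. (cmod (f x))\<^sup>2)"

definition L2_inner :: "'a measure \<Rightarrow> ('a \<Rightarrow> complex) \<Rightarrow> ('a \<Rightarrow> complex) \<Rightarrow> complex" where
  "L2_inner M f g = (LINT x|M. f x * cnj (g x))"

definition linear_op :: "'a measure \<Rightarrow> 'a op \<Rightarrow> bool" where
  "linear_op M A \<longleftrightarrow>
     (\<forall>f\<in>L2 M. A f \<in> L2 M) \<and>
     (\<forall>f\<in>L2 M. \<forall>g\<in>L2 M. (AE x in M. f x = g x) \<longrightarrow> (AE x in M. A f x = A g x)) \<and>
     (\<forall>f\<in>L2 M. \<forall>g\<in>L2 M. AE x in M. A (\<lambda>y. f y + g y) x = A f x + A g x) \<and>
     (\<forall>c. \<forall>f\<in>L2 M. AE x in M. A (\<lambda>y. c * f y) x = c * A f x)"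

definition bounded_op :: "'a measure \<Rightarrow> 'a op \<Rightarrow> bool" where
  "bounded_op M A \<longleftrightarrow> linear_op M A \<and> (\<exists>C. \<forall>f\<in>L2 M. L2_norm M (A f) \<le> C * L2_norm M f)"

definition positive_op :: "'a measure \<Rightarrow> 'a op \<Rightarrow> bool" where
  "positive_op M A \<longleftrightarrow> linear_op M A \<and>
     (\<forall>f\<in>L2 M. (AE x in M. f x \<in> \<real>\<^sub>\<ge>\<^sub>0) \<longrightarrow> (AE x in M. A f x \<in> \<real>\<^sub>\<ge>\<^sub>0))"

text \<open>
  Measurability of kernels refers to the uncompleted product measure. This is no restriction:
  a function measurable for the completion agrees almost everywhere with a product measurable one,
  and that one is a kernel of the same operator.
\<close>

definition has_kernel :: "'a measure \<Rightarrow> 'a op \<Rightarrow> ('a \<Rightarrow> 'a \<Rightarrow> complex) \<Rightarrow> bool" where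
  "has_kernel M A a \<longleftrightarrow>
     (\<lambda>(x, y). a x y) \<in> borel_measurable (M \<Otimes>\<^sub>M M) \<and>
     (\<forall>f\<in>L2 M. AE x in M.
        integrable M (\<lambda>y. a x y * f y) \<and> A f x = (LINT y|M. a x y * f y))"

definition kernel_op :: "'a measure \<Rightarrow> 'a op \<Rightarrow> bool" where
  "kernel_op M A \<longleftrightarrow> linear_op M A \<and> (\<exists>a. has_kernel M A a)"

definition positive_kernel_op :: "'a measure \<Rightarrow> 'a op \<Rightarrow> bool" where
  "positive_kernel_op M A \<longleftrightarrow> positive_op M A \<and> kernel_op M A"

text \<open>
  Suprema of sets of nonnegative reals are taken in \<open>[0, \<infinity>)\<close>, so that the supremum of the empty
  set is 0 (relevant for empty sets of operators, and for the empty spectrum when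
  \<open>L\<^sup>2(X, \<mu>)\<close> is the zero space).
\<close>

definition nonneg_Sup :: "real set \<Rightarrow> real" where
  "nonneg_Sup S = Sup (insert 0 S)"

definition op_norm :: "'a measure \<Rightarrow> 'a op \<Rightarrow> real" where
  "op_norm M A = nonneg_Sup {L2_norm M (A f) | f. f \<in> L2 M \<and> L2_norm M f \<le> 1}"

definition spectrum_op :: "'a measure \<Rightarrow> 'a op \<Rightarrow> complex set" where
  "spectrum_op M A = {z. \<not> (\<exists>B. bounded_op M B \<and>
     (\<forall>f\<in>L2 M. (AE x in M. B (\<lambda>y. z * f y - A f y) x = f x) \<and>
                (AE x in M. z * B f x - A (B f) x = f x)))}"

definition spectral_radius_op :: "'a measure \<Rightarrow> 'a op \<Rightarrow> real" where
  "spectral_radius_op M A = nonneg_Sup (cmod ` spectrum_op M A)"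

definition is_adjoint :: "'a measure \<Rightarrow> 'a op \<Rightarrow> 'a op \<Rightarrow> bool" where
  "is_adjoint M A B \<longleftrightarrow> linear_op M B \<and>
     (\<forall>f\<in>L2 M. \<forall>g\<in>L2 M. L2_inner M (A f) g = L2_inner M f (B g))"

subsection \<open>Sets of operators\<close>

definition bounded_op_set :: "'a measure \<Rightarrow> 'a op set \<Rightarrow> bool" where
  "bounded_op_set M \<Sigma> \<longleftrightarrow> (\<forall>A\<in>\<Sigma>. linear_op M A) \<and>
     (\<exists>C. \<forall>A\<in>\<Sigma>. \<forall>f\<in>L2 M. L2_norm M (A f) \<le> C * L2_norm M f)"

definition opset_norm :: "'a measure \<Rightarrow> 'a op set \<Rightarrow> real" where
  "opset_norm M \<Sigma> = nonneg_Sup (op_norm M ` \<Sigma>)"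

definition opset_adjoint :: "'a measure \<Rightarrow> 'a op set \<Rightarrow> 'a op set" where
  "opset_adjoint M \<Sigma> = {B. \<exists>A\<in>\<Sigma>. is_adjoint M A B}"

definition opset_mult :: "'a op set \<Rightarrow> 'a op set \<Rightarrow> 'a op set" where
  "opset_mult \<Phi> \<Psi> = {A \<circ> B | A B. A \<in> \<Phi> \<and> B \<in> \<Psi>}"

definition opset_prod :: "'a op set list \<Rightarrow> 'a op set" where
  "opset_prod \<Psi>s = foldr opset_mult \<Psi>s {id}"

definition opset_power :: "'a op set \<Rightarrow> nat \<Rightarrow> 'a op set" where
  "opset_power \<Sigma> k = opset_prod (replicate k \<Sigma>)"

text \<open>
  The kernel of a positive kernel operator is nonnegative almost everywhere and unique up to null
  sets, so it may be chosen real and nonnegative everywhere, and the weighted geometric mean of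
  the kernels below does not depend on that choice.
\<close>

definition opset_hadamard ::
    "'a measure \<Rightarrow> nat set \<Rightarrow> (nat \<Rightarrow> real) \<Rightarrow> (nat \<Rightarrow> 'a op set) \<Rightarrow> 'a op set" where
  "opset_hadamard M I \<alpha> \<Psi> = {C. linear_op M C \<and>
     (\<exists>A a. (\<forall>j\<in>I. A j \<in> \<Psi> j \<and> (\<forall>x y. 0 \<le> a j x y) \<and>
                   has_kernel M (A j) (\<lambda>x y. complex_of_real (a j x y))) \<and>
            has_kernel M C (\<lambda>x y. complex_of_real (\<Prod>j\<in>I. a j x y powr \<alpha> j)))}"

definition generalized_spectral_radius :: "'a measure \<Rightarrow> 'a op set \<Rightarrow> real" where
  "generalized_spectral_radius M \<Sigma> = real_of_ereal (limsup (\<lambda>k.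
     ereal (nonneg_Sup (spectral_radius_op M ` opset_power \<Sigma> k) powr (1 / real k))))"

definition joint_spectral_radius :: "'a measure \<Rightarrow> 'a op set \<Rightarrow> real" where
  "joint_spectral_radius M \<Sigma> = lim (\<lambda>k.
     nonneg_Sup (op_norm M ` opset_power \<Sigma> k) powr (1 / real k))"

subsection \<open>Cyclic products\<close>

text \<open>The representative in \<open>{1..m}\<close> of a positive index modulo \<open>m\<close>.\<close>

definition cyc :: "nat \<Rightarrow> nat \<Rightarrow> nat" where
  "cyc m i = (i - 1) mod m + 1"

text \<open>
  The factor \<open>\<Psi>\<^bsub>2j-1\<^esub> \<Psi>\<^bsub>2j\<^esub>\<^sup>*\<close>. As \<open>m\<close> is odd, \<open>j = 1, \<dots>, m\<close> gives
  \<open>\<Psi>\<^sub>1\<Psi>\<^sub>2\<^sup>*, \<Psi>\<^sub>3\<Psi>\<^sub>4\<^sup>*, \<dots>, \<Psi>\<^sub>m\<Psi>\<^sub>1\<^sup>*, \<Psi>\<^sub>2\<Psi>\<^sub>3\<^sup>*, \<dots>, \<Psi>\<^bsub>m-1\<^esub>\<Psi>\<^sub>m\<^sup>*\<close>.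
\<close>

definition pair_factor :: "'a measure \<Rightarrow> nat \<Rightarrow> (nat \<Rightarrow> 'a op set) \<Rightarrow> nat \<Rightarrow> 'a op set" where
  "pair_factor M m \<Psi> j =
     opset_mult (\<Psi> (cyc m (2 * j - 1))) (opset_adjoint M (\<Psi> (cyc m (2 * j))))"

text \<open>
  \<open>\<Omega>\<^sub>j = \<Psi>\<^bsub>2j-1\<^esub> \<Psi>\<^bsub>2j\<^esub>\<^sup>* \<Psi>\<^bsub>2j+1\<^esub> \<Psi>\<^bsub>2j+2\<^esub>\<^sup>* \<dots> \<Psi>\<^bsub>2j+2m-3\<^esub> \<Psi>\<^bsub>2j+2m-2\<^esub>\<^sup>*\<close>
\<close>

definition Omega :: "'a measure \<Rightarrow> nat \<Rightarrow> (nat \<Rightarrow> 'a op set) \<Rightarrow> nat \<Rightarrow> 'a op set" where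
  "Omega M m \<Psi> j = opset_prod (concat (map (\<lambda>l.
     [\<Psi> (cyc m (2 * j - 1 + 2 * l)), opset_adjoint M (\<Psi> (cyc m (2 * j + 2 * l)))]) [0..<m]))"

end

theory Submission imports Defs begin

text \<open>
  Write \<open>A \<preceq> B\<close> if \<open>|A f| \<le> B |f|\<close> for all \<open>f\<close>. By Hoelder's inequality for kernels, a product of Hadamard means
  is dominated by the Hadamard mean of the products. Hence for \<open>C\<close> in the first Hadamard mean,
  \<open>C C\<^sup>*\<close> (paired as \<open>\<Psi>\<^bsub>i\<^esub>\<Psi>\<^bsub>i+1\<^esub>\<^sup>*\<close>, all \<open>i\<close> being reached because \<open>m\<close> is odd) is dominated by an
  element of the second one, and \<open>\<parallel>C\<parallel>\<^sup>2\<close> is the growth rate of the powers of \<open>C C\<^sup>*\<close>. A product of \<open>m\<close> cyclically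
  shifted copies of the second mean is dominated by the third. The last inequality holds since the \<open>\<Omega>\<^sub>j\<close> are
  cyclic permutations \<open>V U\<close> of \<open>\<Omega>\<^sub>1 = U V\<close>, whose powers grow at the same rate.

  Every comparison is thus one of growth rates of powers. For the operator norm the rate is the joint
  spectral radius; for the spectral radius of a single positive operator it is Gelfand's formula, which
  for positive operators needs no complex analysis, only the positivity of the resolvent on a real half line.
\<close>

text \<open>Domination gives no direct inclusion between spectra, so spectra are never compared. The
  working notion is a rate: \<open>growth M A t\<close> and \<open>set_growth M S t\<close> bound
  all powers by \<open>K * t ^ k\<close>. The free constant \<open>K\<close> survives domination,
  passage to roots, cyclic permutation and Hadamard means, and every inequality between radii is
  recovered by letting \<open>t\<close> decrease to the radius. For the generalized radius only the
  spectral radii of single elements are known. Each step therefore picks one element, turns its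
  spectral radius into a rate by the Gelfand argument, moves the rate, and returns by the Neumann
  series. The Gelfand argument needs a strict inequality, which is why bounds with < enter and
  bounds with \<le> leave. All weights are equal, so the factors of one Hadamard mean may be read in
  any order; this freedom is what lets the same set be paired with its adjoint and with shifted
  copies of itself. On a measure space without atoms the identity has no kernel, so the zeroth power
  is treated apart wherever powers of Hadamard means are compared.\<close>

subsection \<open>Square integrable functions\<close>

lemma L2_measurable: "f \<in> L2 M \<Longrightarrow> f \<in> borel_measurable M"
  by (simp add: L2_def)

lemma L2_integrable_square: "f \<in> L2 M \<Longrightarrow> integrable M (\<lambda>x. (cmod (f x))\<^sup>2)"
  by (simp add: L2_def)

lemma L2_norm_nonneg [simp]: "0 \<le> L2_norm M f"
  by (simp add: L2_norm_def)

lemma L2_norm_square: "(L2_norm M f)\<^sup>2 = (LINT x|M. (cmod (f x))\<^sup>2)"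
  by (simp add: L2_norm_def)

lemma L2_zero [simp]: "(\<lambda>x. 0) \<in> L2 M"
  by (simp add: L2_def)

lemma L2_norm_zero [simp]: "L2_norm M (\<lambda>x. 0) = 0"
  by (simp add: L2_norm_def)

lemma L2_dominated:
  assumes f: "f \<in> L2 M" and g: "g \<in> borel_measurable M"
    and le: "AE x in M. cmod (g x) \<le> cmod (f x)"
  shows "g \<in> L2 M" "L2_norm M g \<le> L2_norm M f"
proof -
  note [measurable] = g L2_measurable[OF f]
  have le2: "AE x in M. (cmod (g x))\<^sup>2 \<le> (cmod (f x))\<^sup>2"
    using le by eventually_elim (simp add: power_mono)
  have i: "integrable M (\<lambda>x. (cmod (g x))\<^sup>2)"
    by (rule Bochner_Integration.integrable_bound[OF L2_integrable_square[OF f]]) (use le2 in auto)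
  then show "g \<in> L2 M" using g by (simp add: L2_def)
  show "L2_norm M g \<le> L2_norm M f"
    unfolding L2_norm_def
    by (intro real_sqrt_le_mono integral_mono_AE i L2_integrable_square[OF f] le2)
qed

lemma L2_norm_cong_AE:
  assumes "f \<in> borel_measurable M" "g \<in> borel_measurable M" "AE x in M. f x = g x"
  shows "L2_norm M f = L2_norm M g"
proof -
  note [measurable] = assms(1,2)
  show ?thesis
    unfolding L2_norm_def by (intro arg_cong[of _ _ sqrt] integral_cong_AE) (use assms(3) in auto)
qed

lemma L2_add:
  assumes f: "f \<in> L2 M" and g: "g \<in> L2 M"
  shows "(\<lambda>x. f x + g x) \<in> L2 M"
proof -
  note [measurable] = L2_measurable[OF f] L2_measurable[OF g]
  have "integrable M (\<lambda>x. 2 * (cmod (f x))\<^sup>2 + 2 * (cmod (g x))\<^sup>2)"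
    using f g by (intro Bochner_Integration.integrable_add integrable_mult_right L2_integrable_square)
  then have "integrable M (\<lambda>x. (cmod (f x + g x))\<^sup>2)"
  proof (rule Bochner_Integration.integrable_bound)
    show "AE x in M. norm ((cmod (f x + g x))\<^sup>2) \<le> norm (2 * (cmod (f x))\<^sup>2 + 2 * (cmod (g x))\<^sup>2)"
    proof (intro AE_I2)
      fix x
      have "(cmod (f x + g x))\<^sup>2 \<le> (cmod (f x) + cmod (g x))\<^sup>2"
        by (intro power_mono norm_triangle_ineq) auto
      also have "\<dots> \<le> 2 * (cmod (f x))\<^sup>2 + 2 * (cmod (g x))\<^sup>2"
        using sum_squares_bound[of "cmod (f x)" "cmod (g x)"] by (simp add: power2_sum)
      finally show "norm ((cmod (f x + g x))\<^sup>2) \<le> norm (2 * (cmod (f x))\<^sup>2 + 2 * (cmod (g x))\<^sup>2)"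
        by simp
    qed
  qed auto
  then show ?thesis by (simp add: L2_def)
qed

lemma L2_scale:
  assumes f: "f \<in> L2 M" shows "(\<lambda>x. c * f x) \<in> L2 M"
  using f by (auto simp: L2_def norm_mult power_mult_distrib)

lemma L2_norm_scale: "L2_norm M (\<lambda>x. c * f x) = cmod c * L2_norm M f"
  by (simp add: L2_norm_def norm_mult power_mult_distrib real_sqrt_mult)

lemma L2_diff:
  assumes "f \<in> L2 M" "g \<in> L2 M" shows "(\<lambda>x. f x - g x) \<in> L2 M"
  using L2_add[OF assms(1) L2_scale[OF assms(2), of "-1"]] by simp

lemma L2_sum:
  assumes "\<And>i. i \<in> I \<Longrightarrow> f i \<in> L2 M" shows "(\<lambda>x. \<Sum>i\<in>I. f i x) \<in> L2 M"
  using assms by (induction I rule: infinite_finite_induct) (auto intro: L2_add)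

lemma L2_cmod:
  assumes "f \<in> L2 M" shows "(\<lambda>x. complex_of_real (cmod (f x))) \<in> L2 M"
  using assms L2_measurable[OF assms] by (auto simp: L2_def)

lemma L2_norm_cmod [simp]: "L2_norm M (\<lambda>x. complex_of_real (cmod (f x))) = L2_norm M f"
  by (simp add: L2_norm_def)

lemma nn_integral_L2:
  assumes f: "f \<in> L2 M"
  shows "(\<integral>\<^sup>+x. (ennreal (cmod (f x)))\<^sup>2 \<partial>M) = (ennreal (L2_norm M f))\<^sup>2"
proof -
  have "(\<integral>\<^sup>+x. (ennreal (cmod (f x)))\<^sup>2 \<partial>M) = (\<integral>\<^sup>+x. ennreal ((cmod (f x))\<^sup>2) \<partial>M)"
    by (simp add: ennreal_power)
  also have "\<dots> = ennreal ((L2_norm M f)\<^sup>2)"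
    unfolding L2_norm_square by (intro nn_integral_eq_integral L2_integrable_square f) auto
  finally show ?thesis by (simp add: ennreal_power)
qed

text \<open>The nonnegative integral delivers integrability and the bound at once. There only the
  squared inequality is available, so the root is taken after a case distinction on
  finiteness.\<close>

lemma L2_Cauchy_Schwarz:
  assumes f: "f \<in> L2 M" and g: "g \<in> L2 M"
  shows "integrable M (\<lambda>x. cmod (f x) * cmod (g x))"
    and "(LINT x|M. cmod (f x) * cmod (g x)) \<le> L2_norm M f * L2_norm M g"
proof -
  note [measurable] = L2_measurable[OF f] L2_measurable[OF g]
  have "(\<integral>\<^sup>+x. ennreal (cmod (f x)) * ennreal (cmod (g x)) \<partial>M)\<^sup>2
      \<le> (ennreal (L2_norm M f))\<^sup>2 * (ennreal (L2_norm M g))\<^sup>2"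
    using Cauchy_Schwarz_nn_integral[of "\<lambda>x. ennreal (cmod (f x))" M "\<lambda>x. ennreal (cmod (g x))"]
    by (simp add: nn_integral_L2 f g)
  also have "\<dots> = (ennreal (L2_norm M f * L2_norm M g))\<^sup>2"
    by (simp add: ennreal_mult power_mult_distrib)
  finally have sq: "(\<integral>\<^sup>+x. ennreal (cmod (f x) * cmod (g x)) \<partial>M)\<^sup>2 \<le> (ennreal (L2_norm M f * L2_norm M g))\<^sup>2"
    by (simp add: ennreal_mult)
  have le: "(\<integral>\<^sup>+x. ennreal (cmod (f x) * cmod (g x)) \<partial>M) \<le> ennreal (L2_norm M f * L2_norm M g)"
  proof (cases "\<integral>\<^sup>+x. ennreal (cmod (f x) * cmod (g x)) \<partial>M")
    case (real r)
    have "ennreal (r\<^sup>2) = (\<integral>\<^sup>+x. ennreal (cmod (f x) * cmod (g x)) \<partial>M)\<^sup>2"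
      using real by (simp add: ennreal_power)
    also have "\<dots> \<le> ennreal ((L2_norm M f * L2_norm M g)\<^sup>2)"
      using sq by (subst ennreal_power[symmetric]) auto
    finally have "r\<^sup>2 \<le> (L2_norm M f * L2_norm M g)\<^sup>2"
      by (simp add: ennreal_le_iff)
    then have "r \<le> L2_norm M f * L2_norm M g"
      by (rule power2_le_imp_le) simp
    then show ?thesis using real by (simp add: ennreal_leI)
  next
    case top
    have "(\<integral>\<^sup>+x. ennreal (cmod (f x) * cmod (g x)) \<partial>M)\<^sup>2 \<le> ennreal ((L2_norm M f * L2_norm M g)\<^sup>2)"
      using sq by (subst ennreal_power[symmetric]) auto
    then show ?thesis unfolding top by (simp add: power2_eq_square top_unique)
  qed
  show i: "integrable M (\<lambda>x. cmod (f x) * cmod (g x))"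
    using le by (intro integrableI_nonneg) (auto intro: le_less_trans)
  show "(LINT x|M. cmod (f x) * cmod (g x)) \<le> L2_norm M f * L2_norm M g"
    using le by (subst (asm) nn_integral_eq_integral[OF i]) (auto simp: ennreal_le_iff)
qed

lemma L2_inner_integrable:
  assumes f: "f \<in> L2 M" and g: "g \<in> L2 M"
  shows "integrable M (\<lambda>x. f x * cnj (g x))"
proof -
  note [measurable] = L2_measurable[OF f] L2_measurable[OF g]
  have [measurable]: "(\<lambda>x. cnj (g x)) \<in> borel_measurable M"
    using L2_measurable[OF g] by (rule borel_measurable_continuous_on[OF continuous_on_cnj[OF continuous_on_id]])
  show ?thesis
    by (rule Bochner_Integration.integrable_bound[OF L2_Cauchy_Schwarz(1)[OF f g]])
       (auto simp: norm_mult)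
qed

lemma L2_inner_le:
  assumes f: "f \<in> L2 M" and g: "g \<in> L2 M"
  shows "cmod (L2_inner M f g) \<le> L2_norm M f * L2_norm M g"
proof -
  have "cmod (L2_inner M f g) \<le> (LINT x|M. cmod (f x) * cmod (g x))"
    unfolding L2_inner_def using integral_norm_bound[of M "\<lambda>x. f x * cnj (g x)"]
    by (simp add: norm_mult)
  with L2_Cauchy_Schwarz(2)[OF f g] show ?thesis by simp
qed

lemma L2_inner_self: "L2_inner M f f = complex_of_real ((L2_norm M f)\<^sup>2)"
proof -
  have "L2_inner M f f = (LINT x|M. complex_of_real ((cmod (f x))\<^sup>2))"
    unfolding L2_inner_def complex_norm_square ..
  then show ?thesis unfolding L2_norm_square integral_complex_of_real .
qed

lemma L2_inner_commute: "L2_inner M f g = cnj (L2_inner M g f)"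
  unfolding L2_inner_def by (subst Bochner_Integration.integral_cnj[symmetric]) (simp add: mult.commute)

lemma L2_norm_triangle:
  assumes f: "f \<in> L2 M" and g: "g \<in> L2 M"
  shows "L2_norm M (\<lambda>x. f x + g x) \<le> L2_norm M f + L2_norm M g"
proof -
  have i: "integrable M (\<lambda>x. (cmod (f x))\<^sup>2 + 2 * (cmod (f x) * cmod (g x)) + (cmod (g x))\<^sup>2)"
    using f g by (intro Bochner_Integration.integrable_add integrable_mult_right L2_integrable_square L2_Cauchy_Schwarz)
  have "(L2_norm M (\<lambda>x. f x + g x))\<^sup>2
      \<le> (LINT x|M. (cmod (f x))\<^sup>2 + 2 * (cmod (f x) * cmod (g x)) + (cmod (g x))\<^sup>2)"
    unfolding L2_norm_square
  proof (intro integral_mono i L2_integrable_square L2_add f g)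
    fix x
    have "(cmod (f x + g x))\<^sup>2 \<le> (cmod (f x) + cmod (g x))\<^sup>2"
      by (intro power_mono norm_triangle_ineq) auto
    then show "(cmod (f x + g x))\<^sup>2 \<le> (cmod (f x))\<^sup>2 + 2 * (cmod (f x) * cmod (g x)) + (cmod (g x))\<^sup>2"
      by (simp add: power2_sum algebra_simps)
  qed
  also have "\<dots> = (L2_norm M f)\<^sup>2 + 2 * (LINT x|M. cmod (f x) * cmod (g x)) + (L2_norm M g)\<^sup>2"
    using f g by (simp add: L2_norm_square L2_integrable_square L2_Cauchy_Schwarz)
  also have "\<dots> \<le> (L2_norm M f + L2_norm M g)\<^sup>2"
    using L2_Cauchy_Schwarz(2)[OF f g] by (simp add: power2_sum)
  finally show ?thesis by (rule power2_le_imp_le) simp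
qed

lemma L2_norm_triangle_diff:
  assumes f: "f \<in> L2 M" and g: "g \<in> L2 M"
  shows "L2_norm M (\<lambda>x. f x - g x) \<le> L2_norm M f + L2_norm M g"
  using L2_norm_triangle[OF f L2_scale[OF g, of "-1"]] L2_norm_scale[of M "-1" g] by simp

lemma L2_norm_sum:
  assumes "\<And>i. i \<in> I \<Longrightarrow> f i \<in> L2 M"
  shows "L2_norm M (\<lambda>x. \<Sum>i\<in>I. f i x) \<le> (\<Sum>i\<in>I. L2_norm M (f i))"
  using assms
proof (induction I rule: infinite_finite_induct)
  case (insert i I)
  have "L2_norm M (\<lambda>x. f i x + (\<Sum>j\<in>I. f j x)) \<le> L2_norm M (f i) + L2_norm M (\<lambda>x. \<Sum>j\<in>I. f j x)"
    using insert by (intro L2_norm_triangle L2_sum) auto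
  then show ?case using insert by simp
qed auto

lemma L2_norm_eq_0_iff:
  assumes f: "f \<in> L2 M" shows "L2_norm M f = 0 \<longleftrightarrow> (AE x in M. f x = 0)"
  unfolding L2_norm_def using integral_nonneg_eq_0_iff_AE[OF L2_integrable_square[OF f]] by simp

lemma AE_eqI_L2_norm:
  assumes "f \<in> L2 M" "g \<in> L2 M" "L2_norm M (\<lambda>x. f x - g x) = 0"
  shows "AE x in M. f x = g x"
  using assms L2_norm_eq_0_iff[OF L2_diff[OF assms(1,2)]] by auto

lemma tendsto_square_ennreal:
  fixes a :: ennreal
  assumes "(f \<longlongrightarrow> a) F" shows "((\<lambda>x. (f x)\<^sup>2) \<longlongrightarrow> a\<^sup>2) F"
  unfolding power2_eq_square by (rule tendsto_mult_ennreal) (use assms in auto)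

lemma ennreal_square_neq_infinityD:
  fixes a :: ennreal
  assumes "a\<^sup>2 \<noteq> \<infinity>" shows "a \<noteq> \<infinity>"
  using assms by (auto simp: power2_eq_square)

text \<open>Completeness in the only form needed, by monotone convergence for the partial sums of
  the moduli. Almost everywhere convergence gives the sum an explicit representative, which an
  abstract limit in norm would not have.\<close>

lemma L2_summable_series:
  fixes f :: "nat \<Rightarrow> 'a \<Rightarrow> complex"
  assumes f: "\<And>n. f n \<in> L2 M" and s: "summable (\<lambda>n. L2_norm M (f n))"
  shows "AE x in M. summable (\<lambda>n. cmod (f n x))"
    and "(\<lambda>x. \<Sum>n. f n x) \<in> L2 M"
    and "L2_norm M (\<lambda>x. \<Sum>n. f n x) \<le> (\<Sum>n. L2_norm M (f n))"
proof -
  have [measurable]: "f n \<in> borel_measurable M" for n using f by (rule L2_measurable)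
  let ?S = "\<Sum>n. L2_norm M (f n)"
  define G where "G = (\<lambda>N x. \<Sum>n<N. ennreal (cmod (f n x)))"
  have [measurable]: "G N \<in> borel_measurable M" for N unfolding G_def by measurable
  have GN: "(\<integral>\<^sup>+x. (G N x)\<^sup>2 \<partial>M) \<le> (ennreal ?S)\<^sup>2" for N
  proof -
    let ?g = "\<lambda>x. \<Sum>n<N. complex_of_real (cmod (f n x))"
    have g: "?g \<in> L2 M" by (intro L2_sum L2_cmod f)
    have eq: "cmod (?g x) = (\<Sum>n<N. cmod (f n x))" for x
    proof -
      have "cmod (?g x) = cmod (complex_of_real (\<Sum>n<N. cmod (f n x)))" by simp
      then show ?thesis by (subst (asm) norm_of_real) (simp add: sum_nonneg)
    qed
    have "(\<integral>\<^sup>+x. (G N x)\<^sup>2 \<partial>M) = (\<integral>\<^sup>+x. (ennreal (cmod (?g x)))\<^sup>2 \<partial>M)"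
      unfolding eq G_def by (simp add: sum_nonneg)
    also have "\<dots> = (ennreal (L2_norm M ?g))\<^sup>2" by (rule nn_integral_L2[OF g])
    also have "L2_norm M ?g \<le> (\<Sum>n<N. L2_norm M (f n))"
      using L2_norm_sum[of "{..<N}" "\<lambda>n x. complex_of_real (cmod (f n x))" M] f by (simp add: L2_cmod)
    also have "\<dots> \<le> ?S" by (intro sum_le_suminf s) auto
    finally show ?thesis by (simp add: power_mono ennreal_leI)
  qed
  have inc: "incseq G"
    by (rule incseq_SucI) (auto simp: G_def le_fun_def intro!: ennreal_leI)
  have "(\<integral>\<^sup>+x. (SUP N. G N x)\<^sup>2 \<partial>M) = (\<integral>\<^sup>+x. (SUP N. (G N x)\<^sup>2) \<partial>M)"
  proof (intro nn_integral_cong)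
    fix x
    have i: "incseq (\<lambda>N. G N x)" using inc by (auto simp: incseq_def le_fun_def)
    have "(\<lambda>N. (G N x)\<^sup>2) \<longlonglongrightarrow> (SUP N. G N x)\<^sup>2"
      by (intro tendsto_square_ennreal LIMSEQ_SUP i)
    moreover have "(\<lambda>N. (G N x)\<^sup>2) \<longlonglongrightarrow> (SUP N. (G N x)\<^sup>2)"
      by (intro LIMSEQ_SUP) (use i in \<open>auto simp: incseq_def intro: power_mono\<close>)
    ultimately show "(SUP N. G N x)\<^sup>2 = (SUP N. (G N x)\<^sup>2)" by (rule LIMSEQ_unique)
  qed
  also have "\<dots> = (SUP N. (\<integral>\<^sup>+x. (G N x)\<^sup>2 \<partial>M))"
    by (rule nn_integral_monotone_convergence_SUP)
       (use inc in \<open>auto simp: incseq_def le_fun_def intro: power_mono\<close>)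
  also have "\<dots> \<le> (ennreal ?S)\<^sup>2" by (rule SUP_least) (rule GN)
  finally have le: "(\<integral>\<^sup>+x. (SUP N. G N x)\<^sup>2 \<partial>M) \<le> (ennreal ?S)\<^sup>2" .
  have "(\<integral>\<^sup>+x. (SUP N. G N x)\<^sup>2 \<partial>M) \<noteq> \<infinity>"
    using le by (auto simp: power2_eq_square ennreal_mult_eq_top_iff top_unique)
  then have "AE x in M. (SUP N. G N x)\<^sup>2 \<noteq> \<infinity>"
    by (intro nn_integral_PInf_AE) auto
  then have fin: "AE x in M. (SUP N. G N x) \<noteq> \<infinity>"
    by eventually_elim (rule ennreal_square_neq_infinityD)
  have sup: "(SUP N. G N x) = (\<Sum>n. ennreal (cmod (f n x)))" for x
    unfolding G_def by (simp add: suminf_eq_SUP)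
  show sm: "AE x in M. summable (\<lambda>n. cmod (f n x))"
    using fin unfolding sup by eventually_elim (auto intro: summable_suminf_not_top)
  \<comment> \<open>Where the series diverges \<open>suminf\<close> has a fixed default value; by
    the preceding step this concerns a null set only.\<close>
  define F where "F = (\<lambda>x. \<Sum>n. f n x)"
  have F[measurable]: "F \<in> borel_measurable M" unfolding F_def by measurable
  have Fle: "AE x in M. ennreal (cmod (F x)) \<le> (SUP N. G N x)"
    using sm
  proof eventually_elim
    case (elim x)
    have "ennreal (cmod (F x)) \<le> ennreal (\<Sum>n. cmod (f n x))"
      unfolding F_def by (intro ennreal_leI summable_norm elim)
    also have "\<dots> = (SUP N. G N x)" unfolding sup
      by (rule suminf_ennreal2[symmetric]) (use elim in auto)
    finally show ?case .
  qed
  have "(\<integral>\<^sup>+x. ennreal ((cmod (F x))\<^sup>2) \<partial>M) \<le> (\<integral>\<^sup>+x. (SUP N. G N x)\<^sup>2 \<partial>M)"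
  proof (intro nn_integral_mono_AE)
    show "AE x in M. ennreal ((cmod (F x))\<^sup>2) \<le> (SUP N. G N x)\<^sup>2"
      using Fle
    proof eventually_elim
      case (elim x)
      have "ennreal ((cmod (F x))\<^sup>2) = (ennreal (cmod (F x)))\<^sup>2" by (simp add: ennreal_power)
      also have "\<dots> \<le> (SUP N. G N x)\<^sup>2" by (rule power_mono[OF elim]) simp
      finally show ?case .
    qed
  qed
  then have le2: "(\<integral>\<^sup>+x. ennreal ((cmod (F x))\<^sup>2) \<partial>M) \<le> ennreal (?S\<^sup>2)"
    using le s by (simp add: ennreal_power suminf_nonneg)
  then have i: "integrable M (\<lambda>x. (cmod (F x))\<^sup>2)"
    by (intro integrableI_nonneg) (auto intro: le_less_trans)
  then show "(\<lambda>x. \<Sum>n. f n x) \<in> L2 M" using F by (simp add: L2_def F_def)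
  have "(L2_norm M F)\<^sup>2 \<le> ?S\<^sup>2"
    using le2 nn_integral_eq_integral[OF i] ennreal_le_iff[of "?S\<^sup>2"]
    unfolding L2_norm_square by simp
  then have "L2_norm M F \<le> ?S" by (rule power2_le_imp_le) (use s in \<open>auto intro: suminf_nonneg\<close>)
  then show "L2_norm M (\<lambda>x. \<Sum>n. f n x) \<le> ?S" by (simp add: F_def)
qed

subsection \<open>Linear operators\<close>

text \<open>A bound is a predicate rather than a supremum, so it can be transported without showing
  that a supremum exists; \<open>op_norm\<close> enters only in the final translation.\<close>

definition op_bound :: "'a measure \<Rightarrow> 'a op \<Rightarrow> real \<Rightarrow> bool" where
  "op_bound M A C \<longleftrightarrow> (\<forall>f\<in>L2 M. L2_norm M (A f) \<le> C * L2_norm M f)"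

lemma op_boundI: "(\<And>f. f \<in> L2 M \<Longrightarrow> L2_norm M (A f) \<le> C * L2_norm M f) \<Longrightarrow> op_bound M A C"
  by (simp add: op_bound_def)

lemma op_boundD: "op_bound M A C \<Longrightarrow> f \<in> L2 M \<Longrightarrow> L2_norm M (A f) \<le> C * L2_norm M f"
  by (simp add: op_bound_def)

lemma op_bound_mono:
  assumes "op_bound M A C" "C \<le> D" shows "op_bound M A D"
proof (rule op_boundI)
  fix f assume "f \<in> L2 M"
  then have "L2_norm M (A f) \<le> C * L2_norm M f" by (rule op_boundD[OF assms(1)])
  also have "\<dots> \<le> D * L2_norm M f" by (intro mult_right_mono assms) simp
  finally show "L2_norm M (A f) \<le> D * L2_norm M f" .
qed

lemma bounded_op_iff: "bounded_op M A \<longleftrightarrow> linear_op M A \<and> (\<exists>C. op_bound M A C)"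
  by (simp add: bounded_op_def op_bound_def)

lemma bounded_opE:
  assumes "bounded_op M A"
  obtains C where "0 < C" "linear_op M A" "op_bound M A C"
  using assms op_bound_mono[of M A _ "max _ 1"] unfolding bounded_op_iff
  by (metis max.cobounded1 max.cobounded2 less_le_trans zero_less_one)

lemma linear_op_L2: "linear_op M A \<Longrightarrow> f \<in> L2 M \<Longrightarrow> A f \<in> L2 M"
  by (simp add: linear_op_def)

lemma linear_op_cong:
  "linear_op M A \<Longrightarrow> f \<in> L2 M \<Longrightarrow> g \<in> L2 M \<Longrightarrow> AE x in M. f x = g x \<Longrightarrow> AE x in M. A f x = A g x"
  by (simp add: linear_op_def)

lemma linear_op_add:
  "linear_op M A \<Longrightarrow> f \<in> L2 M \<Longrightarrow> g \<in> L2 M \<Longrightarrow> AE x in M. A (\<lambda>y. f y + g y) x = A f x + A g x"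
  by (simp add: linear_op_def)

lemma linear_op_scale:
  "linear_op M A \<Longrightarrow> f \<in> L2 M \<Longrightarrow> AE x in M. A (\<lambda>y. c * f y) x = c * A f x"
  by (simp add: linear_op_def)

lemma linear_op_diff:
  assumes A: "linear_op M A" and f: "f \<in> L2 M" and g: "g \<in> L2 M"
  shows "AE x in M. A (\<lambda>y. f y - g y) x = A f x - A g x"
  using linear_op_add[OF A f L2_scale[OF g, of "-1"]] linear_op_scale[OF A g, of "-1"]
  by eventually_elim simp

lemma linear_op_zero:
  assumes A: "linear_op M A" shows "AE x in M. A (\<lambda>y. 0) x = 0"
  using linear_op_scale[OF A L2_zero, of 0] by simp

lemma linear_op_sum:
  assumes A: "linear_op M A" and f: "\<And>i. i \<in> I \<Longrightarrow> f i \<in> L2 M"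
  shows "AE x in M. A (\<lambda>y. \<Sum>i\<in>I. f i y) x = (\<Sum>i\<in>I. A (f i) x)"
  using f
proof (induction I rule: infinite_finite_induct)
  case (insert i I)
  have "AE x in M. A (\<lambda>y. f i y + (\<Sum>j\<in>I. f j y)) x = A (f i) x + A (\<lambda>y. \<Sum>j\<in>I. f j y) x"
    by (intro linear_op_add[OF A] L2_sum) (use insert in auto)
  moreover have "AE x in M. A (\<lambda>y. \<Sum>j\<in>I. f j y) x = (\<Sum>j\<in>I. A (f j) x)"
    using insert by auto
  ultimately show ?case
    by eventually_elim (use insert in simp)
qed (use linear_op_zero[OF A] in auto)

lemma linear_op_id [simp]: "linear_op M id"
  by (auto simp: linear_op_def intro: L2_add L2_scale)

lemma linear_op_comp:
  assumes A: "linear_op M A" and B: "linear_op M B" shows "linear_op M (A \<circ> B)"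
  unfolding linear_op_def
proof (intro conjI ballI allI impI)
  fix f assume f: "f \<in> L2 M"
  note Bf = linear_op_L2[OF B f]
  show "(A \<circ> B) f \<in> L2 M" using linear_op_L2[OF A Bf] by simp
  fix c
  have "AE x in M. A (B (\<lambda>y. c * f y)) x = A (\<lambda>y. c * B f y) x"
    by (intro linear_op_cong[OF A] linear_op_L2[OF B] L2_scale f Bf linear_op_scale[OF B])
  then show "AE x in M. (A \<circ> B) (\<lambda>y. c * f y) x = c * (A \<circ> B) f x"
    using linear_op_scale[OF A Bf, of c] by eventually_elim simp
next
  fix f g assume f: "f \<in> L2 M" and g: "g \<in> L2 M"
  note Bf = linear_op_L2[OF B f] note Bg = linear_op_L2[OF B g]
  have "AE x in M. A (B (\<lambda>y. f y + g y)) x = A (\<lambda>y. B f y + B g y) x"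
    by (intro linear_op_cong[OF A] linear_op_L2[OF B] L2_add f g Bf Bg linear_op_add[OF B])
  then show "AE x in M. (A \<circ> B) (\<lambda>y. f y + g y) x = (A \<circ> B) f x + (A \<circ> B) g x"
    using linear_op_add[OF A Bf Bg] by eventually_elim simp
  assume "AE x in M. f x = g x"
  then show "AE x in M. (A \<circ> B) f x = (A \<circ> B) g x"
    unfolding comp_def by (intro linear_op_cong[OF A] Bf Bg linear_op_cong[OF B] f g)
qed

lemma linear_op_funpow: "linear_op M A \<Longrightarrow> linear_op M (A ^^ n)"
  by (induction n) (auto intro: linear_op_comp)

lemma op_bound_comp:
  assumes "linear_op M B" "op_bound M A C" "op_bound M B D" "0 \<le> C"
  shows "op_bound M (A \<circ> B) (C * D)"
proof (rule op_boundI)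
  fix f assume f: "f \<in> L2 M"
  have "L2_norm M (A (B f)) \<le> C * L2_norm M (B f)"
    by (intro op_boundD[OF assms(2)] linear_op_L2[OF assms(1)] f)
  also have "\<dots> \<le> C * (D * L2_norm M f)"
    by (intro mult_left_mono op_boundD[OF assms(3)] f assms)
  finally show "L2_norm M ((A \<circ> B) f) \<le> C * D * L2_norm M f" by simp
qed

lemma op_bound_id: "op_bound M id 1"
  by (rule op_boundI) simp

lemma op_bound_funpow:
  assumes "linear_op M A" "op_bound M A C" "0 \<le> C"
  shows "op_bound M (A ^^ n) (C ^ n)"
proof (induction n)
  case (Suc n)
  show ?case using op_bound_comp[OF linear_op_funpow[OF assms(1)] assms(2) Suc assms(3)] by (simp add: comp_def)
qed (use op_bound_id in \<open>simp add: id_def\<close>)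

lemma positive_op_linear: "positive_op M A \<Longrightarrow> linear_op M A"
  by (simp add: positive_op_def)

lemma positive_opD:
  "positive_op M A \<Longrightarrow> f \<in> L2 M \<Longrightarrow> AE x in M. f x \<in> \<real>\<^sub>\<ge>\<^sub>0 \<Longrightarrow> AE x in M. A f x \<in> \<real>\<^sub>\<ge>\<^sub>0"
  by (simp add: positive_op_def)

lemma positive_op_id: "positive_op M id"
  by (simp add: positive_op_def)

lemma positive_op_comp:
  assumes "positive_op M A" "positive_op M B" shows "positive_op M (A \<circ> B)"
  using assms by (auto simp: positive_op_def linear_op_comp linear_op_L2)

lemma positive_op_funpow: "positive_op M A \<Longrightarrow> positive_op M (A ^^ n)"
  by (induction n) (auto intro: positive_op_comp simp: positive_op_id)

subsection \<open>Neumann series\<close>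

text \<open>For bounded positive \<open>A\<close> the infimum of the nonnegative rates is the
  spectral radius: one direction is \<open>spectral_radius_le_growth\<close>, the other
  \<open>growth_of_spectral_radius_less\<close>.\<close>

definition growth :: "'a measure \<Rightarrow> 'a op \<Rightarrow> real \<Rightarrow> bool" where
  "growth M A t \<longleftrightarrow> (\<exists>K\<ge>0. \<forall>n. op_bound M (A ^^ n) (K * t ^ n))"

lemma suminf_nonneg_Reals:
  fixes f :: "nat \<Rightarrow> complex"
  assumes "summable f" "\<And>n. f n \<in> \<real>\<^sub>\<ge>\<^sub>0" shows "suminf f \<in> \<real>\<^sub>\<ge>\<^sub>0"
proof (rule closed_sequentially[OF closed_nonneg_Reals_complex])
  show "(\<lambda>n. \<Sum>i<n. f i) \<longlonglongrightarrow> suminf f"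
    using assms(1) by (rule summable_LIMSEQ)
  show "(\<Sum>i<n. f i) \<in> \<real>\<^sub>\<ge>\<^sub>0" for n
    using assms(2) by (auto simp: complex_nonneg_Reals_iff intro: sum_nonneg)
qed

text \<open>The condition on the witness in \<open>spectrum_op\<close>, named so that further
  properties of the witness, above all positivity, can be stated beside it.\<close>

definition is_resolvent :: "'a measure \<Rightarrow> 'a op \<Rightarrow> complex \<Rightarrow> 'a op \<Rightarrow> bool" where
  "is_resolvent M A z Q \<longleftrightarrow> bounded_op M Q \<and>
     (\<forall>f\<in>L2 M. (AE x in M. Q (\<lambda>y. z * f y - A f y) x = f x) \<and>
                (AE x in M. z * Q f x - A (Q f) x = f x))"

lemma spectrum_op_iff: "z \<in> spectrum_op M A \<longleftrightarrow> (\<nexists>Q. is_resolvent M A z Q)"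
  by (simp add: spectrum_op_def is_resolvent_def)

text \<open>The series of A^n / z^(n+1) converges geometrically in norm. Its terms are positive when
  \<open>A\<close> is positive and z is nonnegative; that clause supplies positive resolvents on a
  real half line.\<close>

lemma Neumann_series:
  assumes A: "linear_op M A" and g: "growth M A t" and t: "0 \<le> t" "t < cmod z"
  shows "\<exists>Q. is_resolvent M A z Q \<and> (positive_op M A \<longrightarrow> z \<in> \<real>\<^sub>\<ge>\<^sub>0 \<longrightarrow> positive_op M Q)"
proof -
  obtain K where K: "K \<ge> 0" "\<And>n. op_bound M (A ^^ n) (K * t ^ n)"
    using g by (auto simp: growth_def)
  have z0: "z \<noteq> 0" using t by auto
  note An = linear_op_funpow[OF A]
  define T where "T = (\<lambda>n f x. (A ^^ n) f x / z ^ Suc n)"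
  define Q where "Q = (\<lambda>f x. \<Sum>n. T n f x)"
  have T_alt: "T n f = (\<lambda>x. inverse (z ^ Suc n) * (A ^^ n) f x)" for n f
    by (simp add: T_def divide_inverse mult.commute)
  have T: "T n f \<in> L2 M" if "f \<in> L2 M" for n f
    unfolding T_alt by (intro L2_scale linear_op_L2[OF An] that)
  define q where "q = t / cmod z"
  have q: "0 \<le> q" "q < 1" using t z0 by (auto simp: q_def)
  have Tn: "L2_norm M (T n f) \<le> K / cmod z * q ^ n * L2_norm M f" if f: "f \<in> L2 M" for n f
  proof -
    have "L2_norm M (T n f) = inverse (cmod z ^ Suc n) * L2_norm M ((A ^^ n) f)"
      unfolding T_alt L2_norm_scale by (simp add: norm_inverse norm_power norm_mult)
    also have "\<dots> \<le> inverse (cmod z ^ Suc n) * (K * t ^ n * L2_norm M f)"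
      by (intro mult_left_mono op_boundD[OF K(2)] f) auto
    also have "\<dots> = K / cmod z * q ^ n * L2_norm M f"
      by (simp add: q_def field_simps)
    finally show ?thesis .
  qed
  have geo: "summable (\<lambda>n. K / cmod z * q ^ n * L2_norm M f)" for f
    using q by (intro summable_mult summable_mult2 summable_geometric) auto
  have sT: "summable (\<lambda>n. L2_norm M (T n f))" if f: "f \<in> L2 M" for f
    by (rule summable_comparison_test[OF _ geo[of f]]) (use Tn[OF f] in auto)
  have sAE: "AE x in M. summable (\<lambda>n. T n f x)" if f: "f \<in> L2 M" for f
    using L2_summable_series(1)[OF T[OF f] sT[OF f]] by eventually_elim (rule summable_norm_cancel)
  have Q: "Q f \<in> L2 M" if f: "f \<in> L2 M" for f
    unfolding Q_def by (rule L2_summable_series(2)[OF T[OF f] sT[OF f]])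
  have Qlin: "linear_op M Q"
    unfolding linear_op_def
  proof (intro conjI ballI allI impI)
    fix f assume f: "f \<in> L2 M"
    show "Q f \<in> L2 M" by (rule Q[OF f])
    fix c
    have "AE x in M. \<forall>n. (A ^^ n) (\<lambda>y. c * f y) x = c * (A ^^ n) f x"
      unfolding AE_all_countable by (intro allI linear_op_scale[OF An f])
    with sAE[OF f] show "AE x in M. Q (\<lambda>y. c * f y) x = c * Q f x"
    proof eventually_elim
      case (elim x)
      then show ?case unfolding Q_def
        by (subst suminf_mult[symmetric]) (simp_all add: T_def)
    qed
  next
    fix f g assume f: "f \<in> L2 M" and g: "g \<in> L2 M"
    have "AE x in M. \<forall>n. (A ^^ n) (\<lambda>y. f y + g y) x = (A ^^ n) f x + (A ^^ n) g x"
      unfolding AE_all_countable by (intro allI linear_op_add[OF An f g])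
    with sAE[OF f] sAE[OF g] show "AE x in M. Q (\<lambda>y. f y + g y) x = Q f x + Q g x"
    proof eventually_elim
      case (elim x)
      then show ?case unfolding Q_def
        by (subst suminf_add) (simp_all add: T_def add_divide_distrib)
    qed
    assume fg: "AE x in M. f x = g x"
    have "AE x in M. \<forall>n. (A ^^ n) f x = (A ^^ n) g x"
      unfolding AE_all_countable by (intro allI linear_op_cong[OF An f g fg])
    then show "AE x in M. Q f x = Q g x"
      by eventually_elim (simp add: Q_def T_def)
  qed
  \<comment> \<open>The norm estimate for the tails serves twice: with N = 0 it bounds
    \<open>Q\<close>, and for large N it controls the defect of the right inverse.\<close>
  have tail: "L2_norm M (\<lambda>x. Q f x - (\<Sum>n<N. T n f x)) \<le> (\<Sum>n. L2_norm M (T (n + N) f))"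
    if f: "f \<in> L2 M" for f N
  proof -
    have s: "summable (\<lambda>n. L2_norm M (T (n + N) f))"
      using sT[OF f] by (rule summable_ignore_initial_segment)
    note tailN = L2_summable_series[OF T[OF f] s]
    have "AE x in M. Q f x - (\<Sum>n<N. T n f x) = (\<Sum>n. T (n + N) f x)"
      using sAE[OF f]
    proof eventually_elim
      case (elim x)
      show ?case using suminf_split_initial_segment[OF elim, of N] by (simp add: Q_def)
    qed

    then have "L2_norm M (\<lambda>x. Q f x - (\<Sum>n<N. T n f x)) = L2_norm M (\<lambda>x. \<Sum>n. T (n + N) f x)"
      by (intro L2_norm_cong_AE L2_measurable L2_diff Q L2_sum T f tailN)
    with tailN(3) show ?thesis by simp
  qed
  have Qb: "bounded_op M Q"
    unfolding bounded_op_iff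
  proof (intro conjI exI)
    show "op_bound M Q (\<Sum>n. K / cmod z * q ^ n)"
    proof (rule op_boundI)
      fix f assume f: "f \<in> L2 M"
      have "L2_norm M (Q f) \<le> (\<Sum>n. L2_norm M (T n f))" using tail[OF f, of 0] by simp
      also have "\<dots> \<le> (\<Sum>n. K / cmod z * q ^ n * L2_norm M f)"
        by (intro suminf_le sT geo Tn f)
      also have "\<dots> = (\<Sum>n. K / cmod z * q ^ n) * L2_norm M f"
        using q by (intro suminf_mult2[symmetric] summable_mult summable_geometric) auto
      finally show "L2_norm M (Q f) \<le> (\<Sum>n. K / cmod z * q ^ n) * L2_norm M f" .
    qed
  qed (rule Qlin)
  \<comment> \<open>Here every power acts on one fixed function, so the series telescopes at almost
    every x.\<close>
  have left: "AE x in M. Q (\<lambda>y. z * f y - A f y) x = f x" if f: "f \<in> L2 M" for f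
  proof -
    have zf: "(\<lambda>y. z * f y) \<in> L2 M" and Af: "A f \<in> L2 M"
      using f by (auto intro: L2_scale linear_op_L2[OF A])
    have "AE x in M. \<forall>n. (A ^^ n) (\<lambda>y. z * f y - A f y) x
        = (A ^^ n) (\<lambda>y. z * f y) x - (A ^^ n) (A f) x"
      unfolding AE_all_countable by (intro allI linear_op_diff[OF An zf Af])
    moreover have "AE x in M. \<forall>n. (A ^^ n) (\<lambda>y. z * f y) x = z * (A ^^ n) f x"
      unfolding AE_all_countable by (intro allI linear_op_scale[OF An f])
    ultimately show ?thesis using sAE[OF f]
    proof eventually_elim
      case (elim x)
      let ?u = "\<lambda>n. (A ^^ n) f x / z ^ n"
      have "(\<lambda>n. z * T n f x) \<longlonglongrightarrow> z * 0"
        by (intro tendsto_mult tendsto_const summable_LIMSEQ_zero elim)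
      then have u: "?u \<longlonglongrightarrow> 0" using z0 by (simp add: T_def)
      have eq: "T n (\<lambda>y. z * f y - A f y) x = ?u n - ?u (Suc n)" for n
        using elim(1,2) z0 by (simp add: T_def diff_divide_distrib funpow_swap1)
      have "(\<lambda>n. T n (\<lambda>y. z * f y - A f y) x) sums (?u 0 - 0)"
        unfolding eq by (rule telescope_sums'[OF u])
      then show ?case by (simp add: Q_def sums_iff)
    qed
  qed
  \<comment> \<open>\<open>A\<close> is continuous in norm only, so A (Q f) cannot be evaluated term
    by term at a point. Q f is approximated by its partial sums, and the defect is shown to vanish
    in norm.\<close>
  have right: "AE x in M. z * Q f x - A (Q f) x = f x" if f: "f \<in> L2 M" for f
  proof (rule AE_eqI_L2_norm)
    have AQ: "A (Q f) \<in> L2 M" by (intro linear_op_L2[OF A] Q f)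
    show L: "(\<lambda>x. z * Q f x - A (Q f) x) \<in> L2 M" by (intro L2_diff L2_scale Q f AQ)
    let ?S = "\<lambda>N x. \<Sum>n<N. T n f x"
    have S: "?S N \<in> L2 M" for N by (intro L2_sum T f)
    \<comment> \<open>\<open>K * t\<close> bounds \<open>A\<close> itself, being the case n = 1 of
      the growth hypothesis.\<close>
    let ?C = "cmod z + K * t"
    have bound: "L2_norm M (\<lambda>x. z * Q f x - A (Q f) x - f x)
        \<le> ?C * (\<Sum>n. L2_norm M (T (n + N) f)) + cmod z * L2_norm M (T N f)" for N
    proof -
      have D: "(\<lambda>x. Q f x - ?S N x) \<in> L2 M" by (intro L2_diff Q f S)
      have "AE x in M. \<forall>n. A (T n f) x = z * T (Suc n) f x"
        unfolding AE_all_countable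
      proof
        fix n
        show "AE x in M. A (T n f) x = z * T (Suc n) f x"
          using linear_op_scale[OF A linear_op_L2[OF An f, of n], of "inverse (z ^ Suc n)"]
          unfolding T_alt by eventually_elim (use z0 in \<open>simp add: field_simps\<close>)
      qed
      moreover have "AE x in M. A (?S N) x = (\<Sum>n<N. A (T n f) x)"
        by (intro linear_op_sum[OF A] T f)
      moreover have "AE x in M. A (\<lambda>x. Q f x - ?S N x) x = A (Q f) x - A (?S N) x"
        by (intro linear_op_diff[OF A] Q f S)
      ultimately have eq: "AE x in M. z * Q f x - A (Q f) x - f x
         = z * (Q f x - ?S N x) - A (\<lambda>x. Q f x - ?S N x) x - z * T N f x"
      proof eventually_elim
        case (elim x)
        have "z * (\<Sum>n<N. T n f x) - (\<Sum>n<N. A (T n f) x) = (\<Sum>n<N. z * T n f x - z * T (Suc n) f x)"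
          by (simp add: elim sum_distrib_left sum_subtractf)
        also have "\<dots> = z * T 0 f x - z * T N f x" by (rule sum_lessThan_telescope')
        also have "z * T 0 f x = f x" using z0 by (simp add: T_def)
        finally have fx: "f x = z * (\<Sum>n<N. T n f x) - (\<Sum>n<N. A (T n f) x) + z * T N f x"
          by (simp add: algebra_simps)
        show ?case unfolding elim(2,3) by (subst fx) (simp add: algebra_simps)
      qed
      have "L2_norm M (\<lambda>x. z * Q f x - A (Q f) x - f x)
         = L2_norm M (\<lambda>x. z * (Q f x - ?S N x) - A (\<lambda>x. Q f x - ?S N x) x - z * T N f x)"
        by (intro L2_norm_cong_AE eq L2_measurable L2_diff L f L2_scale T D linear_op_L2[OF A])
      also have "\<dots> \<le> L2_norm M (\<lambda>x. z * (Q f x - ?S N x) - A (\<lambda>x. Q f x - ?S N x) x)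
          + L2_norm M (\<lambda>x. z * T N f x)"
        by (intro L2_norm_triangle_diff L2_diff L2_scale T f D linear_op_L2[OF A])
      also have "L2_norm M (\<lambda>x. z * (Q f x - ?S N x) - A (\<lambda>x. Q f x - ?S N x) x)
        \<le> L2_norm M (\<lambda>x. z * (Q f x - ?S N x)) + L2_norm M (A (\<lambda>x. Q f x - ?S N x))"
        by (intro L2_norm_triangle_diff L2_scale D linear_op_L2[OF A])
      also have "L2_norm M (A (\<lambda>x. Q f x - ?S N x)) \<le> K * t * L2_norm M (\<lambda>x. Q f x - ?S N x)"
        using op_boundD[OF K(2)[of 1] D] by simp
      finally have "L2_norm M (\<lambda>x. z * Q f x - A (Q f) x - f x)
         \<le> ?C * L2_norm M (\<lambda>x. Q f x - ?S N x) + cmod z * L2_norm M (T N f)"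
        unfolding L2_norm_scale by (simp add: distrib_right)
      also have "?C * L2_norm M (\<lambda>x. Q f x - ?S N x) \<le> ?C * (\<Sum>n. L2_norm M (T (n + N) f))"
        using K(1) t by (intro mult_left_mono tail f) auto
      finally show ?thesis by simp
    qed
    have "(\<lambda>N. ?C * (\<Sum>n. L2_norm M (T (n + N) f)) + cmod z * L2_norm M (T N f))
        \<longlonglongrightarrow> ?C * 0 + cmod z * 0"
      by (intro tendsto_add tendsto_mult tendsto_const summable_LIMSEQ_zero sT f suminf_exist_split2)
    then have "L2_norm M (\<lambda>x. z * Q f x - A (Q f) x - f x) \<le> 0"
      by (intro LIMSEQ_le_const[where X = "\<lambda>N. ?C * (\<Sum>n. L2_norm M (T (n + N) f)) + cmod z * L2_norm M (T N f)"])
         (use bound in auto)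
    then show "L2_norm M (\<lambda>x. z * Q f x - A (Q f) x - f x) = 0"
      by (intro antisym) auto
  qed (rule f)
  have "positive_op M Q" if pos: "positive_op M A" and zpos: "z \<in> \<real>\<^sub>\<ge>\<^sub>0"
    unfolding positive_op_def
  proof (intro conjI ballI impI)
    fix f assume f: "f \<in> L2 M" and fpos: "AE x in M. f x \<in> \<real>\<^sub>\<ge>\<^sub>0"
    have "AE x in M. \<forall>n. (A ^^ n) f x \<in> \<real>\<^sub>\<ge>\<^sub>0"
      unfolding AE_all_countable by (intro allI positive_opD[OF positive_op_funpow[OF pos]] f fpos)
    with sAE[OF f] show "AE x in M. Q f x \<in> \<real>\<^sub>\<ge>\<^sub>0"
      by eventually_elim
         (auto simp: Q_def T_def intro!: suminf_nonneg_Reals nonneg_Reals_divide_I nonneg_Reals_mult_I nonneg_Reals_pow_I zpos)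
  qed (rule Qlin)
  then show ?thesis using Qb left right unfolding is_resolvent_def by blast
qed

subsection \<open>The spectral radius of a positive operator\<close>

lemma nonneg_Sup_upper: "bdd_above S \<Longrightarrow> x \<in> S \<Longrightarrow> x \<le> nonneg_Sup S"
  unfolding nonneg_Sup_def by (intro cSup_upper) auto

lemma nonneg_Sup_nonneg: "bdd_above S \<Longrightarrow> 0 \<le> nonneg_Sup S"
  unfolding nonneg_Sup_def by (intro cSup_upper) auto

lemma nonneg_Sup_least: "(\<And>x. x \<in> S \<Longrightarrow> x \<le> t) \<Longrightarrow> 0 \<le> t \<Longrightarrow> nonneg_Sup S \<le> t"
  unfolding nonneg_Sup_def by (intro cSup_least) auto

lemma growthI: "0 \<le> K \<Longrightarrow> (\<And>n. op_bound M (A ^^ n) (K * t ^ n)) \<Longrightarrow> growth M A t"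
  by (auto simp: growth_def)

lemma growth_of_op_bound:
  assumes "linear_op M A" "op_bound M A C" "0 \<le> C" shows "growth M A C"
  by (rule growthI[of 1]) (use op_bound_funpow[OF assms] in auto)

lemma growth_mono:
  assumes "growth M A t" "0 \<le> t" "t \<le> u" shows "growth M A u"
proof -
  obtain K where K: "K \<ge> 0" "\<And>n. op_bound M (A ^^ n) (K * t ^ n)"
    using assms(1) by (auto simp: growth_def)
  show ?thesis
    by (rule growthI[OF K(1)], rule op_bound_mono[OF K(2)])
       (intro mult_left_mono power_mono assms K(1))
qed

lemma spectrum_op_le_growth:
  assumes "linear_op M A" "growth M A t" "0 \<le> t" "z \<in> spectrum_op M A" shows "cmod z \<le> t"
  using Neumann_series[OF assms(1,2,3), of z] assms(4) by (auto simp: spectrum_op_iff not_le[symmetric])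

lemma spectral_radius_le_growth:
  assumes "linear_op M A" "growth M A t" "0 \<le> t" shows "spectral_radius_op M A \<le> t"
  unfolding spectral_radius_op_def
  by (rule nonneg_Sup_least) (use spectrum_op_le_growth[OF assms] assms(3) in auto)

lemma bdd_above_spectrum:
  assumes "bounded_op M A" shows "bdd_above (cmod ` spectrum_op M A)"
proof -
  obtain C where C: "0 < C" "linear_op M A" "op_bound M A C"
    using bounded_opE[OF assms] .
  then have "growth M A C" by (intro growth_of_op_bound) auto
  then show ?thesis
    by (intro bdd_aboveI2[of _ _ C]) (use spectrum_op_le_growth[OF C(2)] C(1) in auto)
qed

lemma spectral_radius_nonneg: "bounded_op M A \<Longrightarrow> 0 \<le> spectral_radius_op M A"
  unfolding spectral_radius_op_def by (intro nonneg_Sup_nonneg bdd_above_spectrum)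

lemma spectral_radius_le_op_bound:
  assumes "linear_op M A" "op_bound M A C" "0 \<le> C" shows "spectral_radius_op M A \<le> C"
  by (intro spectral_radius_le_growth growth_of_op_bound assms)

lemma L2_nonneg_part:
  assumes f: "f \<in> L2 M" and p: "continuous_on UNIV p" "\<And>z. cmod (complex_of_real (p z)) \<le> cmod z"
  shows "(\<lambda>x. complex_of_real (p (f x))) \<in> L2 M"
    "L2_norm M (\<lambda>x. complex_of_real (p (f x))) \<le> L2_norm M f"
proof -
  have "(\<lambda>x. complex_of_real (p (f x))) \<in> borel_measurable M"
    by (rule borel_measurable_continuous_on[OF continuous_on_of_real[OF p(1)] L2_measurable[OF f]])
  from L2_dominated[OF f this] p(2)
  show "(\<lambda>x. complex_of_real (p (f x))) \<in> L2 M"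
    "L2_norm M (\<lambda>x. complex_of_real (p (f x))) \<le> L2_norm M f" by auto
qed

text \<open>Split f into the positive and negative parts of its real and imaginary parts, each of
  norm at most that of f. The factor 4 counts them; it is harmless because \<open>growth\<close>
  absorbs constants.\<close>

lemma op_bound_of_nonneg:
  assumes A: "linear_op M A" and C: "0 \<le> C"
    and le: "\<And>f. f \<in> L2 M \<Longrightarrow> (\<And>x. f x \<in> \<real>\<^sub>\<ge>\<^sub>0) \<Longrightarrow> L2_norm M (A f) \<le> C * L2_norm M f"
  shows "op_bound M A (4 * C)"
proof (rule op_boundI)
  fix f assume f: "f \<in> L2 M"
  define p1 where "p1 = (\<lambda>x. complex_of_real (max 0 (Re (f x))))"
  define p2 where "p2 = (\<lambda>x. complex_of_real (max 0 (- Re (f x))))"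
  define p3 where "p3 = (\<lambda>x. complex_of_real (max 0 (Im (f x))))"
  define p4 where "p4 = (\<lambda>x. complex_of_real (max 0 (- Im (f x))))"
  have re: "cmod (complex_of_real (max 0 (Re z))) \<le> cmod z" "cmod (complex_of_real (max 0 (- Re z))) \<le> cmod z"
    and im: "cmod (complex_of_real (max 0 (Im z))) \<le> cmod z" "cmod (complex_of_real (max 0 (- Im z))) \<le> cmod z"
    for z using abs_Re_le_cmod[of z] abs_Im_le_cmod[of z] by auto
  have p: "p1 \<in> L2 M" "p2 \<in> L2 M" "p3 \<in> L2 M" "p4 \<in> L2 M"
    and n: "L2_norm M p1 \<le> L2_norm M f" "L2_norm M p2 \<le> L2_norm M f"
      "L2_norm M p3 \<le> L2_norm M f" "L2_norm M p4 \<le> L2_norm M f"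
    unfolding p1_def p2_def p3_def p4_def
    by (intro L2_nonneg_part[OF f] re im continuous_intros)+
  have le': "L2_norm M (A p) \<le> C * L2_norm M f"
    if "p \<in> L2 M" "\<And>x. p x \<in> \<real>\<^sub>\<ge>\<^sub>0" "L2_norm M p \<le> L2_norm M f" for p
    using le[OF that(1,2)] mult_left_mono[OF that(3) C] by simp
  have b: "L2_norm M (A p1) \<le> C * L2_norm M f" "L2_norm M (A p2) \<le> C * L2_norm M f"
      "L2_norm M (A p3) \<le> C * L2_norm M f" "L2_norm M (A p4) \<le> C * L2_norm M f"
    by (intro le' p n; simp add: p1_def p2_def p3_def p4_def)+
  have f_eq: "f = (\<lambda>x. (p1 x - p2 x) + \<i> * (p3 x - p4 x))"
    by (auto simp: p1_def p2_def p3_def p4_def complex_eq_iff max_def)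
  note Ap = linear_op_L2[OF A p(1)] linear_op_L2[OF A p(2)] linear_op_L2[OF A p(3)] linear_op_L2[OF A p(4)]
  note d12 = L2_diff[OF p(1,2)] and d34 = L2_diff[OF p(3,4)]
  have "AE x in M. A f x = (A p1 x - A p2 x) + \<i> * (A p3 x - A p4 x)"
    using linear_op_add[OF A d12 L2_scale[OF d34, of \<i>]] linear_op_diff[OF A p(1,2)]
      linear_op_diff[OF A p(3,4)] linear_op_scale[OF A d34, of \<i>]
    unfolding f_eq[symmetric] by eventually_elim simp
  then have "L2_norm M (A f) = L2_norm M (\<lambda>x. (A p1 x - A p2 x) + \<i> * (A p3 x - A p4 x))"
    by (intro L2_norm_cong_AE L2_measurable linear_op_L2[OF A f] L2_add L2_scale L2_diff Ap)
  also have "\<dots> \<le> L2_norm M (\<lambda>x. A p1 x - A p2 x) + L2_norm M (\<lambda>x. \<i> * (A p3 x - A p4 x))"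
    by (intro L2_norm_triangle L2_scale L2_diff Ap)
  also have "\<dots> \<le> (L2_norm M (A p1) + L2_norm M (A p2)) + (L2_norm M (A p3) + L2_norm M (A p4))"
    unfolding L2_norm_scale by simp (intro add_mono L2_norm_triangle_diff Ap)
  also have "\<dots> \<le> 4 * C * L2_norm M f" using b by simp
  finally show "L2_norm M (A f) \<le> 4 * C * L2_norm M f" .
qed

lemma nonneg_Reals_cmod_mono:
  assumes "u \<in> \<real>\<^sub>\<ge>\<^sub>0" "v - u \<in> \<real>\<^sub>\<ge>\<^sub>0" shows "cmod u \<le> cmod v"
  using assms by (auto simp: complex_nonneg_Reals_iff cmod_def)

text \<open>
  A resolvent \<open>(t - A)\<^sup>-\<^sup>1\<close> that is positive at a single \<open>t > 0\<close> bounds all powers: if \<open>t g - A g = f \<ge> 0\<close>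
  with \<open>g \<ge> 0\<close>, then \<open>A g \<le> t g\<close>, whence \<open>A\<^sup>n f \<le> t A\<^sup>n g \<le> t\<^sup>n\<^sup>+\<^sup>1 g\<close>.
\<close>

lemma growth_of_nonneg_solutions:
  assumes A: "positive_op M A" and t: "0 < t" and K: "0 \<le> K"
    and sol: "\<And>f. f \<in> L2 M \<Longrightarrow> (\<And>x. f x \<in> \<real>\<^sub>\<ge>\<^sub>0) \<Longrightarrow> \<exists>g\<in>L2 M. (AE x in M. g x \<in> \<real>\<^sub>\<ge>\<^sub>0) \<and>
       (AE x in M. complex_of_real t * g x - A g x = f x) \<and> L2_norm M g \<le> K * L2_norm M f"
  shows "growth M A t"
proof (rule growthI)
  fix n
  note Alin = positive_op_linear[OF A]
  have "op_bound M (A ^^ n) (4 * (t ^ Suc n * K))"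
  proof (rule op_bound_of_nonneg)
    fix f :: "'a \<Rightarrow> complex" assume f: "f \<in> L2 M" "\<And>x. f x \<in> \<real>\<^sub>\<ge>\<^sub>0"
    then obtain g where g: "g \<in> L2 M" "AE x in M. g x \<in> \<real>\<^sub>\<ge>\<^sub>0"
      and eq: "AE x in M. complex_of_real t * g x - A g x = f x" and gn: "L2_norm M g \<le> K * L2_norm M f"
      using sol by blast
    let ?t = "complex_of_real t"
    have tpos: "?t \<in> \<real>\<^sub>\<ge>\<^sub>0" using t by simp
    note Ang = linear_op_L2[OF linear_op_funpow[OF Alin] g(1)]
    have tg: "(\<lambda>y. ?t * g y) \<in> L2 M" by (intro L2_scale g)
    have Ang_pos: "AE x in M. (A ^^ k) g x \<in> \<real>\<^sub>\<ge>\<^sub>0" for k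
      by (intro positive_opD[OF positive_op_funpow[OF A]] g)
    \<comment> \<open>This is \<open>A ^^ k\<close> applied to the equation t g - A g = f.\<close>
    have step: "AE x in M. ?t * (A ^^ k) g x - (A ^^ k) f x = (A ^^ Suc k) g x" for k
    proof -
      have "AE x in M. (A ^^ k) (\<lambda>y. ?t * g y - A g y) x = (A ^^ k) f x"
        by (rule linear_op_cong[OF linear_op_funpow[OF Alin] _ f(1) eq])
           (intro L2_diff tg linear_op_L2[OF Alin] g)
      moreover have "AE x in M. (A ^^ k) (\<lambda>y. ?t * g y - A g y) x
          = (A ^^ k) (\<lambda>y. ?t * g y) x - (A ^^ k) (A g) x"
        by (intro linear_op_diff linear_op_funpow Alin tg linear_op_L2[OF Alin] g)
      ultimately show ?thesis
        using linear_op_scale[OF linear_op_funpow[OF Alin] g(1), of k ?t]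
        by eventually_elim (simp add: funpow_swap1 diff_eq_eq eq_diff_eq add.commute)
    qed
    have Anf_pos: "AE x in M. (A ^^ k) f x \<in> \<real>\<^sub>\<ge>\<^sub>0" for k
      by (intro positive_opD[OF positive_op_funpow[OF A]] f AE_I2)
    have dom: "AE x in M. ?t ^ k * g x - (A ^^ k) g x \<in> \<real>\<^sub>\<ge>\<^sub>0" for k
    proof (induction k)
      case (Suc k)
      then show ?case using step[of k] Anf_pos[of k]
      proof eventually_elim
        case (elim x)
        have "?t ^ Suc k * g x - (A ^^ Suc k) g x
            = ?t * (?t ^ k * g x - (A ^^ k) g x) + (A ^^ k) f x"
          unfolding elim(2)[symmetric] by (simp add: algebra_simps)
        also have "\<dots> \<in> \<real>\<^sub>\<ge>\<^sub>0"
          by (intro nonneg_Reals_add_I nonneg_Reals_mult_I tpos elim)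
        finally show ?case .
      qed
    qed simp
    have "AE x in M. cmod ((A ^^ n) f x) \<le> cmod (?t ^ Suc n * g x)"
      using dom[of "n"] step[of n] Ang_pos[of "Suc n"] Anf_pos[of n]
    proof eventually_elim
      case (elim x)
      have "?t ^ Suc n * g x - (A ^^ n) f x = ?t * (?t ^ n * g x - (A ^^ n) g x) + (A ^^ Suc n) g x"
        unfolding elim(2)[symmetric] by (simp add: algebra_simps)
      also have "\<dots> \<in> \<real>\<^sub>\<ge>\<^sub>0"
        by (intro nonneg_Reals_add_I nonneg_Reals_mult_I tpos elim)
      finally show ?case by (intro nonneg_Reals_cmod_mono elim)
    qed
    then have "L2_norm M ((A ^^ n) f) \<le> L2_norm M (\<lambda>x. ?t ^ Suc n * g x)"
      by (intro L2_dominated(2) L2_scale g L2_measurable linear_op_L2[OF linear_op_funpow[OF Alin]] f)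
    also have "\<dots> = t ^ Suc n * L2_norm M g"
      unfolding L2_norm_scale using t by (simp add: norm_power norm_mult)
    also have "\<dots> \<le> t ^ Suc n * (K * L2_norm M f)" by (intro mult_left_mono gn) (use t in auto)
    finally show "L2_norm M ((A ^^ n) f) \<le> t ^ Suc n * K * L2_norm M f" by simp
  qed (use t K in \<open>auto intro: linear_op_funpow Alin\<close>)
  then show "op_bound M (A ^^ n) (4 * t * K * t ^ n)" by (simp add: algebra_simps)
qed (use t K in auto)

text \<open>
  Let \<open>r\<close> be the infimum of the growth rates of \<open>A\<close>. To the right of \<open>r\<close> the resolvent is a Neumann
  series, hence positive. If \<open>r - A\<close> were invertible, the resolvent would stay bounded as its
  argument approaches \<open>r\<close> from the right, so its expansion around a point slightly above \<open>r\<close> would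
  give positive solutions slightly below \<open>r\<close>. Therefore \<open>r\<close> belongs to the spectrum.
\<close>

lemma growth_of_spectral_radius_less:
  assumes A: "positive_op M A" and b: "bounded_op M A" and t: "spectral_radius_op M A < t"
  shows "growth M A t"
proof (rule ccontr)
  assume ng: "\<not> growth M A t"
  have t0: "0 < t" using spectral_radius_nonneg[OF b] t by simp
  note Alin = positive_op_linear[OF A]
  obtain C where C: "0 < C" "op_bound M A C" using bounded_opE[OF b] by metis
  \<comment> \<open>Rates are upward closed, so every rate in \<open>G\<close> exceeds t once t is
    supposed not to be a rate.\<close>
  define G where "G = {u. 0 < u \<and> growth M A u}"
  have G_ne: "G \<noteq> {}" using growth_of_op_bound[OF Alin C(2)] C(1) by (auto simp: G_def)
  have G_gt: "t < u" if "u \<in> G" for u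
    using that ng growth_mono[of M A u t] by (force simp: G_def)
  have bddG: "bdd_below G" by (rule bdd_belowI[of _ t]) (use G_gt in force)
  define r where "r = Inf G"
  have r: "t \<le> r" unfolding r_def by (intro cInf_greatest G_ne) (use G_gt in force)
  have "complex_of_real r \<notin> spectrum_op M A"
  proof
    assume "complex_of_real r \<in> spectrum_op M A"
    then have "cmod (complex_of_real r) \<le> spectral_radius_op M A"
      unfolding spectral_radius_op_def by (intro nonneg_Sup_upper bdd_above_spectrum b imageI)
    with t r t0 show False by simp
  qed
  then obtain R where "is_resolvent M A (complex_of_real r) R"
    unfolding spectrum_op_iff by auto
  then have Rb: "bounded_op M R"
    and Rl: "\<And>f. f \<in> L2 M \<Longrightarrow> AE x in M. R (\<lambda>y. complex_of_real r * f y - A f y) x = f x"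
    unfolding is_resolvent_def by auto
  obtain K where K: "0 < K" "linear_op M R" "op_bound M R K" using bounded_opE[OF Rb] by metis
  \<comment> \<open>The bound \<open>1 / (8 * K)\<close> serves two purposes: it makes the \<delta>
    term in the estimate of \<open>Q1\<close> absorbable, and it puts r - \<delta> within reach of
    the expansion around s. The bound \<open>r / 2\<close> keeps r - \<delta> positive.\<close>
  define \<delta> where "\<delta> = min (1 / (8 * K)) (r / 2)"
  have \<delta>: "0 < \<delta>" "\<delta> < r" "\<delta> * K \<le> 1 / 8"
  proof -
    show "0 < \<delta>" "\<delta> < r" using K r t0 by (auto simp: \<delta>_def)
    have "\<delta> * K \<le> 1 / (8 * K) * K" by (intro mult_right_mono) (use K in \<open>auto simp: \<delta>_def\<close>)
    then show "\<delta> * K \<le> 1 / 8" using K by simp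
  qed
  define s where "s = r + \<delta>"
  have "Inf G < s" unfolding r_def[symmetric] s_def using \<delta> by simp
  then obtain u where u: "u \<in> G" "u < s" using cInf_lessD[OF G_ne] by blast
  have cs: "cmod (complex_of_real s) = s" unfolding norm_of_real using r t0 \<delta> by (simp add: s_def)
  have sp: "complex_of_real s \<in> \<real>\<^sub>\<ge>\<^sub>0" unfolding nonneg_Reals_of_real_iff using r t0 \<delta> by (simp add: s_def)
  obtain Q1 where Q1: "is_resolvent M A (complex_of_real s) Q1" "positive_op M Q1"
    using Neumann_series[OF Alin, of u "complex_of_real s"] u cs A sp by (auto simp: G_def)
  then have Q1r: "\<And>f. f \<in> L2 M \<Longrightarrow> AE x in M. complex_of_real s * Q1 f x - A (Q1 f) x = f x"
    and Q1p: "positive_op M Q1"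
    unfolding is_resolvent_def by auto
  note Q1lin = positive_op_linear[OF Q1p]
  \<comment> \<open>From R (r - A) = 1 follows Q1 f = R (f - \<delta> Q1 f). Absorbing the \<delta>
    term gives the factor 8 / 7, rounded up to 2; the resulting bound depends on \<open>R\<close>
    alone.\<close>
  have Q1n: "op_bound M Q1 (2 * K)"
  proof (rule op_boundI)
    fix f assume f: "f \<in> L2 M"
    note v = linear_op_L2[OF Q1lin f]
    note Av = linear_op_L2[OF Alin v]
    have "AE x in M. complex_of_real r * Q1 f x - A (Q1 f) x = f x - complex_of_real \<delta> * Q1 f x"
      using Q1r[OF f] by eventually_elim (simp add: s_def algebra_simps)
    then have "AE x in M. R (\<lambda>x. complex_of_real r * Q1 f x - A (Q1 f) x) x
         = R (\<lambda>x. f x - complex_of_real \<delta> * Q1 f x) x"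
      by (intro linear_op_cong[OF K(2)] L2_diff L2_scale v Av f)
    with Rl[OF v] have "AE x in M. Q1 f x = R (\<lambda>x. f x - complex_of_real \<delta> * Q1 f x) x"
      by eventually_elim simp
    then have "L2_norm M (Q1 f) = L2_norm M (R (\<lambda>x. f x - complex_of_real \<delta> * Q1 f x))"
      by (intro L2_norm_cong_AE L2_measurable v linear_op_L2[OF K(2)] L2_diff L2_scale f)
    also have "\<dots> \<le> K * L2_norm M (\<lambda>x. f x - complex_of_real \<delta> * Q1 f x)"
      by (intro op_boundD[OF K(3)] L2_diff L2_scale f v)
    also have "\<dots> \<le> K * (L2_norm M f + L2_norm M (\<lambda>x. complex_of_real \<delta> * Q1 f x))"
      using K(1) by (intro mult_left_mono L2_norm_triangle_diff f L2_scale v) auto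
    also have "\<dots> = K * L2_norm M f + \<delta> * K * L2_norm M (Q1 f)"
      unfolding L2_norm_scale using \<delta> by (simp add: algebra_simps)
    also have "\<dots> \<le> K * L2_norm M f + 1 / 8 * L2_norm M (Q1 f)"
      by (intro add_left_mono mult_right_mono \<delta>) simp
    finally have "7 / 8 * L2_norm M (Q1 f) \<le> K * L2_norm M f" by simp
    then have "L2_norm M (Q1 f) \<le> 8 / 7 * (K * L2_norm M f)" by simp
    also have "\<dots> \<le> 2 * (K * L2_norm M f)" using K(1) by (intro mult_right_mono) auto
    finally show "L2_norm M (Q1 f) \<le> 2 * K * L2_norm M f" by simp
  qed
  \<comment> \<open>With z = 1 / (2 \<delta>) one has s - 1 / z = r - \<delta>, and formally the
    inverse of s - 1 / z - A is z Q1 (z - Q1)^(-1). As z exceeds the bound 2 K of \<open>Q1\<close>,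
    the last factor is again a Neumann series, hence positive.\<close>
  define z where "z = 1 / (2 * \<delta>)"
  have z: "2 * K < z" "0 < z"
  proof -
    show "0 < z" using \<delta> by (simp add: z_def)
    have "2 * K * (2 * \<delta>) < 1" using \<delta>(3) by (simp add: algebra_simps)
    then show "2 * K < z" using \<delta> by (simp add: z_def field_simps)
  qed
  have zp: "complex_of_real z \<in> \<real>\<^sub>\<ge>\<^sub>0" using z by simp
  have "growth M Q1 (2 * K)" using K(1) by (intro growth_of_op_bound Q1lin Q1n) simp
  then obtain Q2 where "is_resolvent M Q1 (complex_of_real z) Q2" and Q2p: "positive_op M Q2"
    using Neumann_series[OF Q1lin, of "2 * K" "complex_of_real z"] K(1) z Q1p zp by auto
  then have Q2: "bounded_op M Q2"
    and Q2r: "\<And>f. f \<in> L2 M \<Longrightarrow> AE x in M. complex_of_real z * Q2 f x - Q1 (Q2 f) x = f x"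
    unfolding is_resolvent_def by auto
  note Q2lin = positive_op_linear[OF Q2p]
  obtain C2 where C2: "0 < C2" "op_bound M Q2 C2" using bounded_opE[OF Q2] by metis
  have "growth M A (r - \<delta>)"
  proof (rule growth_of_nonneg_solutions[OF A])
    show "0 < r - \<delta>" using \<delta> by simp
    show "0 \<le> 2 * K * z * C2" using K z C2 by simp
    fix f :: "'a \<Rightarrow> complex" assume f: "f \<in> L2 M" "\<And>x. f x \<in> \<real>\<^sub>\<ge>\<^sub>0"
    define h where "h = (\<lambda>y. complex_of_real z * Q2 f y)"
    note Q2f = linear_op_L2[OF Q2lin f(1)]
    have h: "h \<in> L2 M" unfolding h_def by (intro L2_scale Q2f)
    have "AE x in M. Q2 f x \<in> \<real>\<^sub>\<ge>\<^sub>0" by (intro positive_opD[OF Q2p] f AE_I2)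
    then have hp: "AE x in M. h x \<in> \<real>\<^sub>\<ge>\<^sub>0"
      by eventually_elim (use z in \<open>auto simp: h_def intro: nonneg_Reals_mult_I\<close>)
    show "\<exists>g\<in>L2 M. (AE x in M. g x \<in> \<real>\<^sub>\<ge>\<^sub>0) \<and>
       (AE x in M. complex_of_real (r - \<delta>) * g x - A g x = f x) \<and> L2_norm M g \<le> 2 * K * z * C2 * L2_norm M f"
    proof (intro bexI conjI)
      show "Q1 h \<in> L2 M" by (intro linear_op_L2[OF Q1lin] h)
      show "AE x in M. Q1 h x \<in> \<real>\<^sub>\<ge>\<^sub>0" by (intro positive_opD[OF Q1p] h hp)
      have rz: "complex_of_real (r - \<delta>) = complex_of_real s - inverse (complex_of_real z)"
        using \<delta> by (simp add: s_def z_def flip: of_real_inverse of_real_diff)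
      have "AE x in M. Q1 h x = complex_of_real z * Q1 (Q2 f) x"
        unfolding h_def by (intro linear_op_scale[OF Q1lin] Q2f)
      with Q1r[OF h] Q2r[OF f(1)]
      show "AE x in M. complex_of_real (r - \<delta>) * Q1 h x - A (Q1 h) x = f x"
      proof eventually_elim
        case (elim x)
        have "inverse (complex_of_real z) * Q1 h x = Q1 (Q2 f) x"
          unfolding elim(3) using z by simp
        then show ?case using elim(1,2) unfolding rz h_def by (simp add: algebra_simps)
      qed
      have "L2_norm M (Q1 h) \<le> 2 * K * L2_norm M h" by (intro op_boundD[OF Q1n] h)
      also have "L2_norm M h = z * L2_norm M (Q2 f)"
        unfolding h_def L2_norm_scale using z by simp
      also have "\<dots> \<le> z * (C2 * L2_norm M f)"
        using z by (intro mult_left_mono op_boundD[OF C2(2)] f) auto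
      finally show "L2_norm M (Q1 h) \<le> 2 * K * z * C2 * L2_norm M f"
        using K(1) by simp
    qed
  qed
  then have "r - \<delta> \<in> G" using \<delta> by (simp add: G_def)
  then have "r \<le> r - \<delta>" unfolding r_def by (intro cInf_lower bddG)
  with \<delta> show False by simp
qed

subsection \<open>Domination\<close>

text \<open>The modulus around the right side makes the relation transitive without any positivity;
  for positive \<open>B\<close> the value inside is already nonnegative almost everywhere.\<close>

definition dominated :: "'a measure \<Rightarrow> 'a op \<Rightarrow> 'a op \<Rightarrow> bool" where
  "dominated M A B \<longleftrightarrow>
     (\<forall>f\<in>L2 M. AE x in M. cmod (A f x) \<le> cmod (B (\<lambda>y. complex_of_real (cmod (f y))) x))"

lemma dominatedD:
  "dominated M A B \<Longrightarrow> f \<in> L2 M \<Longrightarrow>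
    AE x in M. cmod (A f x) \<le> cmod (B (\<lambda>y. complex_of_real (cmod (f y))) x)"
  by (simp add: dominated_def)

lemma nonneg_Reals_cmod: "z \<in> \<real>\<^sub>\<ge>\<^sub>0 \<Longrightarrow> complex_of_real (cmod z) = z"
  by (auto simp: complex_nonneg_Reals_iff complex_eq_iff cmod_def)

lemma positive_op_mono:
  assumes A: "positive_op M A" and u: "u \<in> L2 M" and v: "v \<in> L2 M"
    and u0: "AE x in M. u x \<in> \<real>\<^sub>\<ge>\<^sub>0" and uv: "AE x in M. v x - u x \<in> \<real>\<^sub>\<ge>\<^sub>0"
  shows "AE x in M. cmod (A u x) \<le> cmod (A v x)"
  using positive_opD[OF A u u0] positive_opD[OF A L2_diff[OF v u] uv]
    linear_op_diff[OF positive_op_linear[OF A] v u]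
  by eventually_elim (auto intro: nonneg_Reals_cmod_mono)

text \<open>The estimate for \<open>B\<close> is fed into \<open>A'\<close> by monotonicity, which
  is where positivity of \<open>A'\<close> is used; positivity of \<open>B'\<close> identifies the
  modulus of its value with the value itself.\<close>

lemma dominated_comp:
  assumes A: "dominated M A A'" and B: "dominated M B B'"
    and Bl: "linear_op M B" and A': "positive_op M A'" and B': "positive_op M B'"
  shows "dominated M (A \<circ> B) (A' \<circ> B')"
  unfolding dominated_def
proof
  fix f assume f: "f \<in> L2 M"
  let ?f = "\<lambda>y. complex_of_real (cmod (f y))"
  note Bf = linear_op_L2[OF Bl f]
  have B'f: "B' ?f \<in> L2 M" by (intro linear_op_L2[OF positive_op_linear[OF B']] L2_cmod f)
  have "AE x in M. B' ?f x \<in> \<real>\<^sub>\<ge>\<^sub>0" by (intro positive_opD[OF B'] L2_cmod f) simp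
  with dominatedD[OF B f]
  have "AE x in M. B' ?f x - complex_of_real (cmod (B f x)) \<in> \<real>\<^sub>\<ge>\<^sub>0"
  proof eventually_elim
    case (elim x)
    then show ?case
      using nonneg_Reals_cmod[OF elim(2)] nonneg_Reals_of_real_iff[where 'a = complex, of "cmod (B' ?f x) - cmod (B f x)"]
      by simp
  qed
  then have "AE x in M. cmod (A' (\<lambda>y. complex_of_real (cmod (B f y))) x) \<le> cmod (A' (B' ?f) x)"
    by (intro positive_op_mono[OF A'] L2_cmod Bf B'f) auto
  with dominatedD[OF A Bf] show "AE x in M. cmod ((A \<circ> B) f x) \<le> cmod ((A' \<circ> B') ?f x)"
    by eventually_elim simp
qed

lemma dominated_trans:
  assumes "dominated M A B" "dominated M B D" shows "dominated M A D"
  unfolding dominated_def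
proof
  fix f assume f: "f \<in> L2 M"
  show "AE x in M. cmod (A f x) \<le> cmod (D (\<lambda>y. complex_of_real (cmod (f y))) x)"
    using dominatedD[OF assms(1) f] dominatedD[OF assms(2) L2_cmod[OF f]]
    by eventually_elim simp
qed

lemma dominated_id: "dominated M id id"
  by (simp add: dominated_def)

lemma dominated_funpow:
  assumes "dominated M A B" "linear_op M A" "positive_op M B"
  shows "dominated M (A ^^ n) (B ^^ n)"
  by (induction n, simp_all only: funpow.simps)
     (intro dominated_id dominated_comp assms linear_op_funpow positive_op_funpow)+

lemma dominated_op_bound:
  assumes d: "dominated M A B" and A: "linear_op M A" and B: "linear_op M B" and b: "op_bound M B C"
  shows "op_bound M A C"
proof (rule op_boundI)
  fix f assume f: "f \<in> L2 M"
  have "L2_norm M (A f) \<le> L2_norm M (B (\<lambda>y. complex_of_real (cmod (f y))))"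
    by (intro L2_dominated(2) linear_op_L2[OF B] L2_cmod f L2_measurable linear_op_L2[OF A] dominatedD[OF d])
  also have "\<dots> \<le> C * L2_norm M (\<lambda>y. complex_of_real (cmod (f y)))"
    by (intro op_boundD[OF b] L2_cmod f)
  finally show "L2_norm M (A f) \<le> C * L2_norm M f" by simp
qed

lemma dominated_growth:
  assumes "dominated M A B" "linear_op M A" "positive_op M B" "growth M B t"
  shows "growth M A t"
  using assms(4) unfolding growth_def
  by (meson dominated_op_bound dominated_funpow assms linear_op_funpow positive_op_linear)

subsection \<open>Hoelder's inequality\<close>

lemma prod_powr_inverse_card:
  fixes c :: real
  assumes "finite I" "I \<noteq> {}" "0 \<le> c" shows "(\<Prod>j\<in>I. c powr (1 / card I)) = c"
proof -
  have "(\<Prod>j\<in>I. c powr (1 / card I)) = (c powr (1 / card I)) powr (card I)"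
    using assms by (cases "c = 0") (auto simp: powr_realpow card_gt_0_iff)
  also have "\<dots> = c" using assms by (simp add: powr_powr)
  finally show ?thesis .
qed

lemma prod_powr_le_mean:
  fixes x :: "'i \<Rightarrow> real"
  assumes "finite I" "I \<noteq> {}" "\<And>i. i \<in> I \<Longrightarrow> 0 \<le> x i"
  shows "(\<Prod>i\<in>I. x i powr (1 / card I)) \<le> (\<Sum>i\<in>I. x i / card I)"
  using arith_geom_mean[OF assms] by (simp add: prod_powr_distrib)

text \<open>After division of each factor by its integral this is the arithmetic-geometric mean
  inequality under the integral sign. The same inequality gives integrability, as the product lies
  below the mean of the factors.\<close>

lemma Hoelder_prod:
  fixes f :: "'i \<Rightarrow> 'a \<Rightarrow> real"
  assumes I: "finite I" "I \<noteq> {}"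
    and f: "\<And>j. j \<in> I \<Longrightarrow> integrable M (f j)" and nn: "\<And>j x. j \<in> I \<Longrightarrow> 0 \<le> f j x"
  shows "integrable M (\<lambda>x. \<Prod>j\<in>I. f j x powr (1 / card I))"
    and "(LINT x|M. (\<Prod>j\<in>I. f j x powr (1 / card I))) \<le> (\<Prod>j\<in>I. (LINT x|M. f j x) powr (1 / card I))"
proof -
  have [measurable]: "f j \<in> borel_measurable M" if "j \<in> I" for j
    using f[OF that] by auto
  let ?m = "real (card I)"
  have m0: "?m > 0" using I by (simp add: card_gt_0_iff)
  have nn': "0 \<le> (\<Prod>j\<in>I. f j x powr (1 / ?m))" for x by (simp add: prod_nonneg)
  show i: "integrable M (\<lambda>x. \<Prod>j\<in>I. f j x powr (1 / card I))"
  proof (rule Bochner_Integration.integrable_bound)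
    show "integrable M (\<lambda>x. \<Sum>j\<in>I. f j x / ?m)" using f by auto
    show "AE x in M. norm (\<Prod>j\<in>I. f j x powr (1 / ?m)) \<le> norm (\<Sum>j\<in>I. f j x / ?m)"
    proof (intro AE_I2)
      fix x
      have "0 \<le> (\<Sum>j\<in>I. f j x / ?m)" by (intro sum_nonneg divide_nonneg_nonneg nn) auto
      then show "norm (\<Prod>j\<in>I. f j x powr (1 / ?m)) \<le> norm (\<Sum>j\<in>I. f j x / ?m)"
        using prod_powr_le_mean[OF I, of "\<lambda>j. f j x"] nn nn'[of x] by simp
    qed
  qed measurable
  define t where "t = (\<lambda>j. LINT x|M. f j x)"
  have t0: "0 \<le> t j" if "j \<in> I" for j unfolding t_def using nn[OF that] by simp
  show "(LINT x|M. (\<Prod>j\<in>I. f j x powr (1 / ?m))) \<le> (\<Prod>j\<in>I. (LINT x|M. f j x) powr (1 / ?m))"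
  proof (cases "\<exists>j\<in>I. t j = 0")
    case True
    then obtain j where j: "j \<in> I" "t j = 0" by blast
    \<comment> \<open>A vanishing integral cannot be normalised; but then this factor, and with it
      the product, is zero almost everywhere.\<close>
    have "AE x in M. f j x = 0"
      using integral_nonneg_eq_0_iff_AE[OF f[OF j(1)]] j nn by (auto simp: t_def)
    then have "AE x in M. (\<Prod>j\<in>I. f j x powr (1 / ?m)) = 0"
      by eventually_elim (use I j in \<open>auto intro!: bexI[of _ j]\<close>)
    then have "(LINT x|M. (\<Prod>j\<in>I. f j x powr (1 / ?m))) = 0"
      by (rule integral_eq_zero_AE)
    then show ?thesis by (simp add: prod_nonneg)
  next
    case False
    then have tpos: "0 < t j" if "j \<in> I" for j using t0[OF that] that by force
    define P where "P = (\<Prod>j\<in>I. t j powr (1 / ?m))"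
    have "(LINT x|M. (\<Prod>j\<in>I. f j x powr (1 / ?m))) \<le> (LINT x|M. P * (\<Sum>j\<in>I. f j x / t j / ?m))"
    proof (intro integral_mono i)
      show "integrable M (\<lambda>x. P * (\<Sum>j\<in>I. f j x / t j / ?m))" using f by auto
      fix x
      have "(\<Prod>j\<in>I. f j x powr (1 / ?m)) = (\<Prod>j\<in>I. t j powr (1 / ?m) * (f j x / t j) powr (1 / ?m))"
        by (intro prod.cong refl, subst powr_mult[symmetric]) (use tpos nn in \<open>force+\<close>)
      also have "\<dots> = P * (\<Prod>j\<in>I. (f j x / t j) powr (1 / ?m))"
        by (simp add: prod.distrib P_def)
      also have "\<dots> \<le> P * (\<Sum>j\<in>I. f j x / t j / ?m)"
        by (intro mult_left_mono prod_powr_le_mean I divide_nonneg_nonneg nn t0)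
           (auto simp: P_def prod_nonneg)
      finally show "(\<Prod>j\<in>I. f j x powr (1 / ?m)) \<le> P * (\<Sum>j\<in>I. f j x / t j / ?m)" .
    qed
    also have "\<dots> = P * (\<Sum>j\<in>I. t j / t j / ?m)"
      using f by (simp add: t_def del: div_self divide_self_if)
    also have "(\<Sum>j\<in>I. t j / t j / ?m) = (\<Sum>j\<in>I. 1 / ?m)"
      by (intro sum.cong refl) (use tpos in force)
    also have "\<dots> = 1" using m0 by simp
    finally show ?thesis by (simp add: P_def t_def)
  qed
qed

text \<open>Hoelder for the squared moduli: squaring commutes with the powers
  \<open>1 / card I\<close>.\<close>

lemma L2_prod:
  fixes g :: "'i \<Rightarrow> 'a \<Rightarrow> complex"
  assumes I: "finite I" "I \<noteq> {}" and g: "\<And>j. j \<in> I \<Longrightarrow> g j \<in> L2 M"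
  defines "G \<equiv> \<lambda>x. complex_of_real (\<Prod>j\<in>I. cmod (g j x) powr (1 / card I))"
  shows "G \<in> L2 M" "L2_norm M G \<le> (\<Prod>j\<in>I. L2_norm M (g j) powr (1 / card I))"
proof -
  have [measurable]: "g j \<in> borel_measurable M" if "j \<in> I" for j using g[OF that] by (rule L2_measurable)
  have [measurable]: "G \<in> borel_measurable M" unfolding G_def by measurable
  have sq: "(c powr (1 / card I))\<^sup>2 = (c\<^sup>2) powr (1 / card I)" for c :: real
    by (simp add: power2_eq_square powr_mult)
  have G2: "(cmod (G x))\<^sup>2 = (\<Prod>j\<in>I. ((cmod (g j x))\<^sup>2) powr (1 / card I))" for x
    unfolding G_def norm_of_real power2_abs by (simp add: prod_power_distrib sq)
  have i: "integrable M (\<lambda>x. (cmod (g j x))\<^sup>2)" if "j \<in> I" for j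
    using g[OF that] by (rule L2_integrable_square)
  have "integrable M (\<lambda>x. (cmod (G x))\<^sup>2)"
    unfolding G2 using Hoelder_prod(1)[OF I i] by simp
  then show "G \<in> L2 M" by (simp add: L2_def)
  have "(L2_norm M G)\<^sup>2 \<le> (\<Prod>j\<in>I. (LINT x|M. (cmod (g j x))\<^sup>2) powr (1 / card I))"
    unfolding L2_norm_square G2 using Hoelder_prod(2)[OF I i] by simp
  also have "\<dots> = (\<Prod>j\<in>I. L2_norm M (g j) powr (1 / card I))\<^sup>2"
    by (simp add: prod_power_distrib sq L2_norm_square)
  finally show "L2_norm M G \<le> (\<Prod>j\<in>I. L2_norm M (g j) powr (1 / card I))"
    by (rule power2_le_imp_le) (simp add: prod_nonneg)
qed

subsection \<open>Operators with nonnegative kernels\<close>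

text \<open>The kernel is carried as an explicit real representative, nonnegative everywhere,
  because means, compositions and transposes are formed on representatives.\<close>

definition pos_kernel :: "'a measure \<Rightarrow> 'a op \<Rightarrow> ('a \<Rightarrow> 'a \<Rightarrow> real) \<Rightarrow> bool" where
  "pos_kernel M A a \<longleftrightarrow> linear_op M A \<and> (\<forall>x y. 0 \<le> a x y) \<and>
     has_kernel M A (\<lambda>x y. complex_of_real (a x y))"

definition integral_op :: "'a measure \<Rightarrow> ('a \<Rightarrow> 'a \<Rightarrow> real) \<Rightarrow> 'a op" where
  "integral_op M a = (\<lambda>f x. LINT y|M. complex_of_real (a x y) * f y)"

text \<open>The integral has the default value 0 where the product is not integrable; by
  \<open>AE_integrable_kernel_comp\<close> this concerns, for almost every x, only a null set of
  y.\<close>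

definition kernel_comp :: "'a measure \<Rightarrow> ('a \<Rightarrow> 'a \<Rightarrow> real) \<Rightarrow> ('a \<Rightarrow> 'a \<Rightarrow> real) \<Rightarrow> 'a \<Rightarrow> 'a \<Rightarrow> real" where
  "kernel_comp M a b = (\<lambda>x y. LINT z|M. a x z * b z y)"

definition kernel_mean :: "'i set \<Rightarrow> ('i \<Rightarrow> 'a \<Rightarrow> 'a \<Rightarrow> real) \<Rightarrow> 'a \<Rightarrow> 'a \<Rightarrow> real" where
  "kernel_mean I a = (\<lambda>x y. \<Prod>j\<in>I. a j x y powr (1 / card I))"

lemma pos_kernel_linear: "pos_kernel M A a \<Longrightarrow> linear_op M A"
  by (simp add: pos_kernel_def)

lemma pos_kernel_nonneg: "pos_kernel M A a \<Longrightarrow> 0 \<le> a x y"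
  by (simp add: pos_kernel_def)

lemma pos_kernel_measurable:
  assumes "pos_kernel M A a" shows "case_prod a \<in> borel_measurable (M \<Otimes>\<^sub>M M)"
proof -
  have "(\<lambda>(x, y). complex_of_real (a x y)) \<in> borel_measurable (M \<Otimes>\<^sub>M M)"
    using assms by (simp add: pos_kernel_def has_kernel_def)
  then have "(\<lambda>p. Re ((\<lambda>(x, y). complex_of_real (a x y)) p)) \<in> borel_measurable (M \<Otimes>\<^sub>M M)"
    by measurable
  also have "(\<lambda>p. Re ((\<lambda>(x, y). complex_of_real (a x y)) p)) = case_prod a" by auto
  finally show ?thesis .
qed

text \<open>The statements for f and for its modulus are bundled so that one generic point x serves
  all of them.\<close>

lemma pos_kernel_AE:
  assumes A: "pos_kernel M A a" and f: "f \<in> L2 M"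
  shows "AE x in M. integrable M (\<lambda>y. complex_of_real (a x y) * f y) \<and>
     integrable M (\<lambda>y. a x y * cmod (f y)) \<and>
     A f x = (LINT y|M. complex_of_real (a x y) * f y) \<and>
     A (\<lambda>y. complex_of_real (cmod (f y))) x = complex_of_real (LINT y|M. a x y * cmod (f y))"
proof -
  have k: "has_kernel M A (\<lambda>x y. complex_of_real (a x y))" using A by (simp add: pos_kernel_def)
  have "AE x in M. A (\<lambda>y. complex_of_real (cmod (f y))) x
      = (LINT y|M. complex_of_real (a x y) * complex_of_real (cmod (f y)))"
    using k L2_cmod[OF f] by (auto simp: has_kernel_def)
  moreover have "AE x in M. integrable M (\<lambda>y. complex_of_real (a x y) * f y) \<and>
      A f x = (LINT y|M. complex_of_real (a x y) * f y)"
    using k f by (auto simp: has_kernel_def)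
  ultimately show ?thesis
  proof eventually_elim
    case (elim x)
    have "integrable M (\<lambda>y. cmod (complex_of_real (a x y) * f y))"
      using elim by (intro integrable_norm) auto
    then have "integrable M (\<lambda>y. a x y * cmod (f y))"
      using pos_kernel_nonneg[OF A] by (simp add: norm_mult)
    then show ?case using elim by (simp flip: of_real_mult)
  qed
qed

lemma pos_kernel_positive:
  assumes A: "pos_kernel M A a" shows "positive_op M A"
  unfolding positive_op_def
proof (intro conjI ballI impI)
  fix f assume f: "f \<in> L2 M" and f0: "AE x in M. f x \<in> \<real>\<^sub>\<ge>\<^sub>0"
  have "AE x in M. f x = complex_of_real (cmod (f x))"
    using f0 by eventually_elim (simp add: nonneg_Reals_cmod)
  then have "AE x in M. A f x = A (\<lambda>y. complex_of_real (cmod (f y))) x"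
    by (intro linear_op_cong[OF pos_kernel_linear[OF A]] f L2_cmod)
  with pos_kernel_AE[OF A f] show "AE x in M. A f x \<in> \<real>\<^sub>\<ge>\<^sub>0"
  proof eventually_elim
    case (elim x)
    then have "A f x = complex_of_real (LINT y|M. a x y * cmod (f y))" by metis
    then show ?case by (simp add: pos_kernel_nonneg[OF A])
  qed
qed (rule pos_kernel_linear[OF A])

text \<open>The kernel inequality is asked for in iterated form because the proof fixes x and
  integrates in y alone.\<close>

lemma pos_kernel_le_dominated:
  assumes D: "pos_kernel M D d" and E: "pos_kernel M E e" and le: "AE x in M. AE y in M. d x y \<le> e x y"
  shows "dominated M D E"
  unfolding dominated_def
proof
  fix f assume f: "f \<in> L2 M"
  show "AE x in M. cmod (D f x) \<le> cmod (E (\<lambda>y. complex_of_real (cmod (f y))) x)"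
    using pos_kernel_AE[OF D f] pos_kernel_AE[OF E f] le
  proof eventually_elim
    case (elim x)
    have "cmod (D f x) \<le> (LINT y|M. cmod (complex_of_real (d x y) * f y))"
      using elim(1) by (metis integral_norm_bound)
    also have "\<dots> = (LINT y|M. d x y * cmod (f y))"
      using pos_kernel_nonneg[OF D] by (simp add: norm_mult)
    also have "\<dots> \<le> (LINT y|M. e x y * cmod (f y))"
    proof (rule integral_mono_AE)
      show "AE y in M. d x y * cmod (f y) \<le> e x y * cmod (f y)"
        using elim(3) by eventually_elim (simp add: mult_right_mono)
    qed (use elim in auto)
    also have "\<dots> \<le> cmod (E (\<lambda>y. complex_of_real (cmod (f y))) x)"
      using elim(2) by (metis abs_ge_self norm_of_real)
    finally show ?case .
  qed
qed

lemma pos_kernel_dominated_self: "pos_kernel M A a \<Longrightarrow> dominated M A A"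
  by (rule pos_kernel_le_dominated) auto

lemma kernel_mean_nonneg: "0 \<le> kernel_mean I a x y"
  by (simp add: kernel_mean_def prod_nonneg)

lemma measurable_kernel_mean:
  assumes "\<And>j. j \<in> I \<Longrightarrow> case_prod (a j) \<in> borel_measurable (M \<Otimes>\<^sub>M M)"
  shows "case_prod (kernel_mean I a) \<in> borel_measurable (M \<Otimes>\<^sub>M M)"
proof -
  have eq: "case_prod (kernel_mean I a) = (\<lambda>p. \<Prod>j\<in>I. case_prod (a j) p powr (1 / card I))"
    by (auto simp: kernel_mean_def)
  show ?thesis unfolding eq
    by (intro borel_measurable_prod powr_real_measurable assms measurable_const) auto
qed

text \<open>The weight |f| is spread over the factors as a product of equal roots, so that Hoelder
  applies to the functions a_j(x, y) |f(y)|.\<close>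

lemma kernel_mean_integral:
  assumes I: "finite I" "I \<noteq> {}"
    and a: "\<And>j x y. j \<in> I \<Longrightarrow> 0 \<le> a j x y"
    and i: "\<And>j. j \<in> I \<Longrightarrow> integrable M (\<lambda>y. a j x y * cmod (f y))"
  shows "integrable M (\<lambda>y. kernel_mean I a x y * cmod (f y))"
    and "(LINT y|M. kernel_mean I a x y * cmod (f y))
      \<le> (\<Prod>j\<in>I. (LINT y|M. a j x y * cmod (f y)) powr (1 / card I))"
proof -
  have eq: "kernel_mean I a x y * cmod (f y) = (\<Prod>j\<in>I. (a j x y * cmod (f y)) powr (1 / card I))" for y
  proof -
    have "(\<Prod>j\<in>I. (a j x y * cmod (f y)) powr (1 / card I))
        = (\<Prod>j\<in>I. a j x y powr (1 / card I) * cmod (f y) powr (1 / card I))"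
      by (intro prod.cong refl powr_mult)
    then show ?thesis
      using prod_powr_inverse_card[OF I, of "cmod (f y)"] by (simp add: prod.distrib kernel_mean_def)
  qed
  show "integrable M (\<lambda>y. kernel_mean I a x y * cmod (f y))"
    "(LINT y|M. kernel_mean I a x y * cmod (f y))
      \<le> (\<Prod>j\<in>I. (LINT y|M. a j x y * cmod (f y)) powr (1 / card I))"
    unfolding eq using Hoelder_prod[OF I i] a by simp_all
qed

section \<open>Hadamard means as integral operators\<close>

context sigma_finite_measure
begin

lemma measurable_integral_op:
  assumes "case_prod a \<in> borel_measurable (M \<Otimes>\<^sub>M M)" "f \<in> borel_measurable M"
  shows "integral_op M a f \<in> borel_measurable M"
proof -
  note [measurable] = assms
  show ?thesis unfolding integral_op_def by measurable
qed

text \<open>A majorant in \<open>L2 M\<close> settles two things at once: the integral exists for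
  almost every x, and its value is square integrable in x.\<close>

lemma pos_kernelI:
  assumes a: "\<And>x y. 0 \<le> a x y" and m: "case_prod a \<in> borel_measurable (M \<Otimes>\<^sub>M M)"
    and bd: "\<And>f. f \<in> L2 M \<Longrightarrow> \<exists>g\<in>L2 M. AE x in M. integrable M (\<lambda>y. a x y * cmod (f y)) \<and>
       (LINT y|M. a x y * cmod (f y)) \<le> cmod (g x)"
  shows "pos_kernel M (integral_op M a) a"
proof -
  let ?A = "integral_op M a"
  note [measurable] = m
  have int: "AE x in M. integrable M (\<lambda>y. complex_of_real (a x y) * f y)" if f: "f \<in> L2 M" for f
  proof -
    have [measurable]: "f \<in> borel_measurable M" using f by (rule L2_measurable)
    from bd[OF f] obtain g where "AE x in M. integrable M (\<lambda>y. a x y * cmod (f y)) \<and>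
       (LINT y|M. a x y * cmod (f y)) \<le> cmod (g x)" by blast
    then show ?thesis using AE_space
    proof eventually_elim
      case (elim x)
      have i: "integrable M (\<lambda>y. a x y * cmod (f y))" using elim by blast
      show ?case
        by (rule Bochner_Integration.integrable_bound[OF i])
           (use elim(2) a in \<open>auto simp: norm_mult\<close>)
    qed
  qed
  have L: "?A f \<in> L2 M" if f: "f \<in> L2 M" for f
  proof -
    from bd[OF f] obtain g where g: "g \<in> L2 M" "AE x in M. integrable M (\<lambda>y. a x y * cmod (f y)) \<and>
       (LINT y|M. a x y * cmod (f y)) \<le> cmod (g x)" by blast
    show ?thesis
    proof (rule L2_dominated(1)[OF g(1)])
      show "?A f \<in> borel_measurable M" by (intro measurable_integral_op m L2_measurable f)
      show "AE x in M. cmod (?A f x) \<le> cmod (g x)"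
        using g(2)
      proof eventually_elim
        case (elim x)
        have "cmod (?A f x) \<le> (LINT y|M. cmod (complex_of_real (a x y) * f y))"
          unfolding integral_op_def by (rule integral_norm_bound)
        also have "\<dots> = (LINT y|M. a x y * cmod (f y))" using a by (simp add: norm_mult)
        finally show ?case using elim by simp
      qed
    qed
  qed
  have lin: "linear_op M ?A"
    unfolding linear_op_def
  proof (intro conjI ballI allI impI)
    fix f assume f: "f \<in> L2 M"
    show "?A f \<in> L2 M" by (rule L[OF f])
    fix c
    show "AE x in M. ?A (\<lambda>y. c * f y) x = c * ?A f x"
      by (simp add: integral_op_def mult.left_commute)
  next
    fix f g assume f: "f \<in> L2 M" and g: "g \<in> L2 M"
    show "AE x in M. ?A (\<lambda>y. f y + g y) x = ?A f x + ?A g x"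
      using int[OF f] int[OF g] by eventually_elim (simp add: integral_op_def distrib_left)
    assume fg: "AE x in M. f x = g x"
    have [measurable]: "f \<in> borel_measurable M" "g \<in> borel_measurable M" using f g by (auto intro: L2_measurable)
    show "AE x in M. ?A f x = ?A g x"
      using AE_space
    proof eventually_elim
      case (elim x)
      show ?case unfolding integral_op_def
        by (rule integral_cong_AE) (use elim fg in auto)
    qed
  qed
  have "(\<lambda>(x, y). complex_of_real (a x y)) \<in> borel_measurable (M \<Otimes>\<^sub>M M)" by measurable
  then show ?thesis
    using a lin int by (auto simp: pos_kernel_def has_kernel_def integral_op_def)
qed

text \<open>\<open>G\<close> is the pointwise geometric mean of the functions A_j |f|. By
  \<open>L2_prod\<close> it is square integrable, so it is a majorant of the kind that
  \<open>pos_kernelI\<close> asks for.\<close>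

lemma kernel_mean_AE:
  assumes I: "finite I" "I \<noteq> {}" and A: "\<And>j. j \<in> I \<Longrightarrow> pos_kernel M (A j) (a j)" and f: "f \<in> L2 M"
  defines "G \<equiv> \<lambda>x. complex_of_real (\<Prod>j\<in>I. cmod (A j (\<lambda>y. complex_of_real (cmod (f y))) x) powr (1 / card I))"
  shows "AE x in M. integrable M (\<lambda>y. kernel_mean I a x y * cmod (f y)) \<and>
       (LINT y|M. kernel_mean I a x y * cmod (f y)) \<le> cmod (G x)"
proof -
  let ?f = "\<lambda>y. complex_of_real (cmod (f y))"
  have "AE x in M. \<forall>j\<in>I. integrable M (\<lambda>y. a j x y * cmod (f y)) \<and>
     A j ?f x = complex_of_real (LINT y|M. a j x y * cmod (f y))"
    by (rule AE_finite_allI[OF I(1)]) (use pos_kernel_AE[OF A f] in \<open>force elim: eventually_mono\<close>)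
  then show "AE x in M. integrable M (\<lambda>y. kernel_mean I a x y * cmod (f y)) \<and>
       (LINT y|M. kernel_mean I a x y * cmod (f y)) \<le> cmod (G x)"
  proof eventually_elim
    case (elim x)
    have nn: "0 \<le> (LINT y|M. a j x y * cmod (f y))" if "j \<in> I" for j
      using pos_kernel_nonneg[OF A[OF that]] by simp
    have "cmod (G x) = (\<Prod>j\<in>I. cmod (A j ?f x) powr (1 / card I))"
      unfolding G_def norm_of_real by (simp add: prod_nonneg)
    also have "\<dots> = (\<Prod>j\<in>I. (LINT y|M. a j x y * cmod (f y)) powr (1 / card I))"
      using elim nn by (intro prod.cong refl) auto
    finally show ?case
      using kernel_mean_integral[OF I, of a M x f] pos_kernel_nonneg[OF A] elim by auto
  qed
qed

text \<open>\<open>opset_hadamard\<close> contains operators, not kernels. This shows that a mean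
  kernel always belongs to an operator, so dominating elements can be constructed.\<close>

lemma pos_kernel_kernel_mean:
  assumes I: "finite I" "I \<noteq> {}" and A: "\<And>j. j \<in> I \<Longrightarrow> pos_kernel M (A j) (a j)"
  shows "pos_kernel M (integral_op M (kernel_mean I a)) (kernel_mean I a)"
proof (rule pos_kernelI)
  show "case_prod (kernel_mean I a) \<in> borel_measurable (M \<Otimes>\<^sub>M M)"
    by (intro measurable_kernel_mean pos_kernel_measurable[OF A])
  fix f assume f: "f \<in> L2 M"
  let ?f = "\<lambda>y. complex_of_real (cmod (f y))"
  let ?G = "\<lambda>x. complex_of_real (\<Prod>j\<in>I. cmod (A j ?f x) powr (1 / card I))"
  have "AE x in M. integrable M (\<lambda>y. kernel_mean I a x y * cmod (f y)) \<and>
       (LINT y|M. kernel_mean I a x y * cmod (f y)) \<le> cmod (?G x)"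
    by (rule kernel_mean_AE[OF I A f])
  moreover have "?G \<in> L2 M"
    by (intro L2_prod(1)[OF I] linear_op_L2[OF pos_kernel_linear[OF A]] L2_cmod f)
  ultimately show "\<exists>g\<in>L2 M. AE x in M. integrable M (\<lambda>y. kernel_mean I a x y * cmod (f y)) \<and>
       (LINT y|M. kernel_mean I a x y * cmod (f y)) \<le> cmod (g x)" by (rule bexI)
qed (rule kernel_mean_nonneg)

text \<open>Hoelder is used twice: in y for the kernels, and in x for the squares of the functions
  A_j |f|.\<close>

lemma op_bound_kernel_mean:
  assumes I: "finite I" "I \<noteq> {}" and A: "\<And>j. j \<in> I \<Longrightarrow> pos_kernel M (A j) (a j)"
    and D: "pos_kernel M D (kernel_mean I a)"
    and C: "\<And>j. j \<in> I \<Longrightarrow> op_bound M (A j) (C j)" and C0: "\<And>j. j \<in> I \<Longrightarrow> 0 \<le> C j"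
  shows "op_bound M D (\<Prod>j\<in>I. C j powr (1 / card I))"
proof (rule op_boundI)
  fix f assume f: "f \<in> L2 M"
  let ?f = "\<lambda>y. complex_of_real (cmod (f y))"
  let ?G = "\<lambda>x. complex_of_real (\<Prod>j\<in>I. cmod (A j ?f x) powr (1 / card I))"
  have "AE x in M. (LINT y|M. kernel_mean I a x y * cmod (f y)) \<le> cmod (?G x)"
    using kernel_mean_AE[of I A a f] I A f by auto
  with pos_kernel_AE[OF D f] have "AE x in M. cmod (D f x) \<le> cmod (?G x)"
  proof eventually_elim
    case (elim x)
    have "cmod (D f x) \<le> (LINT y|M. cmod (complex_of_real (kernel_mean I a x y) * f y))"
      using elim(1) by (metis integral_norm_bound)
    also have "\<dots> = (LINT y|M. kernel_mean I a x y * cmod (f y))"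
      using kernel_mean_nonneg[of I a] by (simp add: norm_mult)
    finally show ?case using elim(2) by simp
  qed
  moreover have G: "?G \<in> L2 M" "L2_norm M ?G \<le> (\<Prod>j\<in>I. L2_norm M (A j ?f) powr (1 / card I))"
    by (intro L2_prod[OF I] linear_op_L2[OF pos_kernel_linear[OF A]] L2_cmod f; assumption)+
  ultimately have "L2_norm M (D f) \<le> L2_norm M ?G"
    by (intro L2_dominated(2) L2_measurable linear_op_L2[OF pos_kernel_linear[OF D]] f)
  also have "\<dots> \<le> (\<Prod>j\<in>I. L2_norm M (A j ?f) powr (1 / card I))" by (rule G)
  also have "\<dots> \<le> (\<Prod>j\<in>I. (C j * L2_norm M f) powr (1 / card I))"
  proof (intro prod_mono conjI powr_mono2)
    fix j assume "j \<in> I"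
    from op_boundD[OF C[OF this] L2_cmod[OF f]] show "L2_norm M (A j ?f) \<le> C j * L2_norm M f" by simp
  qed auto
  also have "\<dots> = (\<Prod>j\<in>I. C j powr (1 / card I) * L2_norm M f powr (1 / card I))"
    by (intro prod.cong refl powr_mult)
  also have "\<dots> = (\<Prod>j\<in>I. C j powr (1 / card I)) * L2_norm M f"
    unfolding prod.distrib by (subst prod_powr_inverse_card[OF I]) auto
  finally show "L2_norm M (D f) \<le> (\<Prod>j\<in>I. C j powr (1 / card I)) * L2_norm M f" .
qed

text \<open>Sigma-finiteness provides a strictly positive integrable function. Its square root
  serves as a test function: integrability against it, followed by division, gives integrability of
  the kernels alone.\<close>

lemma ex_pos_L2: "\<exists>w\<in>L2 M. \<forall>x\<in>space M. w x \<noteq> 0"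
proof -
  obtain h where h: "h \<in> borel_measurable M" "integral\<^sup>N M h \<noteq> \<infinity>" "\<forall>x\<in>space M. 0 < h x \<and> h x < \<infinity>"
    using Ex_finite_integrable_function by blast
  note [measurable] = h(1)
  define w where "w = (\<lambda>x. complex_of_real (sqrt (enn2real (h x))))"
  have "integrable M (\<lambda>x. enn2real (h x))"
  proof (rule integrableI_nonneg)
    have "(\<integral>\<^sup>+x. ennreal (enn2real (h x)) \<partial>M) = integral\<^sup>N M h"
      by (intro nn_integral_cong) (use h(3) in auto)
    then show "(\<integral>\<^sup>+x. ennreal (enn2real (h x)) \<partial>M) < \<infinity>" using h(2) by (simp add: less_top)
  qed auto
  then have "w \<in> L2 M" by (auto simp: L2_def w_def)
  moreover have "\<forall>x\<in>space M. w x \<noteq> 0"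
    using h(3) by (auto simp: w_def enn2real_eq_0_iff)
  ultimately show ?thesis by blast
qed

end

section \<open>Composition and transposition of kernels\<close>

context sigma_finite_measure
begin

lemma pair_sigma_finite_self: "pair_sigma_finite M M"
  by (simp add: pair_sigma_finite_def sigma_finite_measure_axioms)

text \<open>Fubini applies because the integral of the moduli over y is a(x, z) (B |f|)(z), whose
  integrability in z is part of the kernel representation of \<open>A\<close> at B |f|.\<close>

lemma pos_kernel_comp_AE:
  assumes A: "pos_kernel M A a" and B: "pos_kernel M B b" and f: "f \<in> L2 M"
  shows "AE x in M. integrable (M \<Otimes>\<^sub>M M) (\<lambda>(z, y). complex_of_real (a x z * b z y) * f y) \<and>
     A (B f) x = (LINT z|M. LINT y|M. complex_of_real (a x z * b z y) * f y)"
proof -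
  interpret P: pair_sigma_finite M M by (rule pair_sigma_finite_self)
  note [measurable] = pos_kernel_measurable[OF A] pos_kernel_measurable[OF B] L2_measurable[OF f]
  let ?f = "\<lambda>y. complex_of_real (cmod (f y))"
  note Bf = linear_op_L2[OF pos_kernel_linear[OF B] f]
  have Baf: "B ?f \<in> L2 M" by (intro linear_op_L2[OF pos_kernel_linear[OF B]] L2_cmod f)
  note [measurable] = L2_measurable[OF Bf] L2_measurable[OF Baf]
  note Bk = pos_kernel_AE[OF B f]
  show ?thesis
    using pos_kernel_AE[OF A Bf] pos_kernel_AE[OF A Baf] AE_space
  proof eventually_elim
    case (elim x)
    have [measurable]: "(\<lambda>z. a x z) \<in> borel_measurable M"
      using elim(3) by measurable
    have "AE z in M. (LINT y|M. cmod (complex_of_real (a x z * b z y) * f y)) = a x z * cmod (B ?f z)"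
      using Bk by eventually_elim
        (simp add: norm_mult mult.assoc pos_kernel_nonneg[OF A] pos_kernel_nonneg[OF B])
    then have "integrable M (\<lambda>z. LINT y|M. cmod (complex_of_real (a x z * b z y) * f y))
        \<longleftrightarrow> integrable M (\<lambda>z. a x z * cmod (B ?f z))"
      by (intro integrable_cong_AE) measurable
    moreover have "AE z in M. integrable M (\<lambda>y. complex_of_real (a x z * b z y) * f y)"
      using Bk by eventually_elim (simp add: mult.assoc)
    ultimately have i: "integrable (M \<Otimes>\<^sub>M M) (\<lambda>(z, y). complex_of_real (a x z * b z y) * f y)"
      using elim(2) by (intro P.Fubini_integrable) auto
    have "A (B f) x = (LINT z|M. complex_of_real (a x z) * B f z)" using elim(1) by simp
    also have "\<dots> = (LINT z|M. LINT y|M. complex_of_real (a x z * b z y) * f y)"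
    proof (rule integral_cong_AE)
      show "AE z in M. complex_of_real (a x z) * B f z = (LINT y|M. complex_of_real (a x z * b z y) * f y)"
        using Bk by eventually_elim (simp add: mult.assoc)
    qed measurable
    finally show ?case using i by simp
  qed
qed

text \<open>Integrate against w, which vanishes nowhere, and divide by w(y) on the sections.\<close>

lemma AE_integrable_kernel_comp:
  assumes A: "pos_kernel M A a" and B: "pos_kernel M B b"
  shows "AE x in M. AE y in M. integrable M (\<lambda>z. a x z * b z y)"
proof -
  interpret P: pair_sigma_finite M M by (rule pair_sigma_finite_self)
  obtain w where w: "w \<in> L2 M" "\<And>x. x \<in> space M \<Longrightarrow> w x \<noteq> 0" using ex_pos_L2 by blast
  show ?thesis
    using pos_kernel_comp_AE[OF A B w(1)]
  proof eventually_elim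
    case (elim x)
    then have "integrable (M \<Otimes>\<^sub>M M) (case_prod (\<lambda>z y. complex_of_real (a x z * b z y) * w y))"
      by (simp add: case_prod_beta')
    from P.AE_integrable_snd[OF this] AE_space show ?case
    proof eventually_elim
      case (elim y)
      have "integrable M (\<lambda>z. complex_of_real (a x z * b z y) * w y * inverse (w y))"
        by (intro integrable_mult_left elim)
      then have "integrable M (\<lambda>z. complex_of_real (a x z * b z y))"
        using w(2)[OF elim(2)] by (simp add: mult.assoc)
      then show ?case by (simp only: complex_of_real_integrable_eq)
    qed
  qed
qed

lemma pos_kernel_comp:
  assumes A: "pos_kernel M A a" and B: "pos_kernel M B b"
  shows "pos_kernel M (A \<circ> B) (kernel_comp M a b)"
  unfolding pos_kernel_def has_kernel_def
proof (intro conjI ballI allI)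
  interpret P: pair_sigma_finite M M by (rule pair_sigma_finite_self)
  note [measurable] = pos_kernel_measurable[OF A] pos_kernel_measurable[OF B]
  show "linear_op M (A \<circ> B)" by (intro linear_op_comp pos_kernel_linear[OF A] pos_kernel_linear[OF B])
  show "0 \<le> kernel_comp M a b x y" for x y
    unfolding kernel_comp_def by (simp add: pos_kernel_nonneg[OF A] pos_kernel_nonneg[OF B])
  show "(\<lambda>(x, y). complex_of_real (kernel_comp M a b x y)) \<in> borel_measurable (M \<Otimes>\<^sub>M M)"
    unfolding kernel_comp_def by measurable
  fix f assume f: "f \<in> L2 M"
  show "AE x in M. integrable M (\<lambda>y. complex_of_real (kernel_comp M a b x y) * f y) \<and>
      (A \<circ> B) f x = (LINT y|M. complex_of_real (kernel_comp M a b x y) * f y)"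
    using pos_kernel_comp_AE[OF A B f]
  proof eventually_elim
    case (elim x)
    let ?F = "\<lambda>z y. complex_of_real (a x z * b z y) * f y"
    have i: "integrable (M \<Otimes>\<^sub>M M) (case_prod ?F)" using elim by simp
    \<comment> \<open>Valid for every y: a constant factor leaves the integral unconditionally, also
      where the integrand is not integrable.\<close>
    have eq: "(LINT z|M. ?F z y) = complex_of_real (kernel_comp M a b x y) * f y" for y
      unfolding integral_mult_left_zero integral_complex_of_real kernel_comp_def ..
    show ?case
      using P.integrable_snd[OF i] P.Fubini_integral[OF i] elim unfolding eq by simp
  qed
qed

text \<open>Hoelder in the middle variable z, applied to a_j(x, z) b_j(z, y) at those x and y where
  all these products are integrable in z.\<close>

lemma dominated_kernel_mean_comp:
  assumes I: "finite I" "I \<noteq> {}"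
    and A: "\<And>j. j \<in> I \<Longrightarrow> pos_kernel M (A j) (a j)" and B: "\<And>j. j \<in> I \<Longrightarrow> pos_kernel M (B j) (b j)"
    and C: "pos_kernel M C (kernel_mean I a)" and D: "pos_kernel M D (kernel_mean I b)"
    and E: "pos_kernel M E (kernel_mean I (\<lambda>j. kernel_comp M (a j) (b j)))"
  shows "dominated M (C \<circ> D) E"
proof (rule pos_kernel_le_dominated[OF pos_kernel_comp[OF C D] E])
  have "AE x in M. \<forall>j\<in>I. AE y in M. integrable M (\<lambda>z. a j x z * b j z y)"
    by (rule AE_finite_allI[OF I(1)]) (rule AE_integrable_kernel_comp[OF A B])
  then show "AE x in M. AE y in M. kernel_comp M (kernel_mean I a) (kernel_mean I b) x y
      \<le> kernel_mean I (\<lambda>j. kernel_comp M (a j) (b j)) x y"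
  proof eventually_elim
    case (elim x)
    then have "AE y in M. \<forall>j\<in>I. integrable M (\<lambda>z. a j x z * b j z y)"
      by (intro AE_finite_allI[OF I(1)]) auto
    then show ?case
    proof eventually_elim
      case (elim y)
      have "kernel_mean I a x z * kernel_mean I b z y = (\<Prod>j\<in>I. (a j x z * b j z y) powr (1 / card I))" for z
        unfolding kernel_mean_def prod.distrib[symmetric] by (intro prod.cong refl powr_mult[symmetric])
      then show ?case
        using Hoelder_prod(2)[OF I, of M "\<lambda>j z. a j x z * b j z y"] elim
          pos_kernel_nonneg[OF A] pos_kernel_nonneg[OF B]
        by (simp add: kernel_mean_def kernel_comp_def)
    qed
  qed
qed

text \<open>The integral of the moduli over y is (A |f|)(x) |g(x)|, integrable by Cauchy-Schwarz.
  Exchanging the integrals is what makes the transposed kernel appear.\<close>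

lemma integrable_kernel_form:
  assumes A: "pos_kernel M A a" and f: "f \<in> L2 M" and g: "g \<in> L2 M"
  shows "integrable (M \<Otimes>\<^sub>M M) (\<lambda>(x, y). complex_of_real (a x y) * f y * cnj (g x))"
    and "L2_inner M (A f) g = (LINT y|M. LINT x|M. complex_of_real (a x y) * f y * cnj (g x))"
proof -
  interpret P: pair_sigma_finite M M by (rule pair_sigma_finite_self)
  let ?f = "\<lambda>y. complex_of_real (cmod (f y))"
  let ?F = "\<lambda>x y. complex_of_real (a x y) * f y * cnj (g x)"
  have Af: "A ?f \<in> L2 M" "A f \<in> L2 M"
    by (intro linear_op_L2[OF pos_kernel_linear[OF A]] L2_cmod f)+
  have cnj_meas: "cnj \<in> borel_measurable borel"
    by (intro borel_measurable_continuous_onI continuous_intros)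
  note [measurable] = pos_kernel_measurable[OF A] L2_measurable[OF f] L2_measurable[OF g]
    L2_measurable[OF Af(1)] L2_measurable[OF Af(2)] cnj_meas
  note Ak = pos_kernel_AE[OF A f]
  have "AE x in M. (LINT y|M. cmod (?F x y)) = cmod (A ?f x) * cmod (g x)"
    using Ak by eventually_elim (simp add: norm_mult pos_kernel_nonneg[OF A])
  then have "integrable M (\<lambda>x. LINT y|M. cmod (?F x y)) \<longleftrightarrow> integrable M (\<lambda>x. cmod (A ?f x) * cmod (g x))"
    by (intro integrable_cong_AE) measurable
  moreover have "AE x in M. integrable M (\<lambda>y. ?F x y)"
    using Ak by eventually_elim auto
  ultimately show i: "integrable (M \<Otimes>\<^sub>M M) (\<lambda>(x, y). ?F x y)"
    using L2_Cauchy_Schwarz(1)[OF Af(1) g] by (intro P.Fubini_integrable) auto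
  have "L2_inner M (A f) g = (LINT x|M. LINT y|M. ?F x y)"
    unfolding L2_inner_def
  proof (rule integral_cong_AE)
    show "AE x in M. A f x * cnj (g x) = (LINT y|M. ?F x y)"
      using Ak by eventually_elim simp
  qed measurable
  also have "\<dots> = (LINT y|M. LINT x|M. ?F x y)"
    using P.Fubini_integral[OF i] by simp
  finally show "L2_inner M (A f) g = (LINT y|M. LINT x|M. ?F x y)" .
qed

text \<open>
  The kernel integral \<open>h\<close> of the transposed kernel against \<open>|g|\<close> is tested against its truncations
  \<open>min h (n w)\<close> with a fixed \<open>w > 0\<close> in \<open>L\<^sup>2\<close>; their norms are bounded by \<open>C \<parallel>g\<parallel>\<close>, so \<open>h \<in> L\<^sup>2\<close>.
\<close>

lemma pos_kernel_transpose:
  assumes A: "pos_kernel M A a" and b: "op_bound M A C"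
  shows "pos_kernel M (integral_op M (\<lambda>x y. a y x)) (\<lambda>x y. a y x)"
proof (rule pos_kernelI)
  interpret P: pair_sigma_finite M M by (rule pair_sigma_finite_self)
  note [measurable] = pos_kernel_measurable[OF A]
  show "0 \<le> a y x" for x y by (rule pos_kernel_nonneg[OF A])
  show "(\<lambda>(x, y). a y x) \<in> borel_measurable (M \<Otimes>\<^sub>M M)" by measurable
  fix g assume g: "g \<in> L2 M"
  note [measurable] = L2_measurable[OF g]
  let ?g = "\<lambda>y. complex_of_real (cmod (g y))"
  define h where "h = (\<lambda>y. LINT x|M. a x y * cmod (g x))"
  have h0: "0 \<le> h y" for y unfolding h_def by (simp add: pos_kernel_nonneg[OF A])
  have [measurable]: "h \<in> borel_measurable M" unfolding h_def by measurable
  have inner: "(LINT x|M. complex_of_real (a x y) * v y * cnj (?g x)) = complex_of_real (h y) * v y" for v y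
  proof -
    have "(LINT x|M. complex_of_real (a x y) * v y * cnj (?g x))
        = (LINT x|M. complex_of_real (a x y * cmod (g x)) * v y)"
      by (intro Bochner_Integration.integral_cong) auto
    then show ?thesis unfolding integral_mult_left_zero integral_complex_of_real h_def .
  qed
  have form: "integrable M (\<lambda>y. complex_of_real (h y) * v y)"
    "L2_inner M (A v) ?g = (LINT y|M. complex_of_real (h y) * v y)" if v: "v \<in> L2 M" for v
    using P.integrable_snd[OF integrable_kernel_form(1)[OF A v L2_cmod[OF g]]]
      integrable_kernel_form(2)[OF A v L2_cmod[OF g]]
    unfolding inner by auto
  obtain w where w: "w \<in> L2 M" "\<And>x. x \<in> space M \<Longrightarrow> w x \<noteq> 0" using ex_pos_L2 by blast
  note [measurable] = L2_measurable[OF w(1)]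
  have i: "AE y in M. integrable M (\<lambda>x. a x y * cmod (g x))"
    using P.AE_integrable_snd[OF integrable_kernel_form(1)[OF A w(1) L2_cmod[OF g]]] AE_space
  proof eventually_elim
    case (elim y)
    have "integrable M (\<lambda>x. complex_of_real (a x y) * w y * cnj (?g x) * inverse (w y))"
      by (intro integrable_mult_left elim)
    also have "(\<lambda>x. complex_of_real (a x y) * w y * cnj (?g x) * inverse (w y))
        = (\<lambda>x. complex_of_real (a x y * cmod (g x)))"
      using w(2)[OF elim(2)] by (auto simp: field_simps)
    finally show ?case by (simp only: complex_of_real_integrable_eq)
  qed
  \<comment> \<open>\<open>C\<close> can be negative when every norm vanishes;
    \<open>max C 0\<close> keeps \<open>B\<close> nonnegative.\<close>
  define B where "B = max C 0 * L2_norm M g"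
  define t where "t = (\<lambda>n y. min (h y) (real n * cmod (w y)))"
  have t0: "0 \<le> t n y" for n y using h0[of y] by (simp add: t_def)
  have [measurable]: "t n \<in> borel_measurable M" for n unfolding t_def by measurable
  have tL: "(\<lambda>y. complex_of_real (t n y)) \<in> L2 M" for n
    by (rule L2_dominated(1)[OF L2_scale[OF w(1), of "complex_of_real (real n)"]])
       (use h0 in \<open>auto simp: t_def norm_mult\<close>)
  have tB: "(LINT y|M. (t n y)\<^sup>2) \<le> B\<^sup>2" for n
  proof -
    let ?t = "\<lambda>y. complex_of_real (t n y)"
    have "(L2_norm M ?t)\<^sup>2 = (LINT y|M. (t n y)\<^sup>2)" by (simp add: L2_norm_square)
    \<comment> \<open>Since the truncation lies below h, its squared norm is at most the inner
      product of its image under \<open>A\<close> with |g|. Cauchy-Schwarz and the bound for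
      \<open>A\<close> bring back one factor of the norm, which cancels.\<close>
    also have "\<dots> \<le> (LINT y|M. h y * t n y)"
    proof (rule integral_mono)
      show "integrable M (\<lambda>y. (t n y)\<^sup>2)" using L2_integrable_square[OF tL[of n]] by simp
      show "integrable M (\<lambda>y. h y * t n y)"
        using form(1)[OF tL[of n]] by (simp flip: of_real_mult add: complex_of_real_integrable_eq)
      show "(t n y)\<^sup>2 \<le> h y * t n y" for y
        unfolding power2_eq_square by (intro mult_right_mono t0) (simp add: t_def)
    qed
    also have "\<dots> \<le> cmod (complex_of_real (LINT y|M. h y * t n y))"
      by simp
    also have "complex_of_real (LINT y|M. h y * t n y) = L2_inner M (A ?t) ?g"
      using form(2)[OF tL[of n]] by (simp flip: of_real_mult)
    also have "cmod \<dots> \<le> L2_norm M (A ?t) * L2_norm M ?g"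
      by (intro L2_inner_le linear_op_L2[OF pos_kernel_linear[OF A]] tL L2_cmod g)
    also have "\<dots> \<le> (max C 0 * L2_norm M ?t) * L2_norm M ?g"
      by (intro mult_right_mono op_boundD[OF op_bound_mono[OF b]] tL) auto
    finally have "L2_norm M ?t * L2_norm M ?t \<le> B * L2_norm M ?t"
      by (simp add: B_def power2_eq_square mult.commute mult.left_commute)
    then have "L2_norm M ?t \<le> B"
      using L2_norm_nonneg[of M ?t] by (cases "L2_norm M ?t = 0") (auto simp: B_def)
    then have "(L2_norm M ?t)\<^sup>2 \<le> B\<^sup>2" by (intro power_mono) auto
    then show ?thesis by (simp add: L2_norm_square)
  qed
  have inc: "t n y \<le> t k y" if "n \<le> k" for n k y
    using that unfolding t_def by (intro min.mono mult_right_mono) auto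
  have "incseq (\<lambda>n. LINT y|M. (t n y)\<^sup>2)"
    unfolding incseq_def
    by (intro allI impI integral_mono power_mono inc t0)
       (use L2_integrable_square[OF tL] in auto)
  then obtain L where L: "(\<lambda>n. LINT y|M. (t n y)\<^sup>2) \<longlonglongrightarrow> L"
    using incseq_convergent tB by blast
  \<comment> \<open>As w(y) is nonzero, the truncation at height n |w(y)| is inactive for large
    n.\<close>
  have lim: "AE y in M. (\<lambda>n. (t n y)\<^sup>2) \<longlonglongrightarrow> (h y)\<^sup>2"
    using AE_space
  proof eventually_elim
    case (elim y)
    obtain N :: nat where N: "h y \<le> real N * cmod (w y)"
      using ex_less_of_nat_mult[of "cmod (w y)" "h y"] w(2)[OF elim] by (auto intro: less_imp_le)
    have "\<forall>\<^sub>F n in sequentially. h y = t n y"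
      using eventually_ge_at_top[of N]
    proof eventually_elim
      case (elim n)
      have "real N * cmod (w y) \<le> real n * cmod (w y)" using elim by (intro mult_right_mono) auto
      then show ?case using N by (simp add: t_def)
    qed
    then have "(\<lambda>n. t n y) \<longlonglongrightarrow> h y"
      by (intro tendsto_eventually) (auto elim: eventually_mono)
    then show ?case by (intro tendsto_power)
  qed
  have ti: "integrable M (\<lambda>y. (t n y)\<^sup>2)" for n
    using L2_integrable_square[OF tL[of n]] by simp
  have "AE y in M. mono (\<lambda>n. (t n y)\<^sup>2)"
    by (intro AE_I2 monoI power_mono inc t0)
  from integrable_monotone_convergence[OF ti this lim L]
  have "integrable M (\<lambda>y. (h y)\<^sup>2)" by simp
  then have "(\<lambda>y. complex_of_real (h y)) \<in> L2 M" by (simp add: L2_def)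
  moreover have "AE y in M. integrable M (\<lambda>x. a x y * cmod (g x)) \<and>
     (LINT x|M. a x y * cmod (g x)) \<le> cmod (complex_of_real (h y))"
    using i by eventually_elim (simp add: h_def)
  ultimately show "\<exists>h\<in>L2 M. AE x in M. integrable M (\<lambda>y. a y x * cmod (g y)) \<and>
       (LINT y|M. a y x * cmod (g y)) \<le> cmod (h x)" by (intro bexI)
qed

text \<open>The kernel is real, so conjugation touches only g, and the exchanged integral is the
  transposed operator.\<close>

lemma is_adjoint_transpose:
  assumes A: "pos_kernel M A a" and b: "op_bound M A C"
  shows "is_adjoint M A (integral_op M (\<lambda>x y. a y x))"
  unfolding is_adjoint_def
proof (intro conjI ballI)
  show "linear_op M (integral_op M (\<lambda>x y. a y x))"
    by (rule pos_kernel_linear[OF pos_kernel_transpose[OF A b]])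
  fix f g assume f: "f \<in> L2 M" and g: "g \<in> L2 M"
  have "(LINT x|M. complex_of_real (a x y) * f y * cnj (g x)) = f y * cnj (integral_op M (\<lambda>x y. a y x) g y)" for y
  proof -
    have "(LINT x|M. complex_of_real (a x y) * f y * cnj (g x))
        = (LINT x|M. f y * cnj (complex_of_real (a x y) * g x))"
      by (intro Bochner_Integration.integral_cong) auto
    also have "\<dots> = f y * cnj (LINT x|M. complex_of_real (a x y) * g x)"
      by (simp only: integral_mult_right_zero Bochner_Integration.integral_cnj)
    finally show ?thesis unfolding integral_op_def .
  qed
  then show "L2_inner M (A f) g = L2_inner M f (integral_op M (\<lambda>x y. a y x) g)"
    using integrable_kernel_form(2)[OF A f g] by (simp add: L2_inner_def)
qed

end

subsection \<open>Products of sets of operators\<close>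

definition domination_set :: "'a measure \<Rightarrow> 'a op set \<Rightarrow> 'a op set \<Rightarrow> bool" where
  "domination_set M \<Sigma> \<Theta> \<longleftrightarrow> (\<forall>A\<in>\<Sigma>. \<exists>B\<in>\<Theta>. dominated M A B)"

lemma bounded_op_set_iff:
  "bounded_op_set M \<Sigma> \<longleftrightarrow> (\<forall>A\<in>\<Sigma>. linear_op M A) \<and> (\<exists>C\<ge>0. \<forall>A\<in>\<Sigma>. op_bound M A C)"
proof -
  have "(\<exists>C. \<forall>A\<in>\<Sigma>. op_bound M A C) \<Longrightarrow> (\<exists>C\<ge>0. \<forall>A\<in>\<Sigma>. op_bound M A C)"
    by (meson max.cobounded1 max.cobounded2 op_bound_mono)
  then show ?thesis unfolding bounded_op_set_def op_bound_def by blast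
qed

lemma opset_mult_assoc: "opset_mult (opset_mult A B) C = opset_mult A (opset_mult B C)"
  unfolding opset_mult_def by (auto simp: comp_assoc) (metis comp_assoc)+

lemma opset_mult_id [simp]: "opset_mult A {id} = A" "opset_mult {id} A = A"
  by (auto simp: opset_mult_def)

lemma opset_multI: "A \<in> \<Phi> \<Longrightarrow> B \<in> \<Psi> \<Longrightarrow> A \<circ> B \<in> opset_mult \<Phi> \<Psi>"
  by (auto simp: opset_mult_def)

lemma opset_multE:
  assumes "C \<in> opset_mult \<Phi> \<Psi>" obtains A B where "A \<in> \<Phi>" "B \<in> \<Psi>" "C = A \<circ> B"
  using assms by (auto simp: opset_mult_def)

lemma opset_mult_mono: "A \<subseteq> A' \<Longrightarrow> B \<subseteq> B' \<Longrightarrow> opset_mult A B \<subseteq> opset_mult A' B'"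
  unfolding opset_mult_def by blast

lemma opset_prod_Nil [simp]: "opset_prod [] = {id}"
  by (simp add: opset_prod_def)

lemma opset_prod_Cons [simp]: "opset_prod (S # Ss) = opset_mult S (opset_prod Ss)"
  by (simp add: opset_prod_def)

lemma opset_prod_append: "opset_prod (Ss @ Ts) = opset_mult (opset_prod Ss) (opset_prod Ts)"
  by (induction Ss) (simp_all add: opset_mult_assoc)

lemma opset_prod_concat_pairs:
  "opset_prod (concat (map (\<lambda>l. [X l, Y l]) ls)) = opset_prod (map (\<lambda>l. opset_mult (X l) (Y l)) ls)"
  by (induction ls) (simp_all add: opset_mult_assoc)

lemma opset_power_0 [simp]: "opset_power \<Sigma> 0 = {id}"
  by (simp add: opset_power_def)

lemma opset_power_Suc: "opset_power \<Sigma> (Suc k) = opset_mult \<Sigma> (opset_power \<Sigma> k)"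
  by (simp add: opset_power_def)

lemma opset_power_1 [simp]: "opset_power \<Sigma> (Suc 0) = \<Sigma>"
  by (simp add: opset_power_Suc)

lemma opset_power_add: "opset_power \<Sigma> (i + k) = opset_mult (opset_power \<Sigma> i) (opset_power \<Sigma> k)"
  by (simp add: opset_power_def replicate_add opset_prod_append)

lemma opset_power_mult: "opset_power \<Sigma> (i * k) = opset_power (opset_power \<Sigma> i) k"
  by (induction k) (simp_all add: opset_power_add opset_power_Suc)

text \<open>Powers of V U are thus powers of U V up to two outer factors, which is why both have the
  same rates.\<close>

lemma opset_power_swap:
  "opset_power (opset_mult V U) (Suc k) = opset_mult V (opset_mult (opset_power (opset_mult U V) k) U)"
proof (induction k)
  case (Suc k)
  show ?case
    by (subst opset_power_Suc, subst Suc) (simp add: opset_power_Suc opset_mult_assoc)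
qed (simp add: opset_power_Suc)

lemma funpow_in_opset_power: "A \<in> \<Sigma> \<Longrightarrow> A ^^ k \<in> opset_power \<Sigma> k"
  by (induction k) (auto simp only: funpow.simps opset_power_0 opset_power_Suc intro: opset_multI)

lemma opset_power_singleton: "opset_power {A} k = {A ^^ k}"
  by (induction k) (auto simp: opset_power_Suc opset_mult_def)

lemma bounded_op_set_id: "bounded_op_set M {id}"
  using op_bound_id by (auto simp: bounded_op_set_iff intro!: exI[of _ 1])

lemma bounded_op_set_mult:
  assumes "bounded_op_set M \<Phi>" "bounded_op_set M \<Psi>" shows "bounded_op_set M (opset_mult \<Phi> \<Psi>)"
proof -
  obtain C D where C: "0 \<le> C" "\<And>A. A \<in> \<Phi> \<Longrightarrow> op_bound M A C"
    and D: "0 \<le> D" "\<And>A. A \<in> \<Psi> \<Longrightarrow> op_bound M A D"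
    using assms unfolding bounded_op_set_iff by blast
  have lin: "linear_op M A" if "A \<in> \<Phi> \<or> A \<in> \<Psi>" for A using assms that unfolding bounded_op_set_iff by blast
  show ?thesis
    unfolding bounded_op_set_iff
  proof (intro conjI exI ballI)
    fix A assume "A \<in> opset_mult \<Phi> \<Psi>"
    then obtain B E where "B \<in> \<Phi>" "E \<in> \<Psi>" "A = B \<circ> E" by (rule opset_multE)
    then show "linear_op M A" "op_bound M A (C * D)"
      using C D lin by (auto intro: linear_op_comp op_bound_comp)
  qed (use C D in auto)
qed

lemma bounded_op_set_prod:
  "(\<And>S. S \<in> set Ss \<Longrightarrow> bounded_op_set M S) \<Longrightarrow> bounded_op_set M (opset_prod Ss)"
  by (induction Ss) (auto intro: bounded_op_set_mult bounded_op_set_id)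

lemma bounded_op_set_power: "bounded_op_set M \<Sigma> \<Longrightarrow> bounded_op_set M (opset_power \<Sigma> k)"
  unfolding opset_power_def by (rule bounded_op_set_prod) simp

lemma bounded_op_set_bounded_op: "bounded_op_set M \<Sigma> \<Longrightarrow> A \<in> \<Sigma> \<Longrightarrow> bounded_op M A"
  by (auto simp: bounded_op_set_iff bounded_op_iff)

lemma positive_op_set_mult:
  assumes "\<And>A. A \<in> \<Phi> \<Longrightarrow> positive_op M A" "\<And>A. A \<in> \<Psi> \<Longrightarrow> positive_op M A" "A \<in> opset_mult \<Phi> \<Psi>"
  shows "positive_op M A"
  using assms by (auto elim!: opset_multE intro: positive_op_comp)

lemma positive_op_set_prod:
  "(\<And>S A. S \<in> set Ss \<Longrightarrow> A \<in> S \<Longrightarrow> positive_op M A) \<Longrightarrow> A \<in> opset_prod Ss \<Longrightarrow> positive_op M A"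
proof (induction Ss arbitrary: A)
  case (Cons S Ss)
  show ?case
    by (rule positive_op_set_mult[of S M "opset_prod Ss"]) (use Cons in auto)
qed (simp add: positive_op_id)

lemma positive_op_set_power:
  "(\<And>A. A \<in> \<Sigma> \<Longrightarrow> positive_op M A) \<Longrightarrow> A \<in> opset_power \<Sigma> k \<Longrightarrow> positive_op M A"
  unfolding opset_power_def by (rule positive_op_set_prod) auto

text \<open>The adjoint relation is tested at f = B g, and one factor of the norm of B g is
  cancelled.\<close>

lemma adjoint_op_bound:
  assumes adj: "is_adjoint M A B" and A: "linear_op M A" "op_bound M A C"
  shows "op_bound M B C"
proof (rule op_boundI)
  fix g assume g: "g \<in> L2 M"
  have B: "linear_op M B" using adj by (simp add: is_adjoint_def)
  note Bg = linear_op_L2[OF B g]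
  have "(L2_norm M (B g))\<^sup>2 = cmod (L2_inner M (B g) (B g))"
    unfolding L2_inner_self norm_of_real by simp
  also have "\<dots> = cmod (L2_inner M (A (B g)) g)" using adj Bg g by (simp add: is_adjoint_def)
  also have "\<dots> \<le> L2_norm M (A (B g)) * L2_norm M g"
    by (intro L2_inner_le linear_op_L2[OF A(1)] Bg g)
  also have "\<dots> \<le> C * L2_norm M (B g) * L2_norm M g"
    by (intro mult_right_mono op_boundD[OF A(2)] Bg) simp
  finally have le: "L2_norm M (B g) * L2_norm M (B g) \<le> L2_norm M (B g) * (C * L2_norm M g)"
    by (simp add: power2_eq_square mult_ac)
  show "L2_norm M (B g) \<le> C * L2_norm M g"
  proof (cases "L2_norm M (B g) = 0")
    case True
    have "0 \<le> C * L2_norm M g"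
      using L2_norm_nonneg[of M "A g"] op_boundD[OF A(2) g] by linarith
    with True show ?thesis by simp
  next
    case False
    then have "0 < L2_norm M (B g)" using L2_norm_nonneg[of M "B g"] by linarith
    with le show ?thesis by simp
  qed
qed

lemma bounded_op_set_adjoint:
  assumes "bounded_op_set M \<Phi>" shows "bounded_op_set M (opset_adjoint M \<Phi>)"
proof -
  obtain C where C: "0 \<le> C" "\<And>A. A \<in> \<Phi> \<Longrightarrow> linear_op M A \<and> op_bound M A C"
    using assms unfolding bounded_op_set_iff by blast
  have "linear_op M B \<and> op_bound M B C" if "B \<in> opset_adjoint M \<Phi>" for B
  proof -
    obtain A where A: "A \<in> \<Phi>" "is_adjoint M A B" using \<open>B \<in> opset_adjoint M \<Phi>\<close> by (auto simp: opset_adjoint_def)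
    then show ?thesis using adjoint_op_bound[OF A(2)] C(2)[OF A(1)] by (simp add: is_adjoint_def)
  qed
  then show ?thesis unfolding bounded_op_set_iff using C(1) by blast
qed

text \<open>\<open>B\<close> is any operator satisfying the adjoint relation, with no kernel given,
  so it is tested against nonnegative functions p of its own value: <p(B g), B g> = <A p(B g), g> is
  nonnegative. Taking for p the negative part of Re gives Re (B g) >= 0; taking the two parts of Im
  gives Im (B g) = 0, because the integral must be real.\<close>

lemma is_adjoint_positive:
  assumes A: "positive_op M A" and adj: "is_adjoint M A B"
  shows "positive_op M B"
  unfolding positive_op_def
proof (intro conjI ballI impI)
  show B: "linear_op M B" using adj by (simp add: is_adjoint_def)
  fix g assume g: "g \<in> L2 M" and g0: "AE x in M. g x \<in> \<real>\<^sub>\<ge>\<^sub>0"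
  note Bg = linear_op_L2[OF B g]
  have test: "(LINT x|M. complex_of_real (p (B g x)) * cnj (B g x)) \<in> \<real>\<^sub>\<ge>\<^sub>0"
    "integrable M (\<lambda>x. complex_of_real (p (B g x)) * cnj (B g x))"
    if p: "continuous_on UNIV p" "\<And>z. cmod (complex_of_real (p z)) \<le> cmod z" "\<And>z. 0 \<le> p z" for p
  proof -
    let ?f = "\<lambda>x. complex_of_real (p (B g x))"
    have f: "?f \<in> L2 M" by (rule L2_nonneg_part[OF Bg p(1,2)])
    have Af: "AE x in M. A ?f x \<in> \<real>\<^sub>\<ge>\<^sub>0" by (intro positive_opD[OF A] f) (simp add: p)
    have "AE x in M. A ?f x * cnj (g x) = complex_of_real (Re (A ?f x) * Re (g x))"
      using Af g0 by eventually_elim (auto simp: complex_nonneg_Reals_iff complex_eq_iff)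
    then have "L2_inner M (A ?f) g = (LINT x|M. complex_of_real (Re (A ?f x) * Re (g x)))"
      unfolding L2_inner_def
      using L2_measurable[OF linear_op_L2[OF positive_op_linear[OF A] f]] L2_measurable[OF g]
        borel_measurable_integrable[OF L2_inner_integrable[OF linear_op_L2[OF positive_op_linear[OF A] f] g]]
      by (intro integral_cong_AE) auto
    also have "\<dots> = complex_of_real (LINT x|M. Re (A ?f x) * Re (g x))" by (rule integral_complex_of_real)
    also have "\<dots> \<in> \<real>\<^sub>\<ge>\<^sub>0"
      unfolding nonneg_Reals_of_real_iff
    proof (rule integral_nonneg_AE)
      show "AE x in M. 0 \<le> Re (A ?f x) * Re (g x)"
        using Af g0 by eventually_elim (auto simp: complex_nonneg_Reals_iff)
    qed
    also have "L2_inner M (A ?f) g = (LINT x|M. ?f x * cnj (B g x))"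
      using adj f g by (simp add: is_adjoint_def L2_inner_def)
    finally show "(LINT x|M. ?f x * cnj (B g x)) \<in> \<real>\<^sub>\<ge>\<^sub>0" .
    show "integrable M (\<lambda>x. ?f x * cnj (B g x))" by (rule L2_inner_integrable[OF f Bg])
  qed
  have re: "cmod (complex_of_real (max 0 (- Re z))) \<le> cmod z" for z
    using abs_Re_le_cmod[of z] by auto
  have zero: "AE x in M. q x = 0" if "integrable M q" "\<And>x. 0 \<le> q x" "(LINT x|M. q x) \<le> 0" for q :: "'a \<Rightarrow> real"
  proof -
    have "(LINT x|M. q x) = 0" using that by (intro antisym Bochner_Integration.integral_nonneg) auto
    then show ?thesis using integral_nonneg_eq_0_iff_AE[OF that(1)] that(2) by simp
  qed
  have 1: "AE x in M. max 0 (- Re (B g x)) * - Re (B g x) = 0"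
  proof (rule zero)
    note t = test[of "\<lambda>z. max 0 (- Re z)", OF _ re]
    have t1: "(LINT x|M. complex_of_real (max 0 (- Re (B g x))) * cnj (B g x)) \<in> \<real>\<^sub>\<ge>\<^sub>0"
      and t2: "integrable M (\<lambda>x. complex_of_real (max 0 (- Re (B g x))) * cnj (B g x))"
      by (intro t continuous_intros; simp)+
    show "integrable M (\<lambda>x. max 0 (- Re (B g x)) * - Re (B g x))"
      using integrable_Re[OF t2] by simp
    have "(LINT x|M. max 0 (- Re (B g x)) * Re (B g x)) = Re (LINT x|M. complex_of_real (max 0 (- Re (B g x))) * cnj (B g x))"
      using integral_Re[OF t2] by simp
    then show "(LINT x|M. max 0 (- Re (B g x)) * - Re (B g x)) \<le> 0"
      using t1 by (simp add: complex_nonneg_Reals_iff)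
  qed (auto simp: max_def mult_nonneg_nonneg)
  have 2: "AE x in M. max 0 (\<sigma> * Im (B g x)) * (\<sigma> * Im (B g x)) = 0" if \<sigma>: "\<sigma> = 1 \<or> \<sigma> = - 1" for \<sigma> :: real
  proof (rule zero)
    have im: "cmod (complex_of_real (max 0 (\<sigma> * Im z))) \<le> cmod z" for z
      using \<sigma> abs_Im_le_cmod[of z] by auto
    note t = test[of "\<lambda>z. max 0 (\<sigma> * Im z)", OF _ im]
    have t1: "(LINT x|M. complex_of_real (max 0 (\<sigma> * Im (B g x))) * cnj (B g x)) \<in> \<real>\<^sub>\<ge>\<^sub>0"
      and t2: "integrable M (\<lambda>x. complex_of_real (max 0 (\<sigma> * Im (B g x))) * cnj (B g x))"
      by (intro t continuous_intros; simp)+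
    show "integrable M (\<lambda>x. max 0 (\<sigma> * Im (B g x)) * (\<sigma> * Im (B g x)))"
      using integrable_Im[OF t2] \<sigma> by auto
    have "- (LINT x|M. max 0 (\<sigma> * Im (B g x)) * Im (B g x))
        = Im (LINT x|M. complex_of_real (max 0 (\<sigma> * Im (B g x))) * cnj (B g x))"
      using integral_Im[OF t2] by simp
    then show "(LINT x|M. max 0 (\<sigma> * Im (B g x)) * (\<sigma> * Im (B g x))) \<le> 0"
      using t1 \<sigma> by (auto simp: complex_nonneg_Reals_iff)
  qed (auto simp: max_def)
  show "AE x in M. B g x \<in> \<real>\<^sub>\<ge>\<^sub>0"
    using 1 2[of 1, simplified] 2[of "- 1", simplified] by eventually_elim (auto simp: complex_nonneg_Reals_iff max_def split: if_splits)
qed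

lemma domination_setD: "domination_set M \<Sigma> \<Theta> \<Longrightarrow> A \<in> \<Sigma> \<Longrightarrow> \<exists>B\<in>\<Theta>. dominated M A B"
  by (simp add: domination_set_def)

lemma domination_set_trans: "domination_set M \<Sigma> \<Theta> \<Longrightarrow> domination_set M \<Theta> \<Xi> \<Longrightarrow> domination_set M \<Sigma> \<Xi>"
  unfolding domination_set_def by (meson dominated_trans)

lemma domination_set_mult:
  assumes "domination_set M \<Sigma> \<Theta>" "domination_set M \<Sigma>' \<Theta>'" "\<And>A. A \<in> \<Sigma>' \<Longrightarrow> linear_op M A"
    and "\<And>A. A \<in> \<Theta> \<Longrightarrow> positive_op M A" "\<And>A. A \<in> \<Theta>' \<Longrightarrow> positive_op M A"
  shows "domination_set M (opset_mult \<Sigma> \<Sigma>') (opset_mult \<Theta> \<Theta>')"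
  unfolding domination_set_def
proof
  fix A assume "A \<in> opset_mult \<Sigma> \<Sigma>'"
  then obtain B C where BC: "B \<in> \<Sigma>" "C \<in> \<Sigma>'" "A = B \<circ> C" by (rule opset_multE)
  then obtain B' C' where B': "B' \<in> \<Theta>" "dominated M B B'" and C': "C' \<in> \<Theta>'" "dominated M C C'"
    using assms(1,2) unfolding domination_set_def by meson
  then show "\<exists>A'\<in>opset_mult \<Theta> \<Theta>'. dominated M A A'"
    using BC assms(3-) by (intro bexI[of _ "B' \<circ> C'"]) (auto intro: dominated_comp opset_multI)
qed

lemma domination_set_power:
  assumes "domination_set M \<Sigma> \<Theta>" "\<And>A. A \<in> \<Sigma> \<Longrightarrow> linear_op M A" "\<And>A. A \<in> \<Theta> \<Longrightarrow> positive_op M A"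
    and "bounded_op_set M \<Sigma>"
  shows "domination_set M (opset_power \<Sigma> k) (opset_power \<Theta> k)"
proof (induction k)
  case 0
  show ?case using dominated_id by (simp add: domination_set_def)
next
  case (Suc k)
  show ?case unfolding opset_power_Suc
    by (rule domination_set_mult[OF assms(1) Suc])
       (use assms bounded_op_set_power[OF assms(4), of k] positive_op_set_power[OF assms(3)]
         in \<open>auto simp: bounded_op_set_iff\<close>)
qed

subsection \<open>Hadamard means of sets of operators\<close>

abbreviation (input) hadamard_mean :: "'a measure \<Rightarrow> nat \<Rightarrow> (nat \<Rightarrow> 'a op set) \<Rightarrow> 'a op set" where
  "hadamard_mean M m \<equiv> opset_hadamard M {1..m} (\<lambda>_. 1 / real m)"

text \<open>\<open>opset_hadamard\<close> does not ask its factors to be linear; with linearity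
  supplied, the conditions on each kernel can be packed into \<open>pos_kernel\<close>.\<close>

lemma hadamard_mean_iff:
  assumes "\<And>j A. j \<in> {1..m} \<Longrightarrow> A \<in> \<Phi> j \<Longrightarrow> linear_op M A"
  shows "C \<in> hadamard_mean M m \<Phi> \<longleftrightarrow>
    (\<exists>A a. (\<forall>j\<in>{1..m}. A j \<in> \<Phi> j \<and> pos_kernel M (A j) (a j)) \<and> pos_kernel M C (kernel_mean {1..m} a))"
proof -
  have "pos_kernel M C (kernel_mean {1..m} a) \<longleftrightarrow> linear_op M C \<and>
      has_kernel M C (\<lambda>x y. complex_of_real (\<Prod>j\<in>{1..m}. a j x y powr (1 / real m)))" for a
    unfolding pos_kernel_def using kernel_mean_nonneg[of "{1..m}" a] by (simp add: kernel_mean_def)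
  moreover have "(\<forall>j\<in>{1..m}. A j \<in> \<Phi> j \<and> pos_kernel M (A j) (a j)) \<longleftrightarrow>
      (\<forall>j\<in>{1..m}. A j \<in> \<Phi> j \<and> (\<forall>x y. 0 \<le> a j x y) \<and>
                   has_kernel M (A j) (\<lambda>x y. complex_of_real (a j x y)))" for A a
    unfolding pos_kernel_def using assms by blast
  ultimately show ?thesis unfolding opset_hadamard_def by blast
qed

lemma positive_op_hadamard_mean:
  assumes "C \<in> hadamard_mean M m \<Phi>" shows "positive_op M C"
proof -
  obtain a where "linear_op M C" "has_kernel M C (\<lambda>x y. complex_of_real (\<Prod>j\<in>{1..m}. a j x y powr (1 / real m)))"
    using assms unfolding opset_hadamard_def by blast
  then show ?thesis
    by (intro pos_kernel_positive[of M C "\<lambda>x y. \<Prod>j\<in>{1..m}. a j x y powr (1 / real m)"])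
       (auto simp: pos_kernel_def prod_nonneg)
qed

text \<open>Equal weights make the product of kernels symmetric, so an element can be read in
  whatever order a later pairing demands.\<close>

lemma hadamard_mean_reindex:
  assumes \<pi>: "bij_betw \<pi> {1..m} {1..m}" shows "hadamard_mean M m \<Phi> \<subseteq> hadamard_mean M m (\<lambda>j. \<Phi> (\<pi> j))"
proof
  fix C assume "C \<in> hadamard_mean M m \<Phi>"
  then obtain A a where C: "linear_op M C"
    "has_kernel M C (\<lambda>x y. complex_of_real (\<Prod>j\<in>{1..m}. a j x y powr (1 / real m)))"
    and A: "\<forall>j\<in>{1..m}. A j \<in> \<Phi> j \<and> (\<forall>x y. 0 \<le> a j x y) \<and>
                   has_kernel M (A j) (\<lambda>x y. complex_of_real (a j x y))"
    unfolding opset_hadamard_def by blast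
  have eq: "(\<Prod>j\<in>{1..m}. a j x y powr (1 / real m)) = (\<Prod>j\<in>{1..m}. a (\<pi> j) x y powr (1 / real m))" for x y
    using prod.reindex_bij_betw[OF \<pi>, of "\<lambda>j. a j x y powr (1 / real m)"] by simp
  have "\<forall>j\<in>{1..m}. \<pi> j \<in> {1..m}" using \<pi> by (auto simp: bij_betw_def)
  with A C show "C \<in> hadamard_mean M m (\<lambda>j. \<Phi> (\<pi> j))"
    unfolding opset_hadamard_def eq
    by (intro CollectI conjI exI[of _ "\<lambda>j. A (\<pi> j)"] exI[of _ "\<lambda>j. a (\<pi> j)"]) auto
qed

section \<open>Products and adjoints of Hadamard means of sets\<close>

context sigma_finite_measure
begin

lemma op_bound_hadamard_mean:
  assumes m: "1 \<le> m" and \<Phi>: "\<And>j A. j \<in> {1..m} \<Longrightarrow> A \<in> \<Phi> j \<Longrightarrow> linear_op M A \<and> op_bound M A C" and C: "0 \<le> C"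
    and D: "D \<in> hadamard_mean M m \<Phi>"
  shows "op_bound M D C"
proof -
  obtain A a where A: "\<And>j. j \<in> {1..m} \<Longrightarrow> A j \<in> \<Phi> j \<and> pos_kernel M (A j) (a j)"
    and D: "pos_kernel M D (kernel_mean {1..m} a)"
    using D hadamard_mean_iff[of m \<Phi> M D] \<Phi> by blast
  have "op_bound M D (\<Prod>j\<in>{1..m}. C powr (1 / card {1..m}))"
    by (rule op_bound_kernel_mean[of _ A a]) (use A D C \<Phi> m in auto)
  then show ?thesis using m C by (subst (asm) prod_powr_inverse_card) auto
qed

lemma bounded_op_set_hadamard_mean:
  assumes m: "1 \<le> m" and \<Phi>: "\<And>j. j \<in> {1..m} \<Longrightarrow> bounded_op_set M (\<Phi> j)"
  shows "bounded_op_set M (hadamard_mean M m \<Phi>)"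
proof -
  have "\<forall>j\<in>{1..m}. \<exists>C. 0 \<le> C \<and> (\<forall>A\<in>\<Phi> j. linear_op M A \<and> op_bound M A C)"
    using \<Phi> unfolding bounded_op_set_iff by blast
  then obtain C where C: "\<And>j. j \<in> {1..m} \<Longrightarrow> 0 \<le> C j"
    "\<And>j A. j \<in> {1..m} \<Longrightarrow> A \<in> \<Phi> j \<Longrightarrow> linear_op M A \<and> op_bound M A (C j)"
    by metis
  have le: "C j \<le> (\<Sum>j\<in>{1..m}. C j)" if "j \<in> {1..m}" for j
    using C(1) that by (intro member_le_sum) auto
  show ?thesis
    unfolding bounded_op_set_iff
  proof (intro conjI exI ballI)
    fix A assume A: "A \<in> hadamard_mean M m \<Phi>"
    show "linear_op M A" using positive_op_hadamard_mean[OF A] by (rule positive_op_linear)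
    have "linear_op M B \<and> op_bound M B (\<Sum>j\<in>{1..m}. C j)" if "j \<in> {1..m}" "B \<in> \<Phi> j" for j B
      using C(2)[OF that] op_bound_mono[OF _ le[OF that(1)]] by blast
    then show "op_bound M A (\<Sum>j\<in>{1..m}. C j)"
      by (rule op_bound_hadamard_mean[OF m _ _ A]) (use C in \<open>auto intro: sum_nonneg\<close>)
  qed (use C in \<open>auto intro: sum_nonneg\<close>)
qed

text \<open>The factors of C and of D are chosen independently; composing those of equal index gives
  admissible factors for a dominating element \<open>E\<close>, whose operator is built from its
  kernel.\<close>

lemma domination_set_hadamard_mean_mult:
  assumes m: "1 \<le> m"
    and \<Phi>: "\<And>j A. j \<in> {1..m} \<Longrightarrow> A \<in> \<Phi> j \<Longrightarrow> linear_op M A"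
    and \<Psi>: "\<And>j A. j \<in> {1..m} \<Longrightarrow> A \<in> \<Psi> j \<Longrightarrow> linear_op M A"
  shows "domination_set M (opset_mult (hadamard_mean M m \<Phi>) (hadamard_mean M m \<Psi>))
    (hadamard_mean M m (\<lambda>j. opset_mult (\<Phi> j) (\<Psi> j)))"
  unfolding domination_set_def
proof
  fix X assume "X \<in> opset_mult (hadamard_mean M m \<Phi>) (hadamard_mean M m \<Psi>)"
  then obtain C D where CD: "C \<in> hadamard_mean M m \<Phi>" "D \<in> hadamard_mean M m \<Psi>" "X = C \<circ> D"
    by (rule opset_multE)
  let ?I = "{1..m}"
  have I: "finite ?I" "?I \<noteq> {}" using m by auto
  obtain A a where A: "\<And>j. j \<in> ?I \<Longrightarrow> A j \<in> \<Phi> j \<and> pos_kernel M (A j) (a j)"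
    and C: "pos_kernel M C (kernel_mean ?I a)"
    using CD(1) hadamard_mean_iff[of m \<Phi> M C] \<Phi> by blast
  obtain B b where B: "\<And>j. j \<in> ?I \<Longrightarrow> B j \<in> \<Psi> j \<and> pos_kernel M (B j) (b j)"
    and D: "pos_kernel M D (kernel_mean ?I b)"
    using CD(2) hadamard_mean_iff[of m \<Psi> M D] \<Psi> by blast
  let ?c = "\<lambda>j. kernel_comp M (a j) (b j)"
  have AB: "pos_kernel M (A j \<circ> B j) (?c j)" if "j \<in> ?I" for j
    using A B that by (intro pos_kernel_comp) auto
  define E where "E = integral_op M (kernel_mean ?I ?c)"
  have E: "pos_kernel M E (kernel_mean ?I ?c)"
    unfolding E_def by (rule pos_kernel_kernel_mean[of _ "\<lambda>j. A j \<circ> B j"]) (use I AB in auto)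
  have lin: "linear_op M T" if "j \<in> ?I" "T \<in> opset_mult (\<Phi> j) (\<Psi> j)" for j T
    using that \<Phi> \<Psi> by (auto elim!: opset_multE intro: linear_op_comp)
  have "E \<in> hadamard_mean M m (\<lambda>j. opset_mult (\<Phi> j) (\<Psi> j))"
  proof (rule iffD2[OF hadamard_mean_iff])
    show "\<exists>A a. (\<forall>j\<in>?I. A j \<in> opset_mult (\<Phi> j) (\<Psi> j) \<and> pos_kernel M (A j) (a j)) \<and>
        pos_kernel M E (kernel_mean ?I a)"
      using A B AB E by (intro exI[of _ "\<lambda>j. A j \<circ> B j"] exI[of _ ?c] conjI ballI opset_multI) auto
  qed (rule lin)
  moreover have "dominated M X E"
    unfolding CD(3) by (rule dominated_kernel_mean_comp[OF I _ _ C D E]) (use A B in auto)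
  ultimately show "\<exists>E\<in>hadamard_mean M m (\<lambda>j. opset_mult (\<Phi> j) (\<Psi> j)). dominated M X E" by blast
qed

text \<open>\<open>dominated\<close> is not reflexive for general operators: here |C f| <= C |f|
  comes from the nonnegative kernel.\<close>

lemma domination_set_hadamard_mean_refl: "domination_set M (hadamard_mean M m \<Phi>) (hadamard_mean M m \<Phi>)"
proof -
  have "dominated M C C" if C: "C \<in> hadamard_mean M m \<Phi>" for C
  proof -
    obtain a where "linear_op M C" "has_kernel M C (\<lambda>x y. complex_of_real (\<Prod>j\<in>{1..m}. a j x y powr (1 / real m)))"
      using C unfolding opset_hadamard_def by blast
    then show ?thesis
      by (intro pos_kernel_dominated_self[of M C "\<lambda>x y. \<Prod>j\<in>{1..m}. a j x y powr (1 / real m)"])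
         (auto simp: pos_kernel_def prod_nonneg)
  qed
  then show ?thesis by (auto simp: domination_set_def)
qed

text \<open>The list must be nonempty: the empty product is the identity, which need not have a
  kernel, so the Hadamard mean on the right could be empty.\<close>

lemma domination_set_hadamard_mean_prod:
  assumes m: "1 \<le> m" and "\<Phi>s \<noteq> []"
    and "\<And>\<Phi> j. \<Phi> \<in> set \<Phi>s \<Longrightarrow> j \<in> {1..m} \<Longrightarrow> bounded_op_set M (\<Phi> j)"
  shows "domination_set M (opset_prod (map (hadamard_mean M m) \<Phi>s))
    (hadamard_mean M m (\<lambda>j. opset_prod (map (\<lambda>\<Phi>. \<Phi> j) \<Phi>s)))"
  using assms(2,3)
proof (induction \<Phi>s rule: list_nonempty_induct)
  case (single \<Phi>)
  show ?case using domination_set_hadamard_mean_refl by simp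
next
  case (cons \<Phi> \<Phi>s)
  let ?P = "\<lambda>j. opset_prod (map (\<lambda>\<Phi>. \<Phi> j) \<Phi>s)"
  have lin: "linear_op M A" if "j \<in> {1..m}" "A \<in> ?P j" for j A
  proof -
    have "bounded_op_set M (?P j)" by (rule bounded_op_set_prod) (use that cons in auto)
    then show ?thesis using that by (auto simp: bounded_op_set_iff)
  qed
  have lin': "linear_op M A" if "A \<in> opset_prod (map (hadamard_mean M m) \<Phi>s)" for A
  proof -
    have "bounded_op_set M (hadamard_mean M m \<Phi>')" if "\<Phi>' \<in> set \<Phi>s" for \<Phi>'
      by (rule bounded_op_set_hadamard_mean[OF m cons.prems]) (use that in auto)
    then have "bounded_op_set M (opset_prod (map (hadamard_mean M m) \<Phi>s))"
      by (intro bounded_op_set_prod) (auto simp del: One_nat_def)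
    then show ?thesis using that by (auto simp: bounded_op_set_iff)
  qed
  have d1: "domination_set M (opset_mult (hadamard_mean M m \<Phi>) (opset_prod (map (hadamard_mean M m) \<Phi>s)))
     (opset_mult (hadamard_mean M m \<Phi>) (hadamard_mean M m ?P))"
    using cons lin' by (intro domination_set_mult domination_set_hadamard_mean_refl)
      (auto intro: positive_op_hadamard_mean)
  have d2: "domination_set M (opset_mult (hadamard_mean M m \<Phi>) (hadamard_mean M m ?P))
     (hadamard_mean M m (\<lambda>j. opset_mult (\<Phi> j) (?P j)))"
    using cons.prems lin by (intro domination_set_hadamard_mean_mult m) (auto simp: bounded_op_set_iff)
  show ?case using domination_set_trans[OF d1 d2] by (simp del: One_nat_def)
qed

lemma domination_set_hadamard_mean_power:
  assumes m: "1 \<le> m" and k: "1 \<le> k" and \<Phi>: "\<And>j. j \<in> {1..m} \<Longrightarrow> bounded_op_set M (\<Phi> j)"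
  shows "domination_set M (opset_power (hadamard_mean M m \<Phi>) k) (hadamard_mean M m (\<lambda>j. opset_power (\<Phi> j) k))"
  using domination_set_hadamard_mean_prod[OF m, of "replicate k \<Phi>"] k \<Phi> by (simp add: opset_power_def)

text \<open>\<open>opset_adjoint\<close> contains every representative of an adjoint. The transposed
  kernels supply one for \<open>C\<close> and one for each factor, and transposition commutes with
  the mean.\<close>

lemma hadamard_mean_adjoint:
  assumes m: "1 \<le> m" and \<Phi>: "\<And>j. j \<in> {1..m} \<Longrightarrow> bounded_op_set M (\<Phi> j)" and C: "C \<in> hadamard_mean M m \<Phi>"
  obtains C' where "is_adjoint M C C'" "C' \<in> hadamard_mean M m (\<lambda>j. opset_adjoint M (\<Phi> j))"
proof -
  let ?I = "{1..m}"
  have lin: "linear_op M A" if "j \<in> ?I" "A \<in> \<Phi> j" for j A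
    using \<Phi> that by (auto simp: bounded_op_set_iff)
  have lin': "linear_op M A" if "j \<in> ?I" "A \<in> opset_adjoint M (\<Phi> j)" for j A
    using that by (auto simp: opset_adjoint_def is_adjoint_def)
  obtain A a where A: "\<And>j. j \<in> ?I \<Longrightarrow> A j \<in> \<Phi> j \<and> pos_kernel M (A j) (a j)"
    and Ck: "pos_kernel M C (kernel_mean ?I a)"
    using C hadamard_mean_iff[of m \<Phi> M C] lin by blast
  obtain K where K: "op_bound M C K"
    using bounded_op_set_hadamard_mean[OF m, of \<Phi>] \<Phi> C unfolding bounded_op_set_iff by blast
  let ?A' = "\<lambda>j. integral_op M (\<lambda>x y. a j y x)"
  have A': "pos_kernel M (?A' j) (\<lambda>x y. a j y x) \<and> ?A' j \<in> opset_adjoint M (\<Phi> j)" if j: "j \<in> ?I" for j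
  proof -
    obtain c where "op_bound M (A j) c" using \<Phi>[OF j] A[OF j] unfolding bounded_op_set_iff by blast
    then show ?thesis
      using A[OF j] pos_kernel_transpose is_adjoint_transpose unfolding opset_adjoint_def by blast
  qed
  let ?C' = "integral_op M (\<lambda>x y. kernel_mean ?I a y x)"
  have "pos_kernel M ?C' (kernel_mean ?I (\<lambda>j x y. a j y x))"
    using pos_kernel_transpose[OF Ck K] by (simp add: kernel_mean_def)
  then have "?C' \<in> hadamard_mean M m (\<lambda>j. opset_adjoint M (\<Phi> j))"
    using A' by (intro iffD2[OF hadamard_mean_iff] exI[of _ ?A'] exI[of _ "\<lambda>j x y. a j y x"] conjI ballI)
      (auto intro: lin')
  then show thesis using is_adjoint_transpose[OF Ck K] by (rule that[rotated])
qed

end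

subsection \<open>Growth of sets of operators\<close>

text \<open>For a bounded set the infimum of the positive rates is
  \<open>joint_spectral_radius\<close>; see \<open>joint_spectral_radius_properties\<close>.\<close>

definition set_growth :: "'a measure \<Rightarrow> 'a op set \<Rightarrow> real \<Rightarrow> bool" where
  "set_growth M \<Sigma> t \<longleftrightarrow> (\<exists>K\<ge>0. \<forall>k. \<forall>A\<in>opset_power \<Sigma> k. op_bound M A (K * t ^ k))"

lemma set_growth_singleton: "set_growth M {A} t \<longleftrightarrow> growth M A t"
  by (simp add: set_growth_def growth_def opset_power_singleton)

lemma op_bound_opset_power:
  assumes "\<And>A. A \<in> \<Sigma> \<Longrightarrow> linear_op M A \<and> op_bound M A c" "0 \<le> c" "A \<in> opset_power \<Sigma> k"
  shows "linear_op M A \<and> op_bound M A (c ^ k)"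
  using assms(3)
proof (induction k arbitrary: A)
  case 0
  then have A: "A = id" by simp
  show ?case unfolding A power_0 by (intro conjI linear_op_id op_bound_id)
next
  case (Suc k)
  from Suc.prems obtain B D where B: "B \<in> \<Sigma>" "D \<in> opset_power \<Sigma> k" "A = B \<circ> D"
    unfolding opset_power_Suc by (rule opset_multE)
  with Suc.IH[of D] assms(1)[of B] assms(2) show ?case
    unfolding B(3) power_Suc by (intro conjI linear_op_comp op_bound_comp) auto
qed

lemma power_remainder_le:
  fixes t C :: real
  assumes t: "0 < t" and C: "0 \<le> C" and e: "e \<le> n"
  shows "C ^ e \<le> (max 1 (C / t)) ^ n * t ^ e"
proof -
  have "C ^ e = (C / t) ^ e * t ^ e" using t by (simp add: power_divide)
  also have "(C / t) ^ e \<le> (max 1 (C / t)) ^ e" using t C by (intro power_mono) auto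
  also have "\<dots> \<le> (max 1 (C / t)) ^ n" by (intro power_increasing e) auto
  finally show ?thesis using t by (simp add: mult_right_mono)
qed

text \<open>Write k = n d + e. The block of n d factors is covered by the hypothesis, the fewer than
  n others by a uniform bound C; the constant \<open>?Q\<close> pays for replacing C^e by
  t^e.\<close>

lemma set_growth_of_subsequence:
  assumes \<Sigma>: "bounded_op_set M \<Sigma>" and t: "0 < t" and n: "1 \<le> n" and K: "0 \<le> K"
    and bd: "\<And>d A. A \<in> opset_power \<Sigma> (n * d) \<Longrightarrow> op_bound M A (K * (t ^ n) ^ d)"
  shows "set_growth M \<Sigma> t"
proof -
  obtain C where C: "0 \<le> C" "\<And>A. A \<in> \<Sigma> \<Longrightarrow> linear_op M A \<and> op_bound M A C"
    using \<Sigma> unfolding bounded_op_set_iff by blast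
  let ?Q = "(max 1 (C / t)) ^ n"
  have "op_bound M A (K * ?Q * t ^ k)" if A: "A \<in> opset_power \<Sigma> k" for k A
  proof -
    define d where "d = k div n"
    define e where "e = k mod n"
    have k: "k = n * d + e" and e: "e \<le> n" using n by (auto simp: d_def e_def intro: less_imp_le)
    obtain B D where B: "B \<in> opset_power \<Sigma> (n * d)" and D: "D \<in> opset_power \<Sigma> e" and AB: "A = B \<circ> D"
      using A unfolding k opset_power_add by (rule opset_multE)
    have "op_bound M A (K * (t ^ n) ^ d * C ^ e)"
      unfolding AB using op_bound_opset_power[OF C(2,1) D] bd[OF B] K t
      by (intro op_bound_comp) auto
    moreover have "K * (t ^ n) ^ d * C ^ e \<le> K * (t ^ n) ^ d * (?Q * t ^ e)"
      using K t by (intro mult_left_mono power_remainder_le C e) auto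
    moreover have "K * (t ^ n) ^ d * (?Q * t ^ e) = K * ?Q * t ^ k"
      by (simp add: k power_add power_mult)
    ultimately show ?thesis using op_bound_mono by metis
  qed
  then show ?thesis
    unfolding set_growth_def by (intro exI[of _ "K * ?Q"]) (use K in auto)
qed

lemma bounded_op_set_singleton:
  assumes "bounded_op M A" shows "bounded_op_set M {A}"
proof -
  obtain C where "0 < C" "linear_op M A" "op_bound M A C" using bounded_opE[OF assms] .
  then show ?thesis by (auto simp: bounded_op_set_iff intro: exI[of _ C])
qed

lemma growth_root:
  assumes A: "bounded_op M A" and t: "0 < t" and n: "1 \<le> n" and g: "growth M (A ^^ n) (t ^ n)"
  shows "growth M A t"
proof -
  obtain K where K: "0 \<le> K" "\<And>d. op_bound M ((A ^^ n) ^^ d) (K * (t ^ n) ^ d)"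
    using g unfolding growth_def by blast
  have "set_growth M {A} t"
  proof (rule set_growth_of_subsequence[OF bounded_op_set_singleton[OF A] t n K(1)])
    fix d B assume "B \<in> opset_power {A} (n * d)"
    then have B: "B = (A ^^ n) ^^ d"
      by (simp only: opset_power_singleton funpow_mult singleton_iff)
    show "op_bound M B (K * (t ^ n) ^ d)" unfolding B by (rule K(2))
  qed
  then show ?thesis by (simp add: set_growth_singleton)
qed

text \<open>By \<open>opset_power_swap\<close> a product of length k + 1 encloses one of length k
  from the swapped set. The two outer factors and the lost power of t go into the constant; the 1 in
  \<open>?K\<close> covers k = 0.\<close>

lemma set_growth_swap:
  assumes U: "bounded_op_set M U" and V: "bounded_op_set M V" and t: "0 < t"
    and g: "set_growth M (opset_mult U V) t"
  shows "set_growth M (opset_mult V U) t"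
proof -
  obtain K where K: "0 \<le> K" "\<And>k A. A \<in> opset_power (opset_mult U V) k \<Longrightarrow> op_bound M A (K * t ^ k)"
    using g unfolding set_growth_def by blast
  obtain C where C: "0 \<le> C" "\<And>A. A \<in> U \<Longrightarrow> linear_op M A \<and> op_bound M A C"
    using U unfolding bounded_op_set_iff by blast
  obtain D where D: "0 \<le> D" "\<And>A. A \<in> V \<Longrightarrow> linear_op M A \<and> op_bound M A D"
    using V unfolding bounded_op_set_iff by blast
  let ?K = "max 1 (D * (K * C) / t)"
  have "op_bound M A (?K * t ^ k)" if A: "A \<in> opset_power (opset_mult V U) k" for k A
  proof (cases k)
    case 0
    then have "A = id" using A by simp
    then show ?thesis using op_bound_mono[OF op_bound_id, of ?K] 0 by simp
  next
    case (Suc l)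
    obtain v w where v: "v \<in> V" and w: "w \<in> opset_mult (opset_power (opset_mult U V) l) U" and A1: "A = v \<circ> w"
      using A unfolding Suc opset_power_swap by (rule opset_multE)
    obtain c u where c: "c \<in> opset_power (opset_mult U V) l" and u: "u \<in> U" and w1: "w = c \<circ> u"
      using w by (rule opset_multE)
    have Aeq: "A = v \<circ> (c \<circ> u)" by (simp only: A1 w1)
    have "linear_op M c"
      using c bounded_op_set_power[OF bounded_op_set_mult[OF U V], of l] by (auto simp: bounded_op_set_iff)
    then have "op_bound M A (D * ((K * t ^ l) * C))"
      unfolding Aeq using C(2)[OF u] D(2)[OF v] K(2)[OF c] K(1) t D(1)
      by (intro op_bound_comp linear_op_comp) auto
    moreover have "D * ((K * t ^ l) * C) = (D * (K * C) / t) * t ^ k"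
      using t by (simp add: Suc field_simps)
    moreover have "\<dots> \<le> ?K * t ^ k" using t by (intro mult_right_mono) auto
    ultimately show ?thesis using op_bound_mono by metis
  qed
  then show ?thesis unfolding set_growth_def by (intro exI[of _ ?K]) auto
qed

lemma growth_swap:
  assumes "bounded_op M A" "bounded_op M B" "0 < t" "growth M (A \<circ> B) t"
  shows "growth M (B \<circ> A) t"
proof -
  have eq: "opset_mult {A} {B} = {A \<circ> B}" "opset_mult {B} {A} = {B \<circ> A}" by (auto simp: opset_mult_def)
  show ?thesis
    using set_growth_swap[of M "{A}" "{B}" t] assms
    by (simp add: eq set_growth_singleton bounded_op_set_singleton)
qed

text \<open>As \<open>S = C C\<^sup>*\<close> is self-adjoint, \<open>\<parallel>S\<^sup>k f\<parallel>\<close> is log-convex in \<open>k\<close>, so \<open>\<parallel>S f\<parallel>\<close> cannot exceed the growth rate.\<close>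

lemma op_bound_of_growth_adjoint:
  assumes adj: "is_adjoint M C D" and C: "linear_op M C" and g: "growth M (C \<circ> D) t" and t: "0 < t"
  shows "op_bound M C (sqrt t)"
proof -
  have D: "linear_op M D" using adj by (simp add: is_adjoint_def)
  define S where "S = C \<circ> D"
  have S: "linear_op M S" unfolding S_def by (intro linear_op_comp C D)
  have inner: "L2_inner M (C f) g = L2_inner M f (D g)" if "f \<in> L2 M" "g \<in> L2 M" for f g
    using adj that by (simp add: is_adjoint_def)
  have cnj_inner: "cmod (L2_inner M f g) = cmod (L2_inner M g f)" for f g
    by (metis L2_inner_commute complex_mod_cnj)
  \<comment> \<open>Self-adjointness of \<open>S\<close> enters here: the squared norm of S f is <S
    S f, f>.\<close>
  have dual: "(L2_norm M (S f))\<^sup>2 \<le> L2_norm M f * L2_norm M (S (S f))" if f: "f \<in> L2 M" for f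
  proof -
    have Sf: "S f \<in> L2 M" "S (S f) \<in> L2 M" using f S by (auto intro: linear_op_L2)
    have "(L2_norm M (S f))\<^sup>2 = cmod (L2_inner M (S f) (S f))" unfolding L2_inner_self norm_of_real by simp
    also have "L2_inner M (S f) (S f) = L2_inner M (D f) (D (S f))"
      unfolding S_def comp_def by (intro inner linear_op_L2[OF D] linear_op_L2[OF C] f)
    also have "cmod \<dots> = cmod (L2_inner M (D (S f)) (D f))" by (rule cnj_inner)
    also have "L2_inner M (D (S f)) (D f) = L2_inner M (C (D (S f))) f"
      by (rule inner[symmetric]) (intro linear_op_L2[OF D] Sf f)+
    also have "cmod \<dots> \<le> L2_norm M (S (S f)) * L2_norm M f"
      unfolding S_def comp_def[of C D] using Sf f unfolding S_def by (intro L2_inner_le) auto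
    finally show ?thesis by (simp add: mult.commute)
  qed
  obtain K where K: "0 \<le> K" "\<And>n. op_bound M (S ^^ n) (K * t ^ n)"
    using g unfolding growth_def S_def by blast
  have Sb: "L2_norm M (S f) \<le> t * L2_norm M f" if f: "f \<in> L2 M" for f
  proof (rule ccontr)
    assume "\<not> L2_norm M (S f) \<le> t * L2_norm M f"
    then have less: "t * L2_norm M f < L2_norm M (S f)" by simp
    define c where "c = (\<lambda>n. L2_norm M ((S ^^ n) f))"
    have Sn: "(S ^^ n) f \<in> L2 M" for n by (intro linear_op_L2[OF linear_op_funpow[OF S]] f)
    have c0: "0 < c 0"
    proof (rule ccontr)
      assume "\<not> 0 < c 0"
      then have "L2_norm M f = 0" using L2_norm_nonneg[of M f] by (simp add: c_def)
      with op_boundD[OF K(2)[of 1] f] less show False by simp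
    qed
    have conv: "(c (Suc n))\<^sup>2 \<le> c n * c (Suc (Suc n))" for n
      using dual[OF Sn[of n]] by (simp add: c_def)
    \<comment> \<open>The ratio s of the norms with index 1 and 0 exceeds t. Log-convexity keeps all
      later ratios at least s, so s^n would have to stay below K t^n.\<close>
    define s where "s = c 1 / c 0"
    have s: "t < s" using less c0 unfolding s_def by (simp add: c_def field_simps)
    have ratio: "0 < c n \<and> s * c n \<le> c (Suc n)" for n
    proof (induction n)
      case 0
      then show ?case using c0 by (simp add: s_def)
    next
      case (Suc n)
      have s0: "0 < s" using s t by simp
      have p: "0 < c (Suc n)" using Suc s0 mult_pos_pos[of s "c n"] by linarith
      have "(s * c n) * c (Suc n) \<le> c (Suc n) * c (Suc n)" using Suc p by (intro mult_right_mono) auto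
      also have "\<dots> \<le> c n * c (Suc (Suc n))" using conv[of n] by (simp add: power2_eq_square)
      finally have "c n * (s * c (Suc n)) \<le> c n * c (Suc (Suc n))" by (simp add: mult_ac)
      then show ?case using Suc p by simp
    qed
    have lower: "s ^ n * c 0 \<le> c n" for n
    proof (induction n)
      case (Suc n)
      have "s * (s ^ n * c 0) \<le> s * c n" using Suc s t by (intro mult_left_mono) auto
      then show ?case using ratio[of n] by simp
    qed simp
    have "c n \<le> K * t ^ n * c 0" for n
      using op_boundD[OF K(2)[of n] f] by (simp add: c_def)
    then have "s ^ n * c 0 \<le> K * t ^ n * c 0" for n
      using lower[of n] order_trans by blast
    then have "s ^ n \<le> K * t ^ n" for n using c0 by simp
    then have "(s / t) ^ n \<le> K" for n using t by (simp add: power_divide divide_le_eq)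
    moreover obtain n where "K < (s / t) ^ n"
      using real_arch_pow[of "s / t" K] s t by auto
    ultimately show False by (meson not_le)
  qed
  \<comment> \<open>The squared norm of D f is <C D f, f>, which bounds \<open>D\<close>; as
    \<open>C\<close> is in turn the adjoint of \<open>D\<close>, it inherits the bound.\<close>
  have Db: "op_bound M D (sqrt t)"
  proof (rule op_boundI)
    fix f assume f: "f \<in> L2 M"
    note Df = linear_op_L2[OF D f]
    have "(L2_norm M (D f))\<^sup>2 = cmod (L2_inner M (D f) (D f))" unfolding L2_inner_self norm_of_real by simp
    also have "L2_inner M (D f) (D f) = L2_inner M (C (D f)) f" by (rule inner[symmetric]) (intro Df f)+
    also have "cmod \<dots> \<le> L2_norm M (C (D f)) * L2_norm M f"
      by (intro L2_inner_le linear_op_L2[OF C] Df f)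
    also have "\<dots> \<le> t * L2_norm M f * L2_norm M f"
      using Sb[OF f] by (intro mult_right_mono) (auto simp: S_def)
    also have "\<dots> = (sqrt t * L2_norm M f)\<^sup>2" using t by (simp add: power_mult_distrib power2_eq_square)
    finally show "L2_norm M (D f) \<le> sqrt t * L2_norm M f"
      by (rule power2_le_imp_le) (use t in simp)
  qed
  have "is_adjoint M D C"
    unfolding is_adjoint_def
  proof (intro conjI ballI C)
    fix f g assume f: "f \<in> L2 M" and g: "g \<in> L2 M"
    show "L2_inner M (D f) g = L2_inner M f (C g)"
      using inner[OF g f] L2_inner_commute[of M "D f" g] L2_inner_commute[of M f "C g"] by simp
  qed
  then show ?thesis using D Db by (rule adjoint_op_bound)
qed

subsection \<open>Operator norms and the two spectral radii\<close>

lemma bdd_above_op_norm: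
  assumes "op_bound M A C" shows "bdd_above {L2_norm M (A f) | f. f \<in> L2 M \<and> L2_norm M f \<le> 1}"
proof (rule bdd_aboveI)
  fix x assume "x \<in> {L2_norm M (A f) | f. f \<in> L2 M \<and> L2_norm M f \<le> 1}"
  then obtain f where f: "f \<in> L2 M" "L2_norm M f \<le> 1" "x = L2_norm M (A f)" by blast
  have "L2_norm M (A f) \<le> max C 0 * L2_norm M f"
    by (rule op_boundD[OF op_bound_mono[OF assms] f(1)]) simp
  also have "\<dots> \<le> max C 0 * 1" using f by (intro mult_left_mono) auto
  finally show "x \<le> max C 0" using f by simp
qed

lemma op_norm_le:
  assumes "op_bound M A C" "0 \<le> C" shows "op_norm M A \<le> C"
  unfolding op_norm_def
proof (rule nonneg_Sup_least)
  fix x assume "x \<in> {L2_norm M (A f) | f. f \<in> L2 M \<and> L2_norm M f \<le> 1}"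
  then obtain f where f: "f \<in> L2 M" "L2_norm M f \<le> 1" "x = L2_norm M (A f)" by blast
  have "L2_norm M (A f) \<le> C * L2_norm M f" by (rule op_boundD[OF assms(1) f(1)])
  also have "\<dots> \<le> C * 1" using f assms by (intro mult_left_mono) auto
  finally show "x \<le> C" using f by simp
qed (rule assms)

lemma op_bound_op_norm:
  assumes A: "linear_op M A" "op_bound M A C" shows "op_bound M A (op_norm M A)"
proof (rule op_boundI)
  fix f assume f: "f \<in> L2 M"
  show "L2_norm M (A f) \<le> op_norm M A * L2_norm M f"
  proof (cases "L2_norm M f = 0")
    case True
    then show ?thesis using op_boundD[OF A(2) f] by simp
  next
    case False
    then have n: "0 < L2_norm M f" using L2_norm_nonneg[of M f] by linarith
    let ?c = "complex_of_real (1 / L2_norm M f)"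
    let ?g = "\<lambda>x. ?c * f x"
    have c: "cmod ?c = 1 / L2_norm M f" unfolding norm_of_real using n by simp
    have g: "?g \<in> L2 M" "L2_norm M ?g \<le> 1"
      using L2_scale[OF f, of ?c] n unfolding L2_norm_scale c by simp_all
    have "L2_norm M (A ?g) = L2_norm M (\<lambda>x. ?c * A f x)"
      by (intro L2_norm_cong_AE linear_op_scale A f L2_measurable L2_scale linear_op_L2[OF A(1)])
    also have "\<dots> = 1 / L2_norm M f * L2_norm M (A f)" unfolding L2_norm_scale c ..
    finally have eq: "L2_norm M (A ?g) = 1 / L2_norm M f * L2_norm M (A f)" .
    have "L2_norm M (A ?g) \<le> op_norm M A"
      unfolding op_norm_def using g
      by (intro nonneg_Sup_upper bdd_above_op_norm[OF A(2)] CollectI exI[of _ ?g]) auto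
    then have "1 / L2_norm M f * L2_norm M (A f) \<le> op_norm M A" unfolding eq .
    then show ?thesis using n by (simp add: field_simps)
  qed
qed

lemma opset_power_bounds:
  assumes "bounded_op_set M \<Sigma>"
  obtains C where "1 \<le> C" "\<And>k A. A \<in> opset_power \<Sigma> k \<Longrightarrow> linear_op M A \<and> op_bound M A (C ^ k)"
proof -
  obtain C where C: "0 \<le> C" "\<And>A. A \<in> \<Sigma> \<Longrightarrow> linear_op M A \<and> op_bound M A C"
    using assms unfolding bounded_op_set_iff by blast
  then have "\<And>A. A \<in> \<Sigma> \<Longrightarrow> linear_op M A \<and> op_bound M A (max C 1)"
    by (meson max.cobounded1 op_bound_mono)
  from op_bound_opset_power[OF this] show thesis by (intro that[of "max C 1"]) auto
qed

lemma powr_inverse_power: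
  fixes x :: real assumes "0 \<le> x" "1 \<le> k" shows "(x powr (1 / real k)) ^ k = x"
  using assms by (cases "x = 0") (auto simp: powr_powr simp flip: powr_realpow)

lemma power_powr_inverse:
  fixes x :: real assumes "0 \<le> x" "1 \<le> k" shows "(x ^ k) powr (1 / real k) = x"
  using assms by (cases "x = 0") (auto simp: powr_powr simp flip: powr_realpow)

text \<open>For k >= 1 the sequence lies between 0 and a common bound of the generators, so its
  limsup is finite and \<open>real_of_ereal\<close> loses nothing.\<close>

lemma generalized_spectral_radius_ereal:
  assumes \<Sigma>: "bounded_op_set M \<Sigma>"
  shows "ereal (generalized_spectral_radius M \<Sigma>) = limsup (\<lambda>k.
     ereal (nonneg_Sup (spectral_radius_op M ` opset_power \<Sigma> k) powr (1 / real k)))"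
    and "0 \<le> generalized_spectral_radius M \<Sigma>"
    and "bdd_above (spectral_radius_op M ` opset_power \<Sigma> k)"
proof -
  obtain C where C: "1 \<le> C" "\<And>k A. A \<in> opset_power \<Sigma> k \<Longrightarrow> linear_op M A \<and> op_bound M A (C ^ k)"
    using opset_power_bounds[OF \<Sigma>] by blast
  have le: "x \<le> C ^ k" if "x \<in> spectral_radius_op M ` opset_power \<Sigma> k" for x k
    using that C by (auto intro: spectral_radius_le_op_bound)
  show "bdd_above (spectral_radius_op M ` opset_power \<Sigma> k)" by (rule bdd_aboveI) (rule le)
  let ?q = "\<lambda>k. nonneg_Sup (spectral_radius_op M ` opset_power \<Sigma> k) powr (1 / real k)"
  have "?q k \<le> C" if "1 \<le> k" for k
  proof -
    have "nonneg_Sup (spectral_radius_op M ` opset_power \<Sigma> k) \<le> C ^ k"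
      by (rule nonneg_Sup_least) (use le C in auto)
    moreover have "0 \<le> nonneg_Sup (spectral_radius_op M ` opset_power \<Sigma> k)"
      by (rule nonneg_Sup_nonneg, rule bdd_aboveI, rule le)
    ultimately have "?q k \<le> (C ^ k) powr (1 / real k)" by (intro powr_mono2) auto
    then show ?thesis using power_powr_inverse[of C k] C that by simp
  qed
  then have "eventually (\<lambda>k. ereal (?q k) \<le> ereal C) sequentially"
    by (intro eventually_sequentiallyI[of 1]) simp
  then have up: "limsup (\<lambda>k. ereal (?q k)) \<le> ereal C" by (rule Limsup_bounded)
  have lo: "0 \<le> limsup (\<lambda>k. ereal (?q k))"
    by (rule le_Limsup) auto
  from up lo show "ereal (generalized_spectral_radius M \<Sigma>) = limsup (\<lambda>k. ereal (?q k))"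
    unfolding generalized_spectral_radius_def by (intro ereal_real') auto
  with lo show "0 \<le> generalized_spectral_radius M \<Sigma>" by (metis ereal_less_eq(5))
qed

lemma generalized_spectral_radius_le:
  assumes \<Sigma>: "bounded_op_set M \<Sigma>" and t: "0 \<le> t"
    and ev: "\<forall>\<^sub>F k in sequentially. \<forall>A\<in>opset_power \<Sigma> k. spectral_radius_op M A \<le> t ^ k"
  shows "generalized_spectral_radius M \<Sigma> \<le> t"
proof -
  have "\<forall>\<^sub>F k in sequentially.
     ereal (nonneg_Sup (spectral_radius_op M ` opset_power \<Sigma> k) powr (1 / real k)) \<le> ereal t"
    using ev eventually_ge_at_top[of 1]
  proof eventually_elim
    case (elim k)
    let ?p = "nonneg_Sup (spectral_radius_op M ` opset_power \<Sigma> k)"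
    have "?p \<le> t ^ k" by (rule nonneg_Sup_least) (use elim t in auto)
    moreover have "0 \<le> ?p" by (intro nonneg_Sup_nonneg generalized_spectral_radius_ereal(3) \<Sigma>)
    ultimately have "?p powr (1 / real k) \<le> (t ^ k) powr (1 / real k)" by (intro powr_mono2) auto
    then show ?case using power_powr_inverse[OF t elim(2)] by simp
  qed
  from Limsup_bounded[OF this] show ?thesis
    unfolding generalized_spectral_radius_ereal(1)[OF \<Sigma>, symmetric] by simp
qed

lemma generalized_spectral_radius_less:
  assumes \<Sigma>: "bounded_op_set M \<Sigma>" and t: "generalized_spectral_radius M \<Sigma> < t"
  shows "\<forall>\<^sub>F k in sequentially. \<forall>A\<in>opset_power \<Sigma> k. spectral_radius_op M A \<le> t ^ k"
proof -
  have "limsup (\<lambda>k. ereal (nonneg_Sup (spectral_radius_op M ` opset_power \<Sigma> k) powr (1 / real k))) < ereal t"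
    unfolding generalized_spectral_radius_ereal(1)[OF \<Sigma>, symmetric] using t by simp
  from Limsup_lessD[OF this] eventually_ge_at_top[of 1] show ?thesis
  proof eventually_elim
    case (elim k)
    let ?p = "nonneg_Sup (spectral_radius_op M ` opset_power \<Sigma> k)"
    note bdd = generalized_spectral_radius_ereal(3)[OF \<Sigma>, of k]
    have p: "0 \<le> ?p" by (intro nonneg_Sup_nonneg bdd)
    have "(?p powr (1 / real k)) ^ k \<le> t ^ k" using elim(1) by (intro power_mono) auto
    then have "?p \<le> t ^ k" using powr_inverse_power[OF p elim(2)] by simp
    then show ?case by (intro ballI order_trans[OF nonneg_Sup_upper[OF bdd imageI]])
  qed
qed

text \<open>The limit exists by the usual subadditivity argument, which also identifies it with an infimum.\<close>

lemma joint_spectral_radius_properties: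
  assumes \<Sigma>: "bounded_op_set M \<Sigma>"
  shows "0 \<le> joint_spectral_radius M \<Sigma>"
    and "joint_spectral_radius M \<Sigma> < t \<Longrightarrow> set_growth M \<Sigma> t"
    and "set_growth M \<Sigma> t \<Longrightarrow> 0 < t \<Longrightarrow> joint_spectral_radius M \<Sigma> \<le> t"
proof -
  define q where "q = (\<lambda>k. nonneg_Sup (op_norm M ` opset_power \<Sigma> k) powr (1 / real k))"
  obtain C where C: "1 \<le> C" "\<And>k A. A \<in> opset_power \<Sigma> k \<Longrightarrow> linear_op M A \<and> op_bound M A (C ^ k)"
    using opset_power_bounds[OF \<Sigma>] by blast
  have bdd: "bdd_above (op_norm M ` opset_power \<Sigma> k)" for k
  proof (rule bdd_aboveI)
    fix x assume "x \<in> op_norm M ` opset_power \<Sigma> k"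
    then show "x \<le> C ^ k" using C by (auto intro: op_norm_le)
  qed
  have q0: "0 \<le> q k" for k by (simp add: q_def)
  have qk: "q k ^ k = nonneg_Sup (op_norm M ` opset_power \<Sigma> k)" if "1 \<le> k" for k
    unfolding q_def by (intro powr_inverse_power nonneg_Sup_nonneg bdd that)
  \<comment> \<open>A single k with \<open>q k < u\<close> is enough: blocks of length k have norm
    at most u^k.\<close>
  have growth_of_less: "set_growth M \<Sigma> u" if k: "1 \<le> k" and u: "q k < u" for k u
  proof (rule set_growth_of_subsequence[OF \<Sigma> _ k zero_le_one])
    show u0: "0 < u" using u q0[of k] by linarith
    fix d A assume A: "A \<in> opset_power \<Sigma> (k * d)"
    have "linear_op M B \<and> op_bound M B (u ^ k)" if B: "B \<in> opset_power \<Sigma> k" for B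
    proof -
      have "op_norm M B \<le> q k ^ k" unfolding qk[OF k] by (intro nonneg_Sup_upper bdd imageI B)
      also have "\<dots> \<le> u ^ k" using u q0 by (intro power_mono) auto
      finally show ?thesis using C(2)[OF B] op_bound_op_norm op_bound_mono by metis
    qed
    then show "op_bound M A (1 * (u ^ k) ^ d)"
      using op_bound_opset_power[of "opset_power \<Sigma> k" M "u ^ k" A d] A u0 by (simp add: opset_power_mult)
  qed
  have less_of_growth: "\<forall>\<^sub>F k in sequentially. q k < v" if g: "set_growth M \<Sigma> u" and u: "0 < u" "u < v" for u v
  proof -
    obtain K where K: "0 \<le> K" "\<And>k A. A \<in> opset_power \<Sigma> k \<Longrightarrow> op_bound M A (K * u ^ k)"
      using g unfolding set_growth_def by blast
    \<comment> \<open>\<open>max K 1\<close> is positive, so its k-th roots tend to 1 even if K =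
      0.\<close>
    have K1: "op_bound M A (max K 1 * u ^ k)" if "A \<in> opset_power \<Sigma> k" for k A
      by (rule op_bound_mono[OF K(2)[OF that]]) (use u in \<open>auto intro: mult_right_mono\<close>)
    have "(\<lambda>k. max K 1 powr (1 / real k)) \<longlonglongrightarrow> max K 1 powr 0"
      by (intro tendsto_powr tendsto_const lim_1_over_n) auto
    moreover have "max K 1 \<noteq> 0" by auto
    ultimately have "(\<lambda>k. max K 1 powr (1 / real k) * u) \<longlonglongrightarrow> 1 * u"
      by (intro tendsto_mult tendsto_const) simp
    then have "\<forall>\<^sub>F k in sequentially. max K 1 powr (1 / real k) * u < v"
      using u by (intro order_tendstoD) auto
    then show ?thesis using eventually_ge_at_top[of 1]
    proof eventually_elim
      case (elim k)
      have "nonneg_Sup (op_norm M ` opset_power \<Sigma> k) \<le> max K 1 * u ^ k"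
        by (rule nonneg_Sup_least) (use u K1 in \<open>auto intro!: op_norm_le\<close>)
      then have "q k \<le> (max K 1 * u ^ k) powr (1 / real k)"
        unfolding q_def by (intro powr_mono2 nonneg_Sup_nonneg bdd) auto
      also have "\<dots> = max K 1 powr (1 / real k) * u"
        using u power_powr_inverse[of u k] elim(2) by (simp add: powr_mult)
      finally show ?case using elim(1) by simp
    qed
  qed
  \<comment> \<open>The index 0 is excluded: there the exponent \<open>1 / real k\<close> is 0 and
    \<open>q 0\<close> carries no information.\<close>
  define L where "L = Inf (q ` {1..})"
  have bddq: "bdd_below (q ` {1..})" by (rule bdd_belowI[of _ 0]) (use q0 in auto)
  have Lle: "L \<le> q k" if "1 \<le> k" for k unfolding L_def by (intro cInf_lower bddq) (use that in auto)
  have L0: "0 \<le> L" unfolding L_def by (intro cInf_greatest) (use q0 in auto)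
  have ex_less: "\<exists>k\<ge>1. q k < u" if "L < u" for u
    using cInf_lessD[of "q ` {1..}" u] that unfolding L_def by auto
  have "q \<longlonglongrightarrow> L"
  proof (rule order_tendstoI)
    fix a assume "a < L"
    then show "\<forall>\<^sub>F k in sequentially. a < q k"
      using Lle by (intro eventually_sequentiallyI[of 1]) (auto intro: less_le_trans)
  next
    fix a assume a: "L < a"
    then obtain u where u: "L < u" "u < a" using dense by blast
    then obtain k where "1 \<le> k" "q k < u" using ex_less by blast
    then show "\<forall>\<^sub>F k in sequentially. q k < a"
      using u L0 by (intro less_of_growth[OF growth_of_less]) auto
  qed
  then have jsr: "joint_spectral_radius M \<Sigma> = L"
    unfolding joint_spectral_radius_def q_def[symmetric] by (rule limI)
  show "0 \<le> joint_spectral_radius M \<Sigma>" by (simp add: jsr L0)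
  show "set_growth M \<Sigma> t" if "joint_spectral_radius M \<Sigma> < t"
    using ex_less[of t] that growth_of_less by (auto simp: jsr)
  show "joint_spectral_radius M \<Sigma> \<le> t" if g: "set_growth M \<Sigma> t" and t: "0 < t"
    unfolding jsr
  proof (rule dense_ge)
    fix v assume "t < v"
    from less_of_growth[OF g t this] eventually_ge_at_top[of 1]
    have "\<forall>\<^sub>F k in sequentially. L \<le> v"
      by eventually_elim (use Lle in \<open>force intro: order_trans less_imp_le\<close>)
    then show "L \<le> v" by simp
  qed
qed

subsection \<open>Cyclic products\<close>

lemma cyc_in: "1 \<le> m \<Longrightarrow> cyc m i \<in> {1..m}"
  by (auto simp: cyc_def Suc_le_eq)

lemma cyc_add: "1 \<le> i \<Longrightarrow> cyc m (i + m) = cyc m i"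
  by (cases i) (auto simp: cyc_def)

text \<open>Multiplication by a unit modulo m is injective, and on a finite set injectivity
  suffices.\<close>

lemma bij_betw_affine_mod:
  fixes m u c :: nat
  assumes m: "1 \<le> m" and u: "coprime u m"
  shows "bij_betw (\<lambda>j. (u * (j - 1) + c) mod m + 1) {1..m} {1..m}"
proof -
  have inj: "j = k" if "j \<in> {1..m}" "k \<in> {1..m}" "k \<le> j"
    "(u * (j - 1) + c) mod m + 1 = (u * (k - 1) + c) mod m + 1" for j k
  proof -
    have "u * (k - 1) + c \<le> u * (j - 1) + c"
      using that by (intro add_right_mono mult_left_mono diff_le_mono) auto
    then have "m dvd (u * (j - 1) + c) - (u * (k - 1) + c)"
      using that(4) mod_eq_dvd_iff_nat by (metis add_right_cancel)
    also have "(u * (j - 1) + c) - (u * (k - 1) + c) = u * (j - k)"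
      using that by (simp add: diff_mult_distrib2[symmetric])
    finally have "m dvd j - k" using u by (simp add: coprime_commute coprime_dvd_mult_right_iff)
    moreover have "j - k < m" using that by auto
    ultimately have "j - k = 0" using nat_dvd_not_less by blast
    with that show ?thesis by simp
  qed
  have "inj_on (\<lambda>j. (u * (j - 1) + c) mod m + 1) {1..m}"
    by (rule linorder_inj_onI') (use inj in \<open>metis less_imp_le less_irrefl\<close>)
  moreover have "(\<lambda>j. (u * (j - 1) + c) mod m + 1) ` {1..m} \<subseteq> {1..m}"
    using m by (auto simp: Suc_le_eq)
  ultimately show ?thesis
    unfolding bij_betw_def by (intro conjI endo_inj_surj finite_atLeastAtMost)
qed

text \<open>Parity matters here: 2 is invertible modulo odd m, so the odd and the even positions of
  the cyclic product each run through all indices.\<close>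

lemma bij_betw_cyc:
  assumes "odd m"
  shows "bij_betw (\<lambda>j. cyc m (2 * j - 1)) {1..m} {1..m}"
    and "bij_betw (\<lambda>j. cyc m (2 * j)) {1..m} {1..m}"
    and "bij_betw (\<lambda>j. cyc m (j + l)) {1..m} {1..m}"
proof -
  have m: "1 \<le> m" using assms by (cases m) auto
  have co: "coprime 2 m" "coprime 1 m" using assms by auto
  show "bij_betw (\<lambda>j. cyc m (2 * j - 1)) {1..m} {1..m}"
    by (subst bij_betw_cong[OF _, of _ _ "\<lambda>j. (2 * (j - 1) + 0) mod m + 1"])
       (auto simp: cyc_def diff_mult_distrib2 numeral_2_eq_2 simp del: mult_Suc intro: bij_betw_affine_mod[OF m co(1), of 0, simplified])
  show "bij_betw (\<lambda>j. cyc m (2 * j)) {1..m} {1..m}"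
    by (rule iffD2[OF bij_betw_cong bij_betw_affine_mod[OF m co(1), of 1]])
       (auto simp: cyc_def intro!: arg_cong[of _ _ "\<lambda>i. i mod m"])
  show "bij_betw (\<lambda>j. cyc m (j + l)) {1..m} {1..m}"
    by (rule iffD2[OF bij_betw_cong bij_betw_affine_mod[OF m co(2), of l]])
       (auto simp: cyc_def intro!: arg_cong[of _ _ "\<lambda>i. i mod m"])
qed

text \<open>Advancing the pair by l advances the underlying indices by 2 l, and reduction modulo m
  may be done before or after doubling.\<close>

lemma pair_factor_cyc:
  assumes "1 \<le> j"
  shows "pair_factor M m \<Psi> (cyc m (j + l)) =
    opset_mult (\<Psi> (cyc m (2 * j - 1 + 2 * l))) (opset_adjoint M (\<Psi> (cyc m (2 * j + 2 * l))))"
proof -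
  obtain i where j: "j = Suc i" using assms by (cases j) auto
  have "cyc m (2 * cyc m (j + l) - 1) = cyc m (2 * j - 1 + 2 * l)"
    by (simp add: cyc_def j mod_mult_right_eq)
  moreover have "cyc m (2 * cyc m (j + l)) = cyc m (2 * j + 2 * l)"
  proof -
    have "(2 * ((i + l) mod m) + 1) mod m = (2 * (i + l) + 1) mod m"
      by (metis mod_add_left_eq mod_mult_right_eq)
    then show ?thesis by (simp add: cyc_def j)
  qed
  ultimately show ?thesis by (simp add: pair_factor_def)
qed

text \<open>Regrouped in pairs, the 2 m factors form a cyclic product of m pair factors beginning at
  j, on which a rotation acts by single steps.\<close>

lemma Omega_eq_prod:
  assumes "1 \<le> j"
  shows "Omega M m \<Psi> j = opset_prod (map (\<lambda>l. pair_factor M m \<Psi> (cyc m (j + l))) [0..<m])"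
  unfolding Omega_def opset_prod_concat_pairs pair_factor_cyc[OF assms] ..

text \<open>\<open>Us\<close> holds the pair factors 1, ..., j - 1 and \<open>Vs\<close> the
  remaining ones. Past position m the cyclic index starts again at 1, which brings \<open>Us\<close>
  to the end.\<close>

lemma Omega_rotate:
  assumes j: "j \<in> {1..m}"
  obtains Us Vs where "set Us \<union> set Vs \<subseteq> pair_factor M m \<Psi> ` {1..m}"
    "Omega M m \<Psi> 1 = opset_prod (Us @ Vs)" "Omega M m \<Psi> j = opset_prod (Vs @ Us)"
proof -
  define F where "F = (\<lambda>i. pair_factor M m \<Psi> (cyc m i))"
  have shift: "map (\<lambda>l. F (k + l)) [0..<n] = map F [k..<k + n]" for k n
    by (rule nth_equalityI) auto
  have "map F [1..<1 + m] = map F [1..<j] @ map F [j..<1 + m]"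
    using j upt_add_eq_append[of 1 j "1 + m - j"] by auto
  then have 1: "Omega M m \<Psi> 1 = opset_prod (map F [1..<j] @ map F [j..<1 + m])"
    using shift[of 1 m] by (subst Omega_eq_prod) (simp_all add: F_def)
  have "map F [1 + m..<j + m] = map F [1..<j]"
    by (rule nth_equalityI) (use j in \<open>auto simp: F_def cyc_add[of "Suc _", simplified] add.commute[of m]\<close>)
  moreover have "map F [j..<j + m] = map F [j..<1 + m] @ map F [1 + m..<j + m]"
  proof -
    have e: "1 + m + (j - 1) = j + m" using j by auto
    have "[j..<1 + m + (j - 1)] = [j..<1 + m] @ [1 + m..<1 + m + (j - 1)]"
      by (rule upt_add_eq_append) (use j in auto)
    then show ?thesis unfolding e by (simp only: map_append)
  qed
  ultimately have 2: "Omega M m \<Psi> j = opset_prod (map F [j..<1 + m] @ map F [1..<j])"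
    using shift[of j m] j by (subst Omega_eq_prod) (simp_all add: F_def)
  have "F i \<in> pair_factor M m \<Psi> ` {1..m}" for i
    unfolding F_def using j by (intro imageI cyc_in) auto
  then have "set (map F [1..<j]) \<union> set (map F [j..<1 + m]) \<subseteq> pair_factor M m \<Psi> ` {1..m}" by auto
  from that[OF this 1 2] show thesis .
qed

section \<open>Rates of Hadamard means of single operators\<close>

context sigma_finite_measure
begin

text \<open>\<open>E ^^ n\<close> is dominated by a mean of the powers \<open>A j ^^ n\<close>, so a
  common constant \<open>L\<close> works. The case n = 0 is apart because the identity need not have
  a kernel.\<close>

lemma growth_hadamard_mean:
  assumes m: "1 \<le> m" and A: "\<And>j. j \<in> {1..m} \<Longrightarrow> bounded_op M (A j) \<and> growth M (A j) t"
    and t: "0 < t" and E: "E \<in> hadamard_mean M m (\<lambda>j. {A j})"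
  shows "growth M E t"
proof -
  have "\<forall>j\<in>{1..m}. \<exists>K\<ge>0. \<forall>n. op_bound M (A j ^^ n) (K * t ^ n)" using A unfolding growth_def by blast
  then obtain K where K: "\<And>j. j \<in> {1..m} \<Longrightarrow> 0 \<le> K j"
    "\<And>j n. j \<in> {1..m} \<Longrightarrow> op_bound M (A j ^^ n) (K j * t ^ n)" by metis
  define L where "L = max 1 (\<Sum>j\<in>{1..m}. K j)"
  have L: "K j \<le> L" if "j \<in> {1..m}" for j
    using K(1) that member_le_sum[of j "{1..m}" K] by (auto simp: L_def)
  have L1: "1 \<le> L" by (simp add: L_def)
  have lin: "linear_op M (A j)" if "j \<in> {1..m}" for j using A[OF that] by (simp add: bounded_op_iff)
  show ?thesis
  proof (rule growthI)
    show "0 \<le> L" using L1 by simp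
    fix n
    show "op_bound M (E ^^ n) (L * t ^ n)"
    proof (cases n)
      case 0
      then show ?thesis using op_bound_mono[OF op_bound_id L1] by (simp add: id_def)
    next
      case (Suc k)
      have "domination_set M (opset_power (hadamard_mean M m (\<lambda>j. {A j})) n)
         (hadamard_mean M m (\<lambda>j. opset_power {A j} n))"
        using A Suc by (intro domination_set_hadamard_mean_power m bounded_op_set_singleton) auto
      from domination_setD[OF this funpow_in_opset_power[OF E]]
      obtain D where D: "D \<in> hadamard_mean M m (\<lambda>j. {A j ^^ n})" and dom: "dominated M (E ^^ n) D"
        unfolding opset_power_singleton by blast
      have "op_bound M D (L * t ^ n)"
      proof (rule op_bound_hadamard_mean[OF m _ _ D])
        fix j B assume j: "j \<in> {1..m}" and B: "B \<in> {A j ^^ n}"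
        have "op_bound M (A j ^^ n) (L * t ^ n)"
          by (rule op_bound_mono[OF K(2)[OF j]]) (use t L[OF j] in \<open>auto intro: mult_right_mono\<close>)
        then show "linear_op M B \<and> op_bound M B (L * t ^ n)"
          using B linear_op_funpow[OF lin[OF j]] by simp
      qed (use t L1 in auto)
      then show ?thesis
        by (intro dominated_op_bound[OF dom] linear_op_funpow positive_op_linear
              positive_op_hadamard_mean[OF E] positive_op_hadamard_mean[OF D])
    qed
  qed
qed

text \<open>Fixing the factors of one element \<open>E\<close> keeps them the same in all powers of
  \<open>E\<close>, so that rates known for the individual factors can be used.\<close>

lemma hadamard_mean_singletons:
  assumes "\<And>j A. j \<in> {1..m} \<Longrightarrow> A \<in> \<Phi> j \<Longrightarrow> linear_op M A" and E: "E \<in> hadamard_mean M m \<Phi>"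
  obtains A where "\<And>j. j \<in> {1..m} \<Longrightarrow> A j \<in> \<Phi> j" "\<And>j. j \<in> {1..m} \<Longrightarrow> positive_op M (A j)"
    "E \<in> hadamard_mean M m (\<lambda>j. {A j})"
proof -
  obtain A a where A: "\<And>j. j \<in> {1..m} \<Longrightarrow> A j \<in> \<Phi> j \<and> pos_kernel M (A j) (a j)"
    and Ek: "pos_kernel M E (kernel_mean {1..m} a)"
    using E hadamard_mean_iff[of m \<Phi> M E] assms(1) by blast
  show thesis
  proof (rule that)
    show "E \<in> hadamard_mean M m (\<lambda>j. {A j})"
      using A Ek pos_kernel_linear by (intro iffD2[OF hadamard_mean_iff] exI[of _ A] exI[of _ a]) auto
  qed (use A pos_kernel_positive in auto)
qed

end

section \<open>The chain of inequalities\<close>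

locale positive_op_sets = sigma_finite_measure M for M :: "'a measure" +
  fixes m :: nat and \<Psi> :: "nat \<Rightarrow> 'a op set"
  assumes odd_m: "odd m"
    and bounded_\<Psi>: "j \<in> {1..m} \<Longrightarrow> bounded_op_set M (\<Psi> j)"
    and positive_\<Psi>: "j \<in> {1..m} \<Longrightarrow> A \<in> \<Psi> j \<Longrightarrow> positive_op M A"
begin

abbreviation "P \<equiv> pair_factor M m \<Psi>"
abbreviation "Om \<equiv> Omega M m \<Psi>"
abbreviation "pair_mean \<equiv> hadamard_mean M m P"
abbreviation "Omega_mean \<equiv> hadamard_mean M m Om"

lemma m_ge_1: "1 \<le> m"
  using odd_m by (cases m) auto

lemma bounded_P: "bounded_op_set M (P j)"
  unfolding pair_factor_def
  by (intro bounded_op_set_mult bounded_op_set_adjoint bounded_\<Psi> cyc_in m_ge_1)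

lemma positive_P: "A \<in> P j \<Longrightarrow> positive_op M A"
  unfolding pair_factor_def
  by (rule positive_op_set_mult[of "\<Psi> (cyc m (2 * j - 1))" M "opset_adjoint M (\<Psi> (cyc m (2 * j)))"])
     (auto simp: opset_adjoint_def intro: positive_\<Psi>[OF cyc_in[OF m_ge_1]] is_adjoint_positive)

lemma Om_rotate:
  assumes "j \<in> {1..m}"
  obtains U V where "bounded_op_set M U" "bounded_op_set M V"
    "Om 1 = opset_mult U V" "Om j = opset_mult V U"
proof -
  obtain Us Vs where s: "set Us \<union> set Vs \<subseteq> P ` {1..m}"
    and eq: "Om 1 = opset_prod (Us @ Vs)" "Om j = opset_prod (Vs @ Us)"
    using Omega_rotate[OF assms] .
  from s have "bounded_op_set M (opset_prod Us)" "bounded_op_set M (opset_prod Vs)"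
    by (auto intro!: bounded_op_set_prod simp: bounded_P)
  then show thesis by (rule that) (simp_all only: eq opset_prod_append)
qed

lemma bounded_Om: "j \<in> {1..m} \<Longrightarrow> bounded_op_set M (Om j)"
  by (rule Om_rotate[of j]) (auto intro: bounded_op_set_mult)

lemma positive_Om: "A \<in> Om 1 \<Longrightarrow> positive_op M A"
  by (subst (asm) Omega_eq_prod) (auto elim!: positive_op_set_prod[rotated] intro: positive_P)

lemma bounded_pair_mean: "bounded_op_set M pair_mean"
  by (intro bounded_op_set_hadamard_mean m_ge_1 bounded_P)

lemma bounded_Omega_mean: "bounded_op_set M Omega_mean"
  by (intro bounded_op_set_hadamard_mean m_ge_1 bounded_Om)

text \<open>\<open>C\<close> is read in the order j -> 2 j - 1 and its adjoint in the order j -> 2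
  j, so that slot j of the product lies in \<open>P j\<close>.\<close>

lemma domination_pair_mean:
  assumes C: "C \<in> hadamard_mean M m \<Psi>"
  obtains D E where "is_adjoint M C D" "E \<in> pair_mean" "dominated M (C \<circ> D) E"
proof -
  obtain D where D: "is_adjoint M C D" "D \<in> hadamard_mean M m (\<lambda>j. opset_adjoint M (\<Psi> j))"
    using hadamard_mean_adjoint[OF m_ge_1 bounded_\<Psi> C] by blast
  have lin: "linear_op M A" if "j \<in> {1..m}" "A \<in> \<Psi> j" for j A
    using positive_\<Psi>[OF that] by (rule positive_op_linear)
  have lin': "linear_op M A" if "A \<in> opset_adjoint M (\<Psi> j)" for j A
    using that by (auto simp: opset_adjoint_def is_adjoint_def)
  have C': "C \<in> hadamard_mean M m (\<lambda>j. \<Psi> (cyc m (2 * j - 1)))"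
    using hadamard_mean_reindex[OF bij_betw_cyc(1)[OF odd_m], of M \<Psi>] C by blast
  have D': "D \<in> hadamard_mean M m (\<lambda>j. opset_adjoint M (\<Psi> (cyc m (2 * j))))"
    using hadamard_mean_reindex[OF bij_betw_cyc(2)[OF odd_m], of M "\<lambda>j. opset_adjoint M (\<Psi> j)"] D by blast
  have "domination_set M (opset_mult (hadamard_mean M m (\<lambda>j. \<Psi> (cyc m (2 * j - 1))))
      (hadamard_mean M m (\<lambda>j. opset_adjoint M (\<Psi> (cyc m (2 * j)))))) pair_mean"
    unfolding pair_factor_def[abs_def]
    using lin[OF cyc_in[OF m_ge_1]] lin' by (intro domination_set_hadamard_mean_mult m_ge_1)
  from domination_setD[OF this opset_multI[OF C' D']] show thesis using that[OF D(1)] by blast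
qed

text \<open>The copy of \<open>pair_mean\<close> with number l is read with its factors shifted by
  l. Slot j then collects the pair factors once around the cycle from j on, which is
  \<open>Om j\<close>.\<close>

lemma domination_pair_mean_power: "domination_set M (opset_power pair_mean m) Omega_mean"
proof -
  let ?\<Phi> = "\<lambda>l j. P (cyc m (j + l))"
  have sub: "pair_mean \<subseteq> hadamard_mean M m (?\<Phi> l)" for l
    by (rule hadamard_mean_reindex[OF bij_betw_cyc(3)[OF odd_m]])
  have mono: "opset_prod (replicate (length ls) pair_mean) \<subseteq> opset_prod (map (hadamard_mean M m) (map ?\<Phi> ls))" for ls
  proof (induction ls)
    case (Cons l ls)
    show ?case using opset_mult_mono[OF sub[of l] Cons] by simp
  qed simp
  have "map ?\<Phi> [0..<m] \<noteq> []" using m_ge_1 by simp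
  from domination_set_hadamard_mean_prod[OF m_ge_1 this]
  have "domination_set M (opset_prod (map (hadamard_mean M m) (map ?\<Phi> [0..<m])))
     (hadamard_mean M m (\<lambda>j. opset_prod (map (\<lambda>\<Phi>. \<Phi> j) (map ?\<Phi> [0..<m]))))"
    using bounded_P by auto
  \<comment> \<open>\<open>Omega_eq_prod\<close> needs j >= 1, so the two families are compared
    inside the definition, where only the indices in \<open>{1..m}\<close> count.\<close>
  moreover have "hadamard_mean M m (\<lambda>j. opset_prod (map (\<lambda>\<Phi>. \<Phi> j) (map ?\<Phi> [0..<m]))) = Omega_mean"
    unfolding opset_hadamard_def by (simp add: Omega_eq_prod comp_def)
  ultimately show ?thesis
    using mono[of "[0..<m]"] unfolding domination_set_def opset_power_def by auto
qed

lemma domination_pair_mean_power_power: "domination_set M (opset_power pair_mean (m * k)) (opset_power Omega_mean k)"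
  unfolding opset_power_mult
  by (rule domination_set_power[OF domination_pair_mean_power])
     (use bounded_op_set_power[OF bounded_pair_mean, of m] positive_op_hadamard_mean in \<open>auto simp: bounded_op_set_iff\<close>)

lemma linear_pair_mean_power: "A \<in> opset_power pair_mean k \<Longrightarrow> linear_op M A"
  using bounded_op_set_power[OF bounded_pair_mean, of k] by (auto simp: bounded_op_set_iff)

lemma positive_pair_mean_power: "A \<in> opset_power pair_mean k \<Longrightarrow> positive_op M A"
  by (rule positive_op_set_power[of pair_mean]) (auto intro: positive_op_hadamard_mean)

lemma linear_Omega_mean_power: "A \<in> opset_power Omega_mean k \<Longrightarrow> linear_op M A"
  using bounded_op_set_power[OF bounded_Omega_mean, of k] by (auto simp: bounded_op_set_iff)

lemma positive_Omega_mean_power: "A \<in> opset_power Omega_mean k \<Longrightarrow> positive_op M A"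
  by (rule positive_op_set_power[of Omega_mean]) (auto intro: positive_op_hadamard_mean)

lemma opset_norm_le:
  assumes g: "\<And>E. E \<in> pair_mean \<Longrightarrow> growth M E t" and t: "0 < t"
  shows "opset_norm M (hadamard_mean M m \<Psi>) \<le> sqrt t"
  unfolding opset_norm_def
proof (rule nonneg_Sup_least)
  fix x assume "x \<in> op_norm M ` hadamard_mean M m \<Psi>"
  then obtain C where C: "C \<in> hadamard_mean M m \<Psi>" "x = op_norm M C" by blast
  obtain D E where D: "is_adjoint M C D" and E: "E \<in> pair_mean" "dominated M (C \<circ> D) E"
    using domination_pair_mean[OF C(1)] .
  have lin: "linear_op M C" "linear_op M D"
    using D positive_op_linear[OF positive_op_hadamard_mean[OF C(1)]] by (simp_all add: is_adjoint_def)
  have "growth M (C \<circ> D) t"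
    by (rule dominated_growth[OF E(2) linear_op_comp[OF lin] positive_op_hadamard_mean[OF E(1)] g[OF E(1)]])
  then show "x \<le> sqrt t" unfolding C(2)
    using t by (intro op_norm_le op_bound_of_growth_adjoint[OF D lin(1)]) auto
qed (use t in simp)

text \<open>One step of \<open>Omega_mean\<close> accounts for m steps of \<open>pair_mean\<close>,
  hence the m-th root; lengths that are not multiples of m cost only a constant.\<close>

lemma set_growth_pair_mean:
  assumes g: "set_growth M Omega_mean t" and t: "0 < t"
  shows "set_growth M pair_mean (t powr (1 / real m))"
proof -
  obtain K where K: "0 \<le> K" "\<And>k A. A \<in> opset_power Omega_mean k \<Longrightarrow> op_bound M A (K * t ^ k)"
    using g unfolding set_growth_def by blast
  have tm: "(t powr (1 / real m)) ^ m = t" using t m_ge_1 by (intro powr_inverse_power) auto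
  show ?thesis
  proof (rule set_growth_of_subsequence[OF bounded_pair_mean _ m_ge_1 K(1)])
    fix d A assume A: "A \<in> opset_power pair_mean (m * d)"
    from domination_setD[OF domination_pair_mean_power_power this]
    obtain B where B: "B \<in> opset_power Omega_mean d" "dominated M A B" by blast
    show "op_bound M A (K * ((t powr (1 / real m)) ^ m) ^ d)"
      unfolding tm by (rule dominated_op_bound[OF B(2) linear_pair_mean_power[OF A] linear_Omega_mean_power[OF B(1)] K(2)[OF B(1)]])
  qed (use t in simp)
qed

text \<open>Each \<open>Om j\<close> inherits the rate of \<open>Om 1\<close> by rotation, with a
  constant of its own. \<open>L\<close> bounds all these constants, and a Hadamard mean preserves a
  common bound.\<close>

lemma set_growth_Omega_mean:
  assumes g: "set_growth M (Om 1) t" and t: "0 < t"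
  shows "set_growth M Omega_mean t"
proof -
  have "\<exists>K\<ge>0. \<forall>k. \<forall>A\<in>opset_power (Om j) k. op_bound M A (K * t ^ k)" if j: "j \<in> {1..m}" for j
  proof -
    obtain U V where "bounded_op_set M U" "bounded_op_set M V" "Om 1 = opset_mult U V" "Om j = opset_mult V U"
      using Om_rotate[OF j] .
    then have "set_growth M (Om j) t" using set_growth_swap[of M U V t] g t by simp
    then show ?thesis unfolding set_growth_def .
  qed
  then obtain K where K: "\<And>j. j \<in> {1..m} \<Longrightarrow> 0 \<le> K j"
    "\<And>j k A. j \<in> {1..m} \<Longrightarrow> A \<in> opset_power (Om j) k \<Longrightarrow> op_bound M A (K j * t ^ k)" by metis
  define L where "L = max 1 (\<Sum>j\<in>{1..m}. K j)"
  have L: "K j \<le> L" if "j \<in> {1..m}" for j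
    using K(1) that member_le_sum[of j "{1..m}" K] by (auto simp: L_def)
  have L1: "1 \<le> L" by (simp add: L_def)
  have "op_bound M A (L * t ^ k)" if A: "A \<in> opset_power Omega_mean k" for k A
  proof (cases k)
    case 0
    then have "A = id" using A by simp
    then show ?thesis using op_bound_mono[OF op_bound_id L1] 0 by simp
  next
    case (Suc l)
    have "domination_set M (opset_power Omega_mean k) (hadamard_mean M m (\<lambda>j. opset_power (Om j) k))"
      using Suc by (intro domination_set_hadamard_mean_power m_ge_1 bounded_Om) auto
    from domination_setD[OF this A]
    obtain D where D: "D \<in> hadamard_mean M m (\<lambda>j. opset_power (Om j) k)" "dominated M A D" by blast
    have "op_bound M D (L * t ^ k)"
    proof (rule op_bound_hadamard_mean[OF m_ge_1 _ _ D(1)])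
      fix j B assume j: "j \<in> {1..m}" and B: "B \<in> opset_power (Om j) k"
      have "op_bound M B (L * t ^ k)"
        by (rule op_bound_mono[OF K(2)[OF j B]]) (use t L[OF j] in \<open>auto intro: mult_right_mono\<close>)
      then show "linear_op M B \<and> op_bound M B (L * t ^ k)"
        using B bounded_op_set_power[OF bounded_Om[OF j], of k] by (auto simp: bounded_op_set_iff)
    qed (use t L1 in auto)
    then show ?thesis
      by (rule dominated_op_bound[OF D(2) linear_Omega_mean_power[OF A] positive_op_linear[OF positive_op_hadamard_mean[OF D(1)]]])
  qed
  then show ?thesis unfolding set_growth_def by (intro exI[of _ L]) (use L1 in auto)
qed

text \<open>Raising A to the power m gives a length at which domination applies: A^m is dominated by
  an element of the k-th power of \<open>Omega_mean\<close>, whose rate comes from its spectral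
  radius. The rate of A^m is then an m-th power and descends to A.\<close>

lemma spectral_radius_pair_mean_power:
  assumes A: "A \<in> opset_power pair_mean k" and t: "0 < t" and k: "1 \<le> k"
    and le: "\<And>B. B \<in> opset_power Omega_mean k \<Longrightarrow> spectral_radius_op M B < t ^ k"
  shows "spectral_radius_op M A \<le> (t powr (1 / real m)) ^ k"
proof -
  have "A ^^ m \<in> opset_power pair_mean (m * k)"
    using funpow_in_opset_power[OF A, of m] by (simp add: opset_power_mult[symmetric] mult.commute)
  from domination_setD[OF domination_pair_mean_power_power this]
  obtain B where B: "B \<in> opset_power Omega_mean k" "dominated M (A ^^ m) B" by blast
  have Bb: "bounded_op M B"
    using bounded_op_set_power[OF bounded_Omega_mean] B(1) by (rule bounded_op_set_bounded_op)
  have Ab: "bounded_op M A"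
    using bounded_op_set_power[OF bounded_pair_mean] A by (rule bounded_op_set_bounded_op)
  have "growth M B (t ^ k)"
    by (rule growth_of_spectral_radius_less[OF positive_Omega_mean_power[OF B(1)] Bb le[OF B(1)]])
  then have "growth M (A ^^ m) (t ^ k)"
    by (rule dominated_growth[OF B(2) linear_op_funpow[OF linear_pair_mean_power[OF A]] positive_Omega_mean_power[OF B(1)]])
  also have "t ^ k = ((t powr (1 / real m)) ^ k) ^ m"
    using t m_ge_1 powr_inverse_power[of t m] by (simp flip: power_mult) (simp add: mult.commute[of k] power_mult)
  finally have "growth M A ((t powr (1 / real m)) ^ k)"
    using t by (intro growth_root[OF Ab _ m_ge_1]) auto
  then show ?thesis using t by (intro spectral_radius_le_growth linear_pair_mean_power[OF A]) auto
qed

text \<open>The factors \<open>B j\<close> of the dominating element come from different sets. Each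
  has the form v w with w v in the k-th power of \<open>Om 1\<close>, where the spectral radius is
  controlled; both orders have the same rates.\<close>

lemma spectral_radius_Omega_mean_power:
  assumes A: "A \<in> opset_power Omega_mean k" and t: "0 < t" and k: "1 \<le> k"
    and le: "\<And>B. B \<in> opset_power (Om 1) k \<Longrightarrow> spectral_radius_op M B < t ^ k"
  shows "spectral_radius_op M A \<le> t ^ k"
proof -
  have "domination_set M (opset_power Omega_mean k) (hadamard_mean M m (\<lambda>j. opset_power (Om j) k))"
    using k by (intro domination_set_hadamard_mean_power m_ge_1 bounded_Om) auto
  from domination_setD[OF this A]
  obtain E where E: "E \<in> hadamard_mean M m (\<lambda>j. opset_power (Om j) k)" "dominated M A E" by blast
  have bdd: "bounded_op M B" if "j \<in> {1..m}" "B \<in> opset_power (Om j) k" for j B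
    using bounded_op_set_power[OF bounded_Om[OF that(1)]] that(2) by (rule bounded_op_set_bounded_op)
  then have lin: "linear_op M B" if "j \<in> {1..m}" "B \<in> opset_power (Om j) k" for j B
    using that by (auto simp: bounded_op_iff)
  obtain B where B: "\<And>j. j \<in> {1..m} \<Longrightarrow> B j \<in> opset_power (Om j) k"
    and EB: "E \<in> hadamard_mean M m (\<lambda>j. {B j})"
    by (rule hadamard_mean_singletons[OF _ E(1)]) (use lin in blast)+
  have "growth M (B j) (t ^ k)" if j: "j \<in> {1..m}" for j
  proof -
    obtain U V where UV: "bounded_op_set M U" "bounded_op_set M V"
      and eq: "Om 1 = opset_mult U V" "Om j = opset_mult V U"
      using Om_rotate[OF j] .
    obtain l where l: "k = Suc l" using k by (cases k) auto
    obtain v w where v: "v \<in> V" and w: "w \<in> opset_mult (opset_power (Om 1) l) U" and Bj: "B j = v \<circ> w"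
      using B[OF j] unfolding eq l opset_power_swap by (rule opset_multE)
    have "w \<circ> v \<in> opset_mult (opset_mult (opset_power (Om 1) l) U) V"
      by (rule opset_multI[OF w v])
    then have "w \<circ> v \<in> opset_mult (opset_power (Om 1) l) (Om 1)"
      unfolding opset_mult_assoc eq(1)[symmetric] .
    then have wv: "w \<circ> v \<in> opset_power (Om 1) k"
      using opset_power_add[of "Om 1" l "Suc 0"] unfolding l opset_power_1 by simp
    have vb: "bounded_op M v" using UV(2) v by (rule bounded_op_set_bounded_op)
    have "bounded_op_set M (Om 1)" using m_ge_1 by (intro bounded_Om) auto
    then have wb: "bounded_op M w"
      using bounded_op_set_bounded_op[OF bounded_op_set_mult[OF bounded_op_set_power UV(1)] w] by blast
    have "growth M (w \<circ> v) (t ^ k)"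
    proof (rule growth_of_spectral_radius_less[OF _ _ le[OF wv]])
      show "positive_op M (w \<circ> v)"
        by (rule positive_op_set_power[OF _ wv]) (rule positive_Om)
      show "bounded_op M (w \<circ> v)" using bdd[of 1] wv m_ge_1 by auto
    qed
    then show ?thesis unfolding Bj using t by (intro growth_swap[OF wb vb]) auto
  qed
  then have "growth M E (t ^ k)"
    using bdd B t by (intro growth_hadamard_mean[OF m_ge_1 _ _ EB]) auto
  then have "growth M A (t ^ k)"
    by (rule dominated_growth[OF E(2) linear_Omega_mean_power[OF A] positive_op_hadamard_mean[OF E(1)]])
  then show ?thesis using t by (intro spectral_radius_le_growth linear_Omega_mean_power[OF A]) auto
qed

text \<open>The common interface of the two radii: nonnegativity and consequences of r < t. It lets
  the final chain be proved once for both.\<close>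

lemma spectral_radii_properties:
  assumes r: "r \<in> {generalized_spectral_radius M, joint_spectral_radius M}"
  shows "0 \<le> r pair_mean" "0 \<le> r Omega_mean" "0 \<le> r (Om 1)"
    and "r pair_mean < t \<Longrightarrow> E \<in> pair_mean \<Longrightarrow> growth M E t"
    and "r Omega_mean < t \<Longrightarrow> r pair_mean \<le> t powr (1 / real m)"
    and "r (Om 1) < t \<Longrightarrow> r Omega_mean \<le> t"
proof -
  have bOm: "bounded_op_set M (Om 1)" using m_ge_1 by (intro bounded_Om) auto
  note b = bounded_pair_mean bounded_Omega_mean bOm
  show nn: "0 \<le> r pair_mean" "0 \<le> r Omega_mean" "0 \<le> r (Om 1)"
    using r generalized_spectral_radius_ereal(2) joint_spectral_radius_properties(1) b by auto
  \<comment> \<open>A value s between the radius and t turns the weak bound by s^k into a strict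
    bound by t^k for k >= 1.\<close>
  have strict: "\<forall>\<^sub>F k in sequentially. \<forall>A\<in>opset_power \<Sigma> k. spectral_radius_op M A < t ^ k"
    if \<Sigma>: "bounded_op_set M \<Sigma>" and lt: "generalized_spectral_radius M \<Sigma> < t" for \<Sigma> t
  proof -
    obtain s where s: "generalized_spectral_radius M \<Sigma> < s" "s < t" using dense lt by blast
    have s0: "0 \<le> s" using s(1) generalized_spectral_radius_ereal(2)[OF \<Sigma>] by linarith
    show ?thesis
      using generalized_spectral_radius_less[OF \<Sigma> s(1)] eventually_ge_at_top[of 1]
    proof eventually_elim
      case (elim k)
      have "s ^ k < t ^ k" using s s0 elim(2) by (intro power_strict_mono) auto
      then show ?case using elim(1) by force
    qed
  qed
  show "growth M E t" if lt: "r pair_mean < t" and E: "E \<in> pair_mean"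
  proof -
    have t: "0 < t" using nn lt by linarith
    have Eb: "bounded_op M E" using bounded_pair_mean E by (rule bounded_op_set_bounded_op)
    consider "r = generalized_spectral_radius M" | "r = joint_spectral_radius M" using r by blast
    then show ?thesis
    proof cases
      case 1
      have "\<forall>\<^sub>F k in sequentially. 1 \<le> k \<and> (\<forall>A\<in>opset_power pair_mean k. spectral_radius_op M A < t ^ k)"
        using strict[OF bounded_pair_mean, of t] lt 1 by (simp add: eventually_conj eventually_ge_at_top)
      then obtain k where k: "1 \<le> k" "\<And>A. A \<in> opset_power pair_mean k \<Longrightarrow> spectral_radius_op M A < t ^ k"
        by (auto simp: eventually_sequentially)
      \<comment> \<open>One suitable k is enough: the power \<open>E ^^ k\<close> gets the rate t^k,
        and \<open>growth_root\<close> returns to \<open>E\<close>.\<close>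
      have Ek: "E ^^ k \<in> opset_power pair_mean k" by (rule funpow_in_opset_power[OF E])
      have "growth M (E ^^ k) (t ^ k)"
        using bounded_op_set_bounded_op[OF bounded_op_set_power[OF bounded_pair_mean] Ek]
        by (intro growth_of_spectral_radius_less positive_pair_mean_power[OF Ek] k(2)[OF Ek])
      then show ?thesis by (rule growth_root[OF Eb t k(1)])
    next
      case 2
      then obtain K where "0 \<le> K" "\<And>k A. A \<in> opset_power pair_mean k \<Longrightarrow> op_bound M A (K * t ^ k)"
        using joint_spectral_radius_properties(2)[OF bounded_pair_mean] lt unfolding set_growth_def by blast
      then show ?thesis using funpow_in_opset_power[OF E] by (intro growthI[of K]) auto
    qed
  qed
  show "r pair_mean \<le> t powr (1 / real m)" if lt: "r Omega_mean < t"
  proof -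
    have t: "0 < t" using nn lt by linarith
    consider "r = generalized_spectral_radius M" | "r = joint_spectral_radius M" using r by blast
    then show ?thesis
    proof cases
      case 1
      have "\<forall>\<^sub>F k in sequentially. \<forall>A\<in>opset_power pair_mean k. spectral_radius_op M A \<le> (t powr (1 / real m)) ^ k"
        using strict[OF bounded_Omega_mean lt[unfolded 1]] eventually_ge_at_top[of 1]
        by eventually_elim (auto intro: spectral_radius_pair_mean_power t)
      then show ?thesis unfolding 1 by (intro generalized_spectral_radius_le bounded_pair_mean) auto
    next
      case 2
      then show ?thesis
        using joint_spectral_radius_properties(2)[OF bounded_Omega_mean] joint_spectral_radius_properties(3)[OF bounded_pair_mean]
          set_growth_pair_mean lt t by auto
    qed
  qed
  show "r Omega_mean \<le> t" if lt: "r (Om 1) < t"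
  proof -
    have t: "0 < t" using nn lt by linarith
    consider "r = generalized_spectral_radius M" | "r = joint_spectral_radius M" using r by blast
    then show ?thesis
    proof cases
      case 1
      have "\<forall>\<^sub>F k in sequentially. \<forall>A\<in>opset_power Omega_mean k. spectral_radius_op M A \<le> t ^ k"
        using strict[OF bOm lt[unfolded 1]] eventually_ge_at_top[of 1]
        by eventually_elim (auto intro: spectral_radius_Omega_mean_power t)
      then show ?thesis unfolding 1 using t by (intro generalized_spectral_radius_le bounded_Omega_mean) auto
    next
      case 2
      then show ?thesis
        using joint_spectral_radius_properties(2)[OF bOm] joint_spectral_radius_properties(3)[OF bounded_Omega_mean]
          set_growth_Omega_mean lt t by auto
    qed
  qed
qed

lemma spectral_radii_chain:
  assumes r: "r \<in> {generalized_spectral_radius M, joint_spectral_radius M}"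
  shows "opset_norm M (hadamard_mean M m \<Psi>) \<le> r pair_mean powr (1 / 2)"
    and "r pair_mean powr (1 / 2) \<le> r Omega_mean powr (1 / (2 * real m))"
    and "r Omega_mean powr (1 / (2 * real m)) \<le> r (Om 1) powr (1 / (2 * real m))"
proof -
  note p = spectral_radii_properties[OF r]
  let ?N = "opset_norm M (hadamard_mean M m \<Psi>)"
  \<comment> \<open>Nonnegativity of \<open>?N\<close> is not at hand, and squaring needs it; for
    negative \<open>?N\<close> the claim is immediate.\<close>
  have "?N\<^sup>2 \<le> r pair_mean \<or> ?N < 0"
  proof (rule disjCI)
    assume N: "\<not> ?N < 0"
    show "?N\<^sup>2 \<le> r pair_mean"
    proof (rule dense_ge)
      fix t assume t: "r pair_mean < t"
      then have "0 < t" using p(1) by linarith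
      then have "?N \<le> sqrt t" using p(4)[OF t] by (intro opset_norm_le) auto
      then have "?N\<^sup>2 \<le> (sqrt t)\<^sup>2" using N by (intro power_mono) auto
      then show "?N\<^sup>2 \<le> t" using \<open>0 < t\<close> by simp
    qed
  qed
  then show "?N \<le> r pair_mean powr (1 / 2)"
    using p(1) by (auto simp: powr_half_sqrt intro: real_le_rsqrt order_trans[OF less_imp_le])
  \<comment> \<open>Comparing m-th powers avoids a limit of roots: the estimate \<open>p(5)\<close>
    becomes a bound by t itself.\<close>
  have "r pair_mean ^ m \<le> r Omega_mean"
  proof (rule dense_ge)
    fix t assume t: "r Omega_mean < t"
    then have t0: "0 < t" using p(2) by linarith
    have "r pair_mean ^ m \<le> (t powr (1 / real m)) ^ m" by (intro power_mono p(5)[OF t] p(1))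
    then show "r pair_mean ^ m \<le> t" using powr_inverse_power[of t m] t0 m_ge_1 by simp
  qed
  then have "(r pair_mean ^ m) powr (1 / (2 * real m)) \<le> r Omega_mean powr (1 / (2 * real m))"
    using p(1) by (intro powr_mono2) auto
  moreover have "(r pair_mean ^ m) powr (1 / (2 * real m)) = ((r pair_mean ^ m) powr (1 / real m)) powr (1 / 2)"
    by (simp add: powr_powr mult.commute)
  ultimately show "r pair_mean powr (1 / 2) \<le> r Omega_mean powr (1 / (2 * real m))"
    using power_powr_inverse[OF p(1) m_ge_1] by simp
  have "r Omega_mean \<le> r (Om 1)" by (rule dense_ge) (rule p(6))
  then show "r Omega_mean powr (1 / (2 * real m)) \<le> r (Om 1) powr (1 / (2 * real m))"
    using p(2) by (intro powr_mono2) auto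
qed

end

theorem theorem3p5:
  fixes M :: "'a measure"
    and m :: nat
    and \<Psi> :: "nat \<Rightarrow> 'a op set"
    and r :: "'a op set \<Rightarrow> real"
  assumes "sigma_finite_measure M"
    and "space M \<noteq> {}"
    and "odd m"
    and "\<And>j. j \<in> {1..m} \<Longrightarrow> bounded_op_set M (\<Psi> j)"
    and "\<And>j A. j \<in> {1..m} \<Longrightarrow> A \<in> \<Psi> j \<Longrightarrow> positive_kernel_op M A"
    and "r \<in> {generalized_spectral_radius M, joint_spectral_radius M}"
  shows "opset_norm M (opset_hadamard M {1..m} (\<lambda>_. 1 / real m) \<Psi>)
           \<le> r (opset_hadamard M {1..m} (\<lambda>_. 1 / real m) (pair_factor M m \<Psi>)) powr (1 / 2) \<and>
         r (opset_hadamard M {1..m} (\<lambda>_. 1 / real m) (pair_factor M m \<Psi>)) powr (1 / 2)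
           \<le> r (opset_hadamard M {1..m} (\<lambda>_. 1 / real m) (Omega M m \<Psi>)) powr (1 / (2 * real m)) \<and>
         r (opset_hadamard M {1..m} (\<lambda>_. 1 / real m) (Omega M m \<Psi>)) powr (1 / (2 * real m))
           \<le> r (Omega M m \<Psi> 1) powr (1 / (2 * real m))"
proof -
  interpret positive_op_sets M m \<Psi>
  proof (intro positive_op_sets.intro positive_op_sets_axioms.intro assms(1,3,4))
    show "positive_op M A" if "j \<in> {1..m}" "A \<in> \<Psi> j" for j A
      using assms(5)[OF that] by (simp add: positive_kernel_op_def)
  qed
  show ?thesis using spectral_radii_chain[OF assms(6)] by blast
qed

end
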